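(* As power series (Laurent series where negative powers appear) in $q$, $|q|<1$: (1) \begin{align*} \sum_{n\ge0}N^{0}(0,8;2n+1)q^n=&-q^{21}g(-q^{32};q^{64})+q^5\frac{J_{32}^8J_{128}^2}{J_{16}^4J_{64}^5}+\frac{1}{4}\frac{J_{2}^8J_{8}^2}{J_{1}^4J_{4}^5}+\frac{1}{4}\frac{J_{4}^3}{J_{2}^2}+\frac{1}{2}\frac{J_{2}^5J_{16}}{J_{1}^2J_{4}^2J_{8}}-\frac{1}{2}q\frac{J_{8}^8J_{32}^2}{J_{4}^4J_{16}^5}-\frac{1}{2}q\frac{J_{16}^3}{J_{8}^2},\\ \sum_{n\ge0}N^{0}(0,8;4n+1)q^n=&\frac{1}{4}\left(\frac{J_{2}^9}{J_{1}^6J_{4}^2} +\frac{J_{2}^3}{J_{1}^2}+2\frac{J_{4}^4}{J_{8}J_{2}^2}\right),\\ \sum_{n\ge0}N^{0}(0,8;4n+3)q^n=&-q^{10}g(-q^{16};q^{32})+q^2\frac{J_{16}^8J_{64}^2}{J_{8}^4J_{32}^5}+\frac{1}{2}\frac{J_{8}^3}{J_{4}^2}+\frac{J_{4}^6}{J_{1}^2J_{2}^3}-\frac{1}{2}\frac{J_{4}^8J_{16}^2}{J_{2}^4J_{8}^5},\\ \sum_{n\ge0}N^{0}(0,8;8n+1)q^n=&\frac{1}{2}\frac{J_{2}^4}{J_{1}^2J_4}+\frac{1}{4}\frac{J_{4}^5}{J_{1}^2J_{8}^2}+\frac{1}{4}\frac{J_{2}^{12}J_{4}}{J_{1}^{10}J_{8}^2}+2q\frac{J_{2}^2J_{4}^3J_{8}^2}{J_{1}^6},\\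 \sum_{n\ge0}N^{0}(0,8;8n+3)q^n=&-q^5g(-q^8;q^{16})+q\frac{J_{8}^8J_{32}^2}{J_{4}^4J_{16}^5}+\frac{1}{2}\frac{J_{4}^3}{J_{2}^2}-\frac{1}{2}\frac{J_{2}^8J_{8}^2}{J_{1}^4J_{4}^5}+\frac{J_{2}^6J_{4}^5}{J_{1}^8J_{8}^2},\\ \sum_{n\ge0}N^{0}(0,8;8n+5)q^n=&2\frac{J_{4}^9}{J_{1}^6J_{8}^2},\qquad \sum_{n\ge0}N^{0}(0,8;8n+7)q^n=2\frac{J_{2}^8J_{8}^2}{J_{1}^8J_{4}}. \end{align*} (2) \begin{align*} \sum_{n\ge0}N^{0}(1,8;2n)q^n=&-\frac{1}{4}+\frac{1}{4}g(-1;q^4)+\frac{1}{2}q^4g(q^4;q^{16})+\frac{1}{8}\frac{J_{2}^6J_{4}}{J_{1}^4J_{8}^2}-\frac{1}{4}\frac{J_{8}^7}{J_{4}^3J_{16}^3}+\frac{1}{4}\frac{J_{2}^5J_{8}^2}{J_{1}^2J_{4}^3J_{16}},\\ \sum_{n\ge0}N^{0}(1,8;4n)q^n=&-\frac{1}{4}+\frac{1}{4}g(-1;q^2)+\frac{1}{2}q^2g(q^2;q^8)+\frac{1}{8}\frac{J_{2}^{15}}{J_{1}^8J_{4}^6},\qquad \sum_{n\ge0}N^{0}(1,8;4n+2)q^n=\frac{1}{2}\left(\frac{J_{2}^3J_{4}^2}{J_{1}^4}+\frac{J_4J_8}{J_2} \right),\\ \sum_{n\ge0}N^{0}(1,8;8n)q^n=&-\frac{1}{4}+\frac{1}{4}g(-1;q)+\frac{1}{2}qg(q;q^4)+\frac{1}{8}\frac{J_{2}^{22}}{J_{1}^{13}J_{4}^8}+2q\frac{J_{4}^8}{J_{1}^5J_{2}^2},\\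 \sum_{n\ge0}N^{0}(1,8;8n+2)q^n=&\frac{1}{2}\left(\frac{J_{2}^{16}}{J_{1}^{11}J_{4}^4}+\frac{J_2J_4}{J_1} \right),\qquad \sum_{n\ge0}N^{0}(1,8;8n+4)q^n=\frac{J_{2}^{10}}{J_{1}^9},\qquad \sum_{n\ge0}N^{0}(1,8;8n+6)q^n=2\frac{J_{2}^4J_{4}^4}{J_{1}^7}. \end{align*} (3) \begin{align*} \sum_{n\ge0}N^{0}(2,8;2n+1)q^n=&-\frac{1}{2}q^{-1}+\frac{1}{2}q^{-1}g(-1;q^{16})+\frac{1}{4}q^{-1}\frac{J_{8}^{6}J_{16}}{J_{4}^4J_{32}^2}+\frac{1}{4}\frac{J_{2}^8J_{8}^2}{J_{4}^5J_{1}^4}-\frac{1}{4}\frac{J_{4}^3}{J_{2}^2},\\ \sum_{n\ge0}N^{0}(2,8;4n+1)q^n=&q\frac{J_{2}^4J_{16}^2}{J_{1}^4J_{8}},\qquad \sum_{n\ge0}N^{0}(2,8;4n+3)q^n=-\frac{1}{2}q^{-1}+\frac{1}{2}q^{-1}g(-1;q^8)+\frac{1}{4}q^{-1}\frac{J_{4}^6J_{8}}{J_{2}^4J_{16}^2}+\frac{J_{4}^6}{J_{1}^2J_{2}^3},\\ \sum_{n\ge0}N^{0}(2,8;8n+1)q^n=&4q\frac{J_{2}^2J_{4}^3J_{8}^2}{J_{1}^6},\qquad \sum_{n\ge0}N^{0}(2,8;8n+3)q^n=\frac{J_{2}^6J_{4}^5}{J_{1}^8J_{8}^2},\qquad \sum_{n\ge0}N^{0}(2,8;8n+5)q^n=\frac{J_{2}^{14}J_{8}^2}{J_{1}^{10}J_{4}^5},\\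 \sum_{n\ge0}N^{0}(2,8;8n+7)q^n=&-\frac{1}{2}q^{-1}+\frac{1}{2}q^{-1}g(-1;q^4)+\frac{1}{4}q^{-1}\frac{J_{2}^6J_{4}}{J_{1}^4J_{8}^2}+2\frac{J_{2}^8J_{8}^2}{J_{1}^8J_{4}}. \end{align*} (4) \begin{align*} \sum_{n\ge0}N^{0}(3,8;2n)q^n=&-\frac{1}{4}+\frac{1}{4}g(-1;q^4)-\frac{1}{2}q^4g(q^4;q^{16})+\frac{1}{4}\frac{J_{8}^7}{J_{4}^3J_{16}^3}-\frac{1}{4}\frac{J_{2}^5J_{8}^2}{J_{1}^2J_{4}^3J_{16}}+\frac{1}{8}\frac{J_{2}^6J_{4}}{J_{1}^4J_{8}^2},\\ \sum_{n\ge0}N^{0}(3,8;4n)q^n=&-\frac{1}{4}+\frac{1}{4}g(-1;q^2)-\frac{1}{2}q^2g(q^2;q^8)+\frac{1}{4}\frac{J_{4}^7}{J_{2}^3J_{8}^3}-\frac{1}{4}\frac{J_{4}^7}{J_{2}^3J_{8}^3}+\frac{1}{8}\frac{J_{2}^{15}}{J_{4}^6J_{1}^8},\\ \sum_{n\ge0}N^{0}(3,8;4n+2)q^n=&\frac{1}{2}\left(\frac{J_{2}^3J_{4}^2}{J_{1}^4}-\frac{J_4J_8}{J_2} \right),\qquad \sum_{n\ge0}N^{0}(3,8;8n)q^n=-\frac{1}{4}+\frac{1}{4}g(-1;q)-\frac{1}{2}qg(q;q^4)+\frac{1}{8}\frac{J_{2}^{22}}{J_{1}^{13}J_{4}^8}+2q\frac{J_{4}^8}{J_{1}^5J_{2}^2},\\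 \sum_{n\ge0}N^{0}(3,8;8n+2)q^n=&\frac{1}{2}\left(\frac{J_{2}^{16}}{J_{1}^{11}J_{4}^4}-\frac{J_2J_4}{J_1} \right),\qquad \sum_{n\ge0}N^{0}(3,8;8n+4)q^n=\frac{J_{2}^{10}}{J_{1}^9},\qquad \sum_{n\ge0}N^{0}(3,8;8n+6)q^n=2\frac{J_{2}^4J_{4}^4}{J_{1}^7}. \end{align*} (5) \begin{align*} \sum_{n\ge0}N^{0}(4,8;2n+1)q^n=&q^{-3}-q^{-3}g(-1;q^{64})-\frac{1}{2}q^{-3}\frac{J_{32}^6J_{64}}{J_{16}^4J_{128}^2}+\frac{1}{4}\left(\frac{J_{2}^8J_{8}^2}{J_{1}^4J_{4}^5}-2\frac{J_{2}^5J_{16}}{J_{1}^2J_{4}^2J_{8}}+\frac{J_{4}^3}{J_{2}^2} \right)+\frac{1}{2}q\left( \frac{J_{16}^3}{J_{8}^2}-\frac{J_{8}^8J_{32}^2}{J_{4}^4J_{16}^5}\right),\\ \sum_{n\ge0}N^{0}(4,8;4n+1)q^n=&\frac{1}{4}\left(\frac{J_{2}^9}{J_{1}^6J_{4}^2}-2\frac{J_{4}^4}{J_{2}^2J_{8}}+\frac{J_{2}^3}{J_{1}^2} \right),\\ \sum_{n\ge0}N^{0}(4,8;4n+3)q^n=&q^{-2}-q^{-2}g(-1;q^{32})-\frac{1}{2}q^{-2}\frac{J_{16}^6J_{32}}{J_{8}^4J_{64}^2}-\frac{1}{2}\frac{J_{8}^3}{J_{4}^2}-\frac{1}{2}\frac{J_{4}^8J_{16}^2}{J_{2}^4J_{8}^5}+\frac{J_{4}^6}{J_{2}^3J_{1}^2},\\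 \sum_{n\ge0}N^{0}(4,8;8n+1)q^n=&\frac{1}{4}\frac{J_{2}^{12}J_{4}}{J_{1}^{10}J_{8}^2}+2q\frac{J_{2}^2J_{4}^3J_{8}^2}{J_{1}^6}-\frac{1}{2}\frac{J_{2}^4}{J_{1}^2J_{4}}+\frac{1}{4}\frac{J_{4}^5}{J_{1}^2J_{8}^2},\\ \sum_{n\ge0}N^{0}(4,8;8n+3)q^n=&q^{-1}-q^{-1}g(-1;q^{16})-\frac{1}{2}q^{-1}\frac{J_{8}^6J_{16}}{J_{4}^4J_{32}^2}-\frac{1}{2}\frac{J_{4}^3}{J_{2}^2}-\frac{1}{2}\frac{J_{2}^8J_{8}^2}{J_{1}^4J_{4}^5}+\frac{J_{2}^6J_{4}^5}{J_{1}^8J_{8}^2},\\ \sum_{n\ge0}N^{0}(4,8;8n+5)q^n=&2\frac{J_{4}^9}{J_{1}^6J_{8}^2},\qquad \sum_{n\ge0}N^{0}(4,8;8n+7)q^n=2\frac{J_{2}^8J_{8}^2}{J_{1}^8J_{4}}. \end{align*}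
   Context: For $|q|<1$: $(a;q)_n=\prod_{k=0}^{n-1}(1-aq^k)$, $(a;q)_\infty=\prod_{k\ge0}(1-aq^k)$, $J_m=(q^m;q^m)_\infty$, and for $x$ not an integer power of $q$, \[g(x;q)=x^{-1}\Big(-1+\sum_{n=0}^{\infty}\frac{q^{n^2}}{(x;q)_{n+1}(q/x;q)_{n}}\Big)\] (expressions such as $g(-q^{32};q^{64})$ mean this function with $x=-q^{32}$ and $q$ replaced by $q^{64}$). An odd Durfee symbol of a positive integer $n$ consists of a nonnegative integer $D$ together with two (possibly empty) non-increasing sequences of odd positive integers $a_1\ge\cdots\ge a_s$ (top row) and $b_1\ge\cdots\ge b_t$ (bottom row), all entries at most $2D+1$, with $n=\sum a_i+\sum b_j+2D^2+2D+1$; its odd rank is $s-t$. $N^{0}(a,M;n)$ is the number of odd Durfee symbols of $n$ with odd rank congruent to $a$ modulo $M$, and $N^0(a,M;0)=0$. *)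

theory Defs
  imports "HOL-Analysis.Analysis" "HOL-Number_Theory.Cong"
begin

definition qpoch :: "complex \<Rightarrow> complex \<Rightarrow> nat \<Rightarrow> complex" where
  "qpoch a q n = (\<Prod>k<n. 1 - a * q ^ k)"

definition qpoch_inf :: "complex \<Rightarrow> complex \<Rightarrow> complex" where
  "qpoch_inf a q = (\<Prod>k. 1 - a * q ^ k)"

definition qJ :: "nat \<Rightarrow> complex \<Rightarrow> complex" where
  "qJ m q = qpoch_inf (q ^ m) (q ^ m)"

text \<open>The universal mock theta function \<open>g(x; q)\<close>, meaningful for \<open>0 < \<bar>q\<bar> < 1\<close> and
  \<open>x\<close> not an integer power of \<open>q\<close>.\<close>

definition mock_g :: "complex \<Rightarrow> complex \<Rightarrow> complex" where
  "mock_g x q = inverse x * (-1 + (\<Sum>n. q ^ (n\<^sup>2) / (qpoch x q (n + 1) * qpoch (q / x) q n)))"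

text \<open>A symbol is a triple of the number \<open>D\<close>, the top row and the bottom row. There is none for
  \<open>n = 0\<close>, so \<open>N0 a M 0 = 0\<close> needs no separate convention (see \<open>N0_0\<close> below).\<close>

definition odd_Durfee_symbols :: "nat \<Rightarrow> (nat \<times> nat list \<times> nat list) set" where
  "odd_Durfee_symbols n =
     {(D, as, bs). sorted_wrt (\<ge>) as \<and> sorted_wrt (\<ge>) bs \<and>
        (\<forall>x\<in>set as \<union> set bs. odd x \<and> x \<le> 2 * D + 1) \<and>
        n = sum_list as + sum_list bs + 2 * D\<^sup>2 + 2 * D + 1}"

definition odd_rank :: "nat \<times> nat list \<times> nat list \<Rightarrow> int" where
  "odd_rank = (\<lambda>(D, as, bs). int (length as) - int (length bs))"

definition N0 :: "int \<Rightarrow> int \<Rightarrow> nat \<Rightarrow> nat" where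
  "N0 a M n = card {S \<in> odd_Durfee_symbols n. [odd_rank S = a] (mod M)}"

lemma N0_0: "N0 a M 0 = 0"
  by (simp add: N0_def odd_Durfee_symbols_def)

lemma finite_odd_Durfee_symbols: "finite (odd_Durfee_symbols n)"
proof -
  have len: "length xs \<le> sum_list xs" if "\<forall>x\<in>set xs. odd x" for xs :: "nat list"
    using that by (induction xs) (auto elim!: oddE)
  have "odd_Durfee_symbols n \<subseteq>
      {..n} \<times> {xs. set xs \<subseteq> {..n} \<and> length xs \<le> n} \<times> {xs. set xs \<subseteq> {..n} \<and> length xs \<le> n}"
  proof
    fix S assume "S \<in> odd_Durfee_symbols n"
    then obtain D as bs where S: "S = (D, as, bs)"
      and odd: "\<forall>x\<in>set as. odd x" "\<forall>x\<in>set bs. odd x"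
      and n: "n = sum_list as + sum_list bs + 2 * D\<^sup>2 + 2 * D + 1"
      by (auto simp: odd_Durfee_symbols_def)
    have "x \<le> n" if "x \<in> set as \<or> x \<in> set bs" for x
      using that member_le_sum_list[of x as] member_le_sum_list[of x bs] n by auto
    moreover have "length as \<le> n" "length bs \<le> n" "D \<le> n"
      using len[OF odd(1)] len[OF odd(2)] n by auto
    ultimately show "S \<in> {..n} \<times> {xs. set xs \<subseteq> {..n} \<and> length xs \<le> n} \<times>
        {xs. set xs \<subseteq> {..n} \<and> length xs \<le> n}"
      by (auto simp: S)
  qed
  then show ?thesis
    by (rule finite_subset) (intro finite_cartesian_product finite_lists_length_le finite_atMost)
qed

end

theory Submission
  imports Defs "HOL-Complex_Analysis.Cauchy_Integral_Formula"
begin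

text \<open>
  With \<open>R(x; q) = q g(x q; q\<^sup>2)\<close> the two-variable generating function of the odd rank, the counts
  modulo 8 are combinations of \<open>R\<close> at eighth roots of unity. All these values are reduced to one
  another by a single identity,
  \<open>g(x; q) + g(-x; q) + 2 q g(-q x\<^sup>2; q\<^sup>4) = C(q) / ((x\<^sup>2, q\<^sup>2/x\<^sup>2; q\<^sup>2) (-q x\<^sup>2, -q\<^sup>3/x\<^sup>2; q\<^sup>4))\<close>:
  multiplied by the denominator on the right, the left-hand side is holomorphic for \<open>x \<noteq> 0\<close> and
  invariant under \<open>x \<mapsto> q\<^sup>2 x\<close>, hence constant by Liouville's theorem, and \<open>C(q)\<close> is read off at
  \<open>x = 1\<close>. This yields the formulas for the progressions modulo 2. The finer ones follow by
  splitting into even and odd powers of \<open>q\<close>, which only needs the 2-dissections of \<open>\<phi>(q)\<close> and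
  \<open>\<phi>(q)\<^sup>2\<close> for \<open>\<phi>(q) = J\<^sub>2\<^sup>5 / (J\<^sub>1\<^sup>2 J\<^sub>4\<^sup>2)\<close>.
\<close>

section \<open>Infinite q-Pochhammer symbols\<close>

text \<open>The obstacle is that \<open>g\<close> is not elliptic: x -> q x multiplies it by -x^3
  and adds -x - x^2. In the combination of the overview, after two such shifts, all three terms
  acquire the multiplier q^3 x^6 and the added terms cancel. Since x = 1 is a pole of g, reading off
  C(q) requires the numerator of g there. Shifts carry x = 1 to q^(-a), and letting a tend to
  infinity leaves one term of the series. Parity shapes the result. All entries of a symbol are odd,
  so its size is congruent to its rank plus 1 modulo 2. Analytically, R(x; -q) = -R(-x; q): sums
  R(x; q) + R(-x; q) are odd in q, differences are even. Hence even residues live on odd n and odd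
  residues on even n. The differences come from the same identity taken at q x, because the
  multiplier -x^3 of the shift is odd in x.\<close>

lemma norm_power_less_one:
  fixes q :: complex
  assumes "norm q < 1" "n > 0"
  shows "norm (q ^ n) < 1"
  using power_strict_mono[of "norm q" 1 n] assms by (simp add: norm_power)

lemma convergent_prod_qpoch:
  fixes a q :: complex
  assumes "norm q < 1"
  shows "convergent_prod (\<lambda>k. 1 - a * q ^ k)"
proof -
  have "summable (\<lambda>k. norm a * norm q ^ k)"
    using assms by (intro summable_mult summable_geometric) auto
  then have "summable (\<lambda>k. norm ((1 - a * q ^ k) - 1))"
    by (simp add: norm_mult norm_power)
  then show ?thesis
    by (intro abs_convergent_prod_imp_convergent_prod summable_imp_abs_convergent_prod)
qed

lemma qpoch_LIMSEQ:
  assumes "norm q < 1"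
  shows "qpoch a q \<longlonglongrightarrow> qpoch_inf a q"
proof -
  have "(\<lambda>n. \<Prod>k\<le>n. 1 - a * q ^ k) \<longlonglongrightarrow> qpoch_inf a q"
    using convergent_prod_LIMSEQ[OF convergent_prod_qpoch[OF assms]] by (simp add: qpoch_inf_def)
  then have "(\<lambda>n. qpoch a q (Suc n)) \<longlonglongrightarrow> qpoch_inf a q"
    by (simp only: qpoch_def lessThan_Suc_atMost)
  then show ?thesis
    by (simp add: filterlim_sequentially_Suc)
qed

lemma qpoch_0 [simp]: "qpoch a q 0 = 1"
  by (simp add: qpoch_def)

lemma qpoch_Suc: "qpoch a q (Suc n) = qpoch a q n * (1 - a * q ^ n)"
  by (simp add: qpoch_def)

lemma qpoch_add: "qpoch a q (m + n) = qpoch a q m * qpoch (a * q ^ m) q n"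
  by (induction n) (simp_all add: qpoch_Suc power_add mult_ac)

lemma qpoch_inf_split:
  assumes "norm q < 1"
  shows "qpoch_inf a q = qpoch a q m * qpoch_inf (a * q ^ m) q"
proof (rule LIMSEQ_unique)
  show "(\<lambda>n. qpoch a q (n + m)) \<longlonglongrightarrow> qpoch_inf a q"
    using qpoch_LIMSEQ[OF assms] by (rule LIMSEQ_ignore_initial_segment)
  have "(\<lambda>n. qpoch a q m * qpoch (a * q ^ m) q n) \<longlonglongrightarrow> qpoch a q m * qpoch_inf (a * q ^ m) q"
    by (intro tendsto_intros qpoch_LIMSEQ assms)
  then show "(\<lambda>n. qpoch a q (n + m)) \<longlonglongrightarrow> qpoch a q m * qpoch_inf (a * q ^ m) q"
    by (simp add: qpoch_add add.commute[of _ m])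
qed

lemma qpoch_inf_step:
  assumes "norm q < 1"
  shows "qpoch_inf a q = (1 - a) * qpoch_inf (a * q) q"
  using qpoch_inf_split[OF assms, of a 1] by (simp add: qpoch_def)

lemma qpoch_inf_one [simp]:
  assumes "norm q < 1"
  shows "qpoch_inf 1 q = 0"
  using qpoch_inf_step[OF assms, of 1] by simp

lemma qpoch_inf_eq_0:
  assumes "norm q < 1" "a * q ^ k = 1"
  shows "qpoch_inf a q = 0"
  using qpoch_inf_split[OF assms(1), of a k] assms by simp

lemma qpoch_inf_nonzero:
  assumes "norm q < 1" and "\<And>k. a * q ^ k \<noteq> 1"
  shows "qpoch_inf a q \<noteq> 0"
  unfolding qpoch_inf_def
  using assms by (intro prodinf_nonzero convergent_prod_qpoch) (metis eq_iff_diff_eq_0)+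

lemma qpoch_inf_nonzero_norm:
  assumes "norm q < 1" "norm a < 1"
  shows "qpoch_inf a q \<noteq> 0"
proof (rule qpoch_inf_nonzero[OF assms(1)])
  fix k
  have "norm (a * q ^ k) = norm a * norm q ^ k"
    by (simp add: norm_mult norm_power)
  also have "\<dots> \<le> norm a * 1"
    using assms by (intro mult_left_mono power_le_one) auto
  finally have "norm (a * q ^ k) < 1"
    using assms(2) by simp
  then show "a * q ^ k \<noteq> 1"
    by (metis norm_one less_irrefl)
qed

lemma qpoch_inf_square:
  assumes "norm q < 1"
  shows "qpoch_inf a q = qpoch_inf a (q ^ 2) * qpoch_inf (a * q) (q ^ 2)"
proof -
  have q2: "norm (q ^ 2) < 1"
    using assms by (simp add: norm_power_less_one)
  have eq: "qpoch a q (2 * n) = qpoch a (q ^ 2) n * qpoch (a * q) (q ^ 2) n" for n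
  proof (induction n)
    case (Suc n)
    have "qpoch a q (2 * Suc n) = qpoch a q (2 * n) * (1 - a * (q ^ 2) ^ n) * (1 - a * q * (q ^ 2) ^ n)"
      by (simp add: qpoch_Suc power_mult power2_eq_square power_mult_distrib mult_ac)
    then show ?case
      by (simp add: qpoch_Suc Suc)
  qed simp
  have "(\<lambda>n. qpoch a q (2 * n)) \<longlonglongrightarrow> qpoch_inf a q"
    using LIMSEQ_subseq_LIMSEQ[OF qpoch_LIMSEQ[OF assms, of a], of "\<lambda>n. 2 * n"]
    by (simp add: o_def strict_mono_def)
  moreover have "(\<lambda>n. qpoch a (q ^ 2) n * qpoch (a * q) (q ^ 2) n)
      \<longlonglongrightarrow> qpoch_inf a (q ^ 2) * qpoch_inf (a * q) (q ^ 2)"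
    by (intro tendsto_mult qpoch_LIMSEQ q2)
  ultimately show ?thesis
    unfolding eq by (rule LIMSEQ_unique)
qed

lemma qpoch_inf_mult_minus:
  assumes "norm q < 1"
  shows "qpoch_inf a q * qpoch_inf (- a) q = qpoch_inf (a ^ 2) (q ^ 2)"
proof -
  have q2: "norm (q ^ 2) < 1"
    using assms by (simp add: norm_power_less_one)
  have eq: "qpoch a q n * qpoch (- a) q n = qpoch (a ^ 2) (q ^ 2) n" for n
  proof (induction n)
    case (Suc n)
    have "(1 - a * q ^ n) * (1 - (- a) * q ^ n) = 1 - a\<^sup>2 * (q\<^sup>2) ^ n"
      by (simp add: power2_eq_square power_mult_distrib algebra_simps)
    then have "qpoch a q (Suc n) * qpoch (- a) q (Suc n)
        = (qpoch a q n * qpoch (- a) q n) * (1 - a\<^sup>2 * (q\<^sup>2) ^ n)"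
      by (simp only: qpoch_Suc mult_ac)
    then show ?case
      by (simp only: Suc qpoch_Suc)
  qed simp
  have "(\<lambda>n. qpoch a q n * qpoch (- a) q n) \<longlonglongrightarrow> qpoch_inf a q * qpoch_inf (- a) q"
    by (intro tendsto_mult qpoch_LIMSEQ assms)
  moreover have "qpoch (a ^ 2) (q ^ 2) \<longlonglongrightarrow> qpoch_inf (a ^ 2) (q ^ 2)"
    by (rule qpoch_LIMSEQ[OF q2])
  ultimately show ?thesis
    unfolding eq by (rule LIMSEQ_unique)
qed

lemma norm_qpoch_le:
  assumes "norm q < 1"
  shows "norm (qpoch a q n) \<le> exp (norm a / (1 - norm q))"
proof -
  have "norm (qpoch a q n) \<le> (\<Prod>k<n. 1 + norm a * norm q ^ k)"
    unfolding qpoch_def prod_norm[symmetric]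
  proof (intro prod_mono conjI norm_ge_zero)
    fix k
    show "norm (1 - a * q ^ k) \<le> 1 + norm a * norm q ^ k"
      using norm_triangle_ineq4[of 1 "a * q ^ k"] by (simp add: norm_mult norm_power)
  qed
  also have "\<dots> \<le> exp (\<Sum>k<n. norm a * norm q ^ k)"
    by (intro prod_le_exp_sum) auto
  also have "(\<Sum>k<n. norm a * norm q ^ k) \<le> (\<Sum>k. norm a * norm q ^ k)"
    using assms by (intro sum_le_suminf summable_mult summable_geometric) auto
  also have "(\<Sum>k. norm a * norm q ^ k) = norm a / (1 - norm q)"
    using assms by (subst suminf_mult) (auto simp: suminf_geometric summable_geometric)
  finally show ?thesis
    by simp
qed

lemma norm_qpoch_inf_le:
  assumes "norm q < 1"
  shows "norm (qpoch_inf a q) \<le> exp (norm a / (1 - norm q))"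
  by (rule LIMSEQ_le_const2[OF tendsto_norm[OF qpoch_LIMSEQ[OF assms]]])
     (use norm_qpoch_le[OF assms] in blast)

lemma holomorphic_qpoch_inf:
  assumes "norm q < 1"
  shows "(\<lambda>a. qpoch_inf a q) holomorphic_on UNIV"
proof (rule holomorphic_uniform_sequence[where f = "\<lambda>n a. qpoch a q n"])
  fix a :: complex
  have "uniformly_convergent_on (cball a 1) (\<lambda>N x. \<Prod>n<N. 1 + - x * q ^ n)"
  proof (rule uniformly_convergent_on_prod)
    show "uniformly_convergent_on (cball a 1) (\<lambda>N x. \<Sum>n<N. norm (- x * q ^ n))"
    proof (rule Weierstrass_m_test')
      fix n x assume "x \<in> cball a 1"
      then have "norm x \<le> norm a + 1"
        using norm_triangle_ineq2[of x a] by (auto simp: dist_norm norm_minus_commute)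
      then show "norm (norm (- x * q ^ n)) \<le> (norm a + 1) * norm q ^ n"
        by (simp add: norm_mult norm_power mult_right_mono)
    next
      show "summable (\<lambda>n. (norm a + 1) * norm q ^ n)"
        using assms by (intro summable_mult summable_geometric) auto
    qed
  qed (auto intro!: continuous_intros)
  then have "uniform_limit (cball a 1) (\<lambda>N x. qpoch x q N) (\<lambda>x. lim (\<lambda>N. qpoch x q N)) sequentially"
    by (simp add: qpoch_def uniformly_convergent_uniform_limit_iff)
  moreover have "lim (\<lambda>N. qpoch x q N) = qpoch_inf x q" for x
    using limI[OF qpoch_LIMSEQ[OF assms]] by simp
  ultimately show "\<exists>d>0. cball a d \<subseteq> UNIV \<and>
      uniform_limit (cball a d) (\<lambda>n a. qpoch a q n) (\<lambda>a. qpoch_inf a q) sequentially"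
    by (intro exI[of _ 1]) auto
qed (auto simp: qpoch_def intro!: holomorphic_intros)

lemma holomorphic_qpoch_inf_compose [holomorphic_intros]:
  assumes "f holomorphic_on A" "norm q < 1"
  shows "(\<lambda>x. qpoch_inf (f x) q) holomorphic_on A"
  using holomorphic_on_compose_gen[OF assms(1) holomorphic_qpoch_inf[OF assms(2)]]
  by (simp add: o_def)

section \<open>The universal mock theta function\<close>

lemma qpoch_inf_zero [simp]: "qpoch_inf 0 q = 1"
  by (simp add: qpoch_inf_def)

text \<open>\<open>mock_num\<close> and \<open>rank_num\<close> are the Eulerian series of the universal mock theta function and of
  the rank function multiplied termwise by \<open>theta_prod\<close>, which removes all their poles in \<open>x \<noteq> 0\<close>.\<close>

definition theta_prod :: "complex \<Rightarrow> complex \<Rightarrow> complex" where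
  "theta_prod x q = qpoch_inf x q * qpoch_inf (q / x) q"

definition mock_num :: "complex \<Rightarrow> complex \<Rightarrow> complex" where
  "mock_num x q = (\<Sum>n. q ^ (n * (n + 1)) * (qpoch_inf (x * q ^ (n + 1)) q * qpoch_inf (q ^ (n + 2) / x) q))"

definition rank_num :: "complex \<Rightarrow> complex \<Rightarrow> complex" where
  "rank_num x q = (\<Sum>n. q ^ (n\<^sup>2) * (qpoch_inf (x * q ^ (n + 1)) q * qpoch_inf (q ^ (n + 1) / x) q))"

lemma norm_mult_power_le:
  fixes x q :: complex
  assumes "norm q < 1"
  shows "norm (x * q ^ n) \<le> norm x"
  using mult_left_mono[OF power_le_one[of "norm q" n], of "norm x"] assms
  by (simp add: norm_mult norm_power)

lemma norm_qpoch_inf_product_le: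
  assumes "norm q < 1" "norm x \<le> r" "norm (inverse x) \<le> r"
  shows "norm (qpoch_inf (x * q ^ m) q * qpoch_inf (q ^ n / x) q) \<le> exp (r / (1 - norm q)) ^ 2"
proof -
  have "norm (qpoch_inf a q) \<le> exp (r / (1 - norm q))" if "norm a \<le> r" for a
  proof -
    have "norm a / (1 - norm q) \<le> r / (1 - norm q)"
      using that assms(1) by (intro divide_right_mono) auto
    with norm_qpoch_inf_le[OF assms(1), of a] show ?thesis
      by (meson exp_le_cancel_iff order_trans)
  qed
  moreover have "norm (x * q ^ m) \<le> r" "norm (q ^ n / x) \<le> r"
    using norm_mult_power_le[OF assms(1), of x m] norm_mult_power_le[OF assms(1), of "inverse x" n] assms
    by (auto simp: field_simps)
  ultimately show ?thesis
    unfolding norm_mult[of "qpoch_inf (x * q ^ m) q"] power2_eq_square by (intro mult_mono) auto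
qed

text \<open>A geometric majorant, uniform where both x and 1/x are bounded by \<open>r\<close>. The
  free exponents let it serve both numerator series and also the limit in
  \<open>mock_num_1\<close>.\<close>

lemma norm_qpoch_term_le:
  assumes "norm q < 1" "norm x \<le> r" "norm (inverse x) \<le> r" "k \<le> e"
  shows "norm (q ^ e * (qpoch_inf (x * q ^ m) q * qpoch_inf (q ^ n / x) q))
           \<le> norm q ^ k * exp (r / (1 - norm q)) ^ 2"
proof -
  have "norm (q ^ e) \<le> norm q ^ k"
    using assms by (auto simp: norm_power intro!: power_decreasing)
  with norm_qpoch_inf_product_le[OF assms(1-3)] show ?thesis
    unfolding norm_mult[of "q ^ e"] by (intro mult_mono) auto
qed

lemma summable_qpoch_terms:
  assumes "norm q < 1" "\<And>k. k \<le> e k"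
  shows "summable (\<lambda>k. q ^ e k * (qpoch_inf (x * q ^ m k) q * qpoch_inf (q ^ n k / x) q))"
proof (rule summable_comparison_test')
  let ?r = "max (norm x) (norm (inverse x))"
  show "summable (\<lambda>k. norm q ^ k * exp (?r / (1 - norm q)) ^ 2)"
    using assms(1) by (intro summable_mult2 summable_geometric) auto
  show "norm (q ^ e k * (qpoch_inf (x * q ^ m k) q * qpoch_inf (q ^ n k / x) q))
      \<le> norm q ^ k * exp (?r / (1 - norm q)) ^ 2" for k
    by (rule norm_qpoch_term_le) (use assms in auto)
qed

lemma summable_mock_num:
  assumes "norm q < 1"
  shows "summable (\<lambda>n. q ^ (n * (n + 1)) * (qpoch_inf (x * q ^ (n + 1)) q * qpoch_inf (q ^ (n + 2) / x) q))"
  by (rule summable_qpoch_terms[OF assms]) simp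

lemma summable_rank_num:
  assumes "norm q < 1"
  shows "summable (\<lambda>n. q ^ (n\<^sup>2) * (qpoch_inf (x * q ^ (n + 1)) q * qpoch_inf (q ^ (n + 1) / x) q))"
  by (rule summable_qpoch_terms[OF assms]) (simp add: power2_eq_square)

lemma holomorphic_mock_num:
  assumes "norm q < 1"
  shows "(\<lambda>x. mock_num x q) holomorphic_on - {0}"
proof (rule holomorphic_uniform_sequence)
  let ?f = "\<lambda>k x. q ^ (k * (k + 1)) * (qpoch_inf (x * q ^ (k + 1)) q * qpoch_inf (q ^ (k + 2) / x) q)"
  show "open (- {0 :: complex})"
    by (intro open_Compl) simp
  show "(\<lambda>x. \<Sum>k<n. ?f k x) holomorphic_on - {0}" for n
    by (intro holomorphic_intros assms) auto
  fix x :: complex assume "x \<in> - {0}"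
  then have x: "norm x > 0"
    by simp
  define r where "r = max (2 * norm x) (2 / norm x)"
  have y: "norm y \<ge> norm x / 2" "norm y \<le> 2 * norm x" if "y \<in> cball x (norm x / 2)" for y
    using that norm_triangle_ineq2[of x y] norm_triangle_ineq2[of y x] x
    by (auto simp: dist_norm norm_minus_commute)
  have "uniform_limit (cball x (norm x / 2)) (\<lambda>n x. \<Sum>k<n. ?f k x) (\<lambda>x. suminf (\<lambda>k. ?f k x)) sequentially"
  proof (rule Weierstrass_m_test)
    show "summable (\<lambda>k. norm q ^ k * exp (r / (1 - norm q)) ^ 2)"
      using assms by (intro summable_mult2 summable_geometric) auto
    fix k y assume "y \<in> cball x (norm x / 2)"
    note y = y[OF this]
    have "norm (inverse y) \<le> 2 / norm x"
      using le_imp_inverse_le[OF y(1)] x by (simp add: norm_inverse)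
    with y have "norm y \<le> r" "norm (inverse y) \<le> r"
      by (auto simp: r_def)
    then show "norm (?f k y) \<le> norm q ^ k * exp (r / (1 - norm q)) ^ 2"
      by (intro norm_qpoch_term_le assms) auto
  qed
  moreover have "cball x (norm x / 2) \<subseteq> - {0}"
    using y(1) x by fastforce
  ultimately show "\<exists>d>0. cball x d \<subseteq> - {0} \<and>
      uniform_limit (cball x d) (\<lambda>n x. \<Sum>k<n. ?f k x) (\<lambda>x. mock_num x q) sequentially"
    unfolding mock_num_def using x by (intro exI[of _ "norm x / 2"]) auto
qed

lemma holomorphic_mock_num_compose [holomorphic_intros]:
  assumes "f holomorphic_on A" "norm q < 1" "\<And>x. x \<in> A \<Longrightarrow> f x \<noteq> 0"
  shows "(\<lambda>x. mock_num (f x) q) holomorphic_on A"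
proof -
  have "f ` A \<subseteq> - {0}"
    using assms(3) by auto
  from holomorphic_on_compose_gen[OF assms(1) holomorphic_mock_num[OF assms(2)] this]
  show ?thesis
    by (simp add: o_def)
qed

lemma holomorphic_theta_prod_compose [holomorphic_intros]:
  assumes "f holomorphic_on A" "norm q < 1" "\<And>x. x \<in> A \<Longrightarrow> f x \<noteq> 0"
  shows "(\<lambda>x. theta_prod (f x) q) holomorphic_on A"
  unfolding theta_prod_def using assms by (intro holomorphic_intros) auto

section \<open>Functional equations of the theta product and of the numerators\<close>

text \<open>Quasi-periodicity of Jacobi's theta function: the first product loses the factor 1 - x,
  the second gains 1 - 1/x, and their quotient is -1/x.\<close>

lemma theta_prod_shift:
  assumes "norm q < 1" "q \<noteq> 0" "x \<noteq> 0"
  shows "theta_prod (q * x) q = - theta_prod x q / x"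
proof -
  have "qpoch_inf (q / (q * x)) q = (1 - 1 / x) * qpoch_inf (q / x) q"
    using qpoch_inf_step[OF assms(1), of "1 / x"] assms by simp
  moreover have "qpoch_inf x q = (1 - x) * qpoch_inf (q * x) q"
    using qpoch_inf_step[OF assms(1), of x] by (simp add: mult_ac)
  ultimately have 1: "theta_prod (q * x) q = qpoch_inf (q * x) q * ((1 - 1 / x) * qpoch_inf (q / x) q)"
    and 2: "theta_prod x q = ((1 - x) * qpoch_inf (q * x) q) * qpoch_inf (q / x) q"
    by (simp_all only: theta_prod_def)
  show ?thesis
    unfolding 1 2 using assms by (simp add: field_simps)
qed

lemma theta_prod_reflect:
  assumes "q \<noteq> 0" "x \<noteq> 0"
  shows "theta_prod (q / x) q = theta_prod x q"
  using assms by (simp add: theta_prod_def)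

lemma mock_num_reflect:
  assumes "q \<noteq> 0" "x \<noteq> 0"
  shows "mock_num (q / x) q = mock_num x q"
  using assms by (simp add: mock_num_def mult_ac)

lemma rank_num_inverse:
  assumes "x \<noteq> 0"
  shows "rank_num (1 / x) q = rank_num x q"
  using assms by (simp add: rank_num_def mult_ac)

text \<open>Links the series in the definition of \<open>mock_g\<close> with the one that is
  symmetric under x -> q/x.\<close>

lemma rank_num_eq:
  assumes "norm q < 1" "x \<noteq> 0"
  shows "rank_num x q = theta_prod x q + x * mock_num x q"
proof -
  \<comment> \<open>An interpolating sequence between the two series: its first product starts one
    factor earlier than in \<open>rank_num\<close>. Its start \<open>t 0\<close> is
    \<open>theta_prod x q\<close>, and its differences are the terms of \<open>rank_num\<close>
    minus x times those of \<open>mock_num\<close>.\<close>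
  define t where "t n = q ^ (n\<^sup>2) * (qpoch_inf (x * q ^ n) q * qpoch_inf (q ^ (n + 1) / x) q)" for n
  have "t \<longlonglongrightarrow> 0"
    unfolding t_def
    by (rule summable_LIMSEQ_zero[OF summable_qpoch_terms[OF assms(1)]]) (simp add: power2_eq_square)
  then have "(\<lambda>n. t n - t (Suc n)) sums (t 0 - 0)"
    by (rule telescope_sums')
  moreover have "t n - t (Suc n) =
      q ^ (n\<^sup>2) * (qpoch_inf (x * q ^ (n + 1)) q * qpoch_inf (q ^ (n + 1) / x) q)
      - x * (q ^ (n * (n + 1)) * (qpoch_inf (x * q ^ (n + 1)) q * qpoch_inf (q ^ (n + 2) / x) q))" for n
  proof -
    define A B Y u where "A = qpoch_inf (x * q ^ (n + 1)) q" and "B = qpoch_inf (q ^ (n + 2) / x) q"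
      and "Y = q ^ (n\<^sup>2)" and "u = q ^ n"
    have 1: "qpoch_inf (x * q ^ n) q = (1 - x * u) * A"
      using qpoch_inf_step[OF assms(1), of "x * q ^ n"] by (simp add: A_def u_def mult_ac)
    have 2: "qpoch_inf (q ^ (n + 1) / x) q = (1 - u * q / x) * B"
      using qpoch_inf_step[OF assms(1), of "q ^ (n + 1) / x"] by (simp add: B_def u_def mult_ac)
    have 3: "q ^ (n * (n + 1)) = Y * u" "q ^ ((Suc n)\<^sup>2) = Y * u\<^sup>2 * q"
      by (simp_all add: Y_def u_def power_add power2_eq_square algebra_simps)
    have 4: "t (Suc n) = Y * u\<^sup>2 * q * (A * B)"
      unfolding t_def 3 by (simp add: A_def B_def)
    have 5: "t n = Y * (((1 - x * u) * A) * ((1 - u * q / x) * B))"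
      unfolding t_def 1 2 Y_def ..
    show ?thesis
      unfolding 4 5 3 2 A_def[symmetric] B_def[symmetric] Y_def[symmetric]
      using assms(2) by (simp add: field_simps power2_eq_square)
  qed
  moreover have "(\<lambda>n. q ^ (n\<^sup>2) * (qpoch_inf (x * q ^ (n + 1)) q * qpoch_inf (q ^ (n + 1) / x) q)
      - x * (q ^ (n * (n + 1)) * (qpoch_inf (x * q ^ (n + 1)) q * qpoch_inf (q ^ (n + 2) / x) q)))
      sums (rank_num x q - x * mock_num x q)"
    unfolding rank_num_def mock_num_def
    by (intro sums_diff sums_mult summable_sums summable_mock_num summable_rank_num assms(1))
  ultimately have "t 0 - 0 = rank_num x q - x * mock_num x q"
    by (metis (no_types, lifting) sums_unique2 sums_cong)
  then show ?thesis
    by (simp add: t_def theta_prod_def algebra_simps)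
qed

text \<open>The shift is composed of two reflections: \<open>mock_num\<close> is invariant under x
  -> q/x, \<open>rank_num\<close> under x -> 1/x, and \<open>rank_num_eq\<close> translates between
  them.\<close>

lemma mock_num_shift:
  assumes "norm q < 1" "q \<noteq> 0" "x \<noteq> 0"
  shows "mock_num (q * x) q = (1 + x) * theta_prod x q + x\<^sup>2 * mock_num x q"
proof -
  have "rank_num (1 / x) q = theta_prod (1 / x) q + 1 / x * mock_num (1 / x) q"
    using assms by (intro rank_num_eq) auto
  moreover have "rank_num (1 / x) q = theta_prod x q + x * mock_num x q"
    using rank_num_eq[OF assms(1,3)] rank_num_inverse[OF assms(3)] by simp
  moreover have "mock_num (1 / x) q = mock_num (q * x) q"
    using mock_num_reflect[of q "q * x"] assms by simp
  moreover have "theta_prod (1 / x) q = - theta_prod x q / x"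
    using theta_prod_reflect[of q "q * x"] theta_prod_shift[OF assms] assms by simp
  ultimately show ?thesis
    using assms by (simp add: field_simps power2_eq_square)
qed

lemma theta_prod_eq_0:
  assumes "norm q < 1" "x * q ^ k = 1"
  shows "theta_prod x q = 0"
  using qpoch_inf_eq_0[OF assms] by (simp add: theta_prod_def)

text \<open>At the zeros of the theta product the shift has no inhomogeneous term, so it can be
  iterated in closed form.\<close>

lemma mock_num_inverse_power:
  assumes "norm q < 1" "q \<noteq> 0"
  shows "mock_num (1 / q ^ a) q = q ^ (a * (a + 1)) * mock_num 1 q"
proof (induction a)
  case (Suc a)
  have "mock_num (q * (1 / q ^ Suc a)) q = (1 / q ^ Suc a)\<^sup>2 * mock_num (1 / q ^ Suc a) q"
    using theta_prod_eq_0[OF assms(1), of "1 / q ^ Suc a" "Suc a"] assms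
      mock_num_shift[OF assms, of "1 / q ^ Suc a"] by simp
  then have "mock_num (1 / q ^ Suc a) q = (q ^ Suc a)\<^sup>2 * mock_num (1 / q ^ a) q"
    using assms by (simp add: field_simps)
  moreover have "(q ^ Suc a)\<^sup>2 * q ^ (a * (a + 1)) = q ^ (Suc a * (Suc a + 1))"
    by (simp add: power2_eq_square flip: power_add)
  ultimately show ?case
    by (simp add: Suc mult.assoc [symmetric])
qed simp

text \<open>Expresses a value independent of \<open>a\<close> by a series containing
  \<open>a\<close>, so that \<open>a\<close> may tend to infinity. It is the series of
  \<open>mock_num\<close> at 1 / q^a, whose first \<open>a\<close> terms vanish.\<close>

lemma mock_num_1_eq_suminf:
  assumes "norm q < 1" "q \<noteq> 0"
  shows "mock_num 1 q = (\<Sum>m. q ^ (m * (m + 2 * a + 1)) *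
           (qpoch_inf (q ^ (m + 1)) q * qpoch_inf (q ^ (m + 2 * a + 2)) q))"
proof -
  define f where "f n = q ^ (n * (n + 1)) * (qpoch_inf (1 / q ^ a * q ^ (n + 1)) q *
      qpoch_inf (q ^ (n + 2) / (1 / q ^ a)) q)" for n
  have f: "summable f"
    unfolding f_def by (rule summable_mock_num[OF assms(1)])
  \<comment> \<open>The product starts at a power of q with exponent n + 1 - a, which is not
    positive, so it contains the factor 1 - 1.\<close>
  have f0: "f n = 0" if "n < a" for n
  proof -
    have "q ^ (n + 1) * q ^ (a - (n + 1)) = q ^ a"
      using that by (metis Suc_eq_plus1 Suc_leI le_add_diff_inverse power_add)
    then have "1 / q ^ a * q ^ (n + 1) * q ^ (a - (n + 1)) = 1"
      using assms(2) by (simp only: mult.assoc) simp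
    then have "qpoch_inf (1 / q ^ a * q ^ (n + 1)) q = 0"
      by (rule qpoch_inf_eq_0[OF assms(1)])
    then show ?thesis
      by (simp add: f_def)
  qed
  have fm: "f (m + a) = q ^ (a * (a + 1)) * (q ^ (m * (m + 2 * a + 1)) *
           (qpoch_inf (q ^ (m + 1)) q * qpoch_inf (q ^ (m + 2 * a + 2)) q))" for m
  proof -
    have 1: "1 / q ^ a * q ^ (m + a + 1) = q ^ (m + 1)"
      and 2: "q ^ (m + a + 2) / (1 / q ^ a) = q ^ (m + 2 * a + 2)"
      using assms(2) by (simp_all add: power_add mult_2)
    have 3: "q ^ ((m + a) * (m + a + 1)) = q ^ (a * (a + 1)) * q ^ (m * (m + 2 * a + 1))"
      by (simp add: algebra_simps mult_2_right flip: power_add)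
    show ?thesis
      unfolding f_def 1 2 3 by (simp only: mult.assoc)
  qed
  have "q ^ (a * (a + 1)) * mock_num 1 q = suminf f"
    unfolding mock_num_inverse_power[OF assms, symmetric] by (simp add: mock_num_def f_def[abs_def])
  also have "\<dots> = (\<Sum>m. f (m + a))"
    using suminf_split_initial_segment[OF f, of a] f0 by simp
  also have "\<dots> = q ^ (a * (a + 1)) * (\<Sum>m. q ^ (m * (m + 2 * a + 1)) *
           (qpoch_inf (q ^ (m + 1)) q * qpoch_inf (q ^ (m + 2 * a + 2)) q))"
    unfolding fm
  proof (rule suminf_mult)
    show "summable (\<lambda>m. q ^ (m * (m + 2 * a + 1)) *
           (qpoch_inf (q ^ (m + 1)) q * qpoch_inf (q ^ (m + 2 * a + 2)) q))"
      using summable_qpoch_terms[OF assms(1), of "\<lambda>m. m * (m + 2 * a + 1)" 1 "\<lambda>m. m + 1" "\<lambda>m. m + 2 * a + 2"]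
      by simp
  qed
  finally show ?thesis
    using assms(2) by simp
qed

text \<open>Dominated convergence for a -> infinity in \<open>mock_num_1_eq_suminf\<close>: the
  exponent m (m + 2 a + 1) tends to infinity unless m = 0, so only the first term survives.\<close>

lemma mock_num_1:
  assumes "norm q < 1" "q \<noteq> 0"
  shows "mock_num 1 q = qpoch_inf q q"
proof -
  define f where "f m a = q ^ (m * (m + 2 * a + 1)) *
      (qpoch_inf (q ^ (m + 1)) q * qpoch_inf (q ^ (m + 2 * a + 2)) q)" for m a
  define b where "b m = (if m = 0 then qpoch_inf q q else 0)" for m :: nat
  define E where "E = exp (1 / (1 - norm q)) ^ 2"
  have "((\<lambda>a. suminf (\<lambda>m. f m a)) \<longlongrightarrow> suminf b) sequentially"
  proof (rule tannerys_theorem[THEN conjunct2, THEN conjunct2])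
    show "summable (\<lambda>m. norm q ^ m * E)"
      using assms(1) by (intro summable_mult2 summable_geometric) auto
    show "\<forall>\<^sub>F (k, n) in sequentially \<times>\<^sub>F sequentially. norm (f k n) \<le> norm q ^ k * E"
    proof (intro always_eventually allI, clarify)
      fix k n
      show "norm (f k n) \<le> norm q ^ k * E"
        using norm_qpoch_term_le[OF assms(1), of 1 1 k "k * (k + 2 * n + 1)" "k + 1" "k + 2 * n + 2"]
        by (simp add: f_def E_def)
    qed
    show "f m \<longlonglongrightarrow> b m" for m
    proof -
      have cont: "isCont (\<lambda>a. qpoch_inf a q) 0"
        using holomorphic_on_imp_continuous_on[OF holomorphic_qpoch_inf[OF assms(1)]]
        by (simp add: continuous_on_eq_continuous_at)
      have qn: "(\<lambda>n. q ^ (m + 2 * n + c)) \<longlonglongrightarrow> 0" for m c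
      proof -
        have "filterlim (\<lambda>n. m + 2 * n + c) sequentially sequentially"
          by (rule filterlim_subseq) (auto simp: strict_mono_def)
        from filterlim_compose[OF LIMSEQ_power_zero[OF assms(1)] this] show ?thesis .
      qed
      have lim: "(\<lambda>n. qpoch_inf (q ^ (m + 2 * n + 2)) q) \<longlonglongrightarrow> 1"
        using isCont_tendsto_compose[OF cont qn[of m 2]] by simp
      show ?thesis
      proof (cases "m = 0")
        case True
        then show ?thesis
          using tendsto_mult_left[OF lim, of "qpoch_inf q q"] by (simp add: f_def[abs_def] b_def)
      next
        case False
        have le: "norm q ^ (m * (m + 2 * n + 1)) \<le> norm q ^ (m + 2 * n + 1)" for n
          using mult_le_mono1[of 1 m "m + 2 * n + 1"] False assms(1)
          by (intro power_decreasing) auto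
        from qn[of m 1] have "(\<lambda>n. q ^ (m * (m + 2 * n + 1))) \<longlonglongrightarrow> 0"
        proof (rule tendsto_0_le[where K = 1])
          show "\<forall>\<^sub>F n in sequentially.
              norm (q ^ (m * (m + 2 * n + 1))) \<le> norm (q ^ (m + 2 * n + 1)) * 1"
            unfolding norm_power using le by (intro always_eventually) simp
        qed
        from tendsto_mult[OF this tendsto_mult[OF tendsto_const[of "qpoch_inf (q ^ (m + 1)) q"] lim]]
        show ?thesis
          using False by (simp add: f_def[abs_def] b_def)
      qed
    qed
  qed simp
  moreover have "suminf (\<lambda>m. f m a) = mock_num 1 q" for a
    using mock_num_1_eq_suminf[OF assms, of a] by (simp add: f_def)
  moreover have "suminf b = qpoch_inf q q"
    using suminf_finite[of "{0}" b] by (simp add: b_def)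
  ultimately show ?thesis
    by (simp add: LIMSEQ_const_iff)
qed

lemma mock_g_eq:
  assumes "norm q < 1" "x \<noteq> 0" "theta_prod x q \<noteq> 0"
  shows "mock_g x q = mock_num x q / theta_prod x q"
proof -
  have "q ^ (n\<^sup>2) / (qpoch x q (n + 1) * qpoch (q / x) q n) =
      q ^ (n\<^sup>2) * (qpoch_inf (x * q ^ (n + 1)) q * qpoch_inf (q ^ (n + 1) / x) q) / theta_prod x q" for n
  proof -
    define A B C D where "A = qpoch x q (n + 1)" and "B = qpoch_inf (x * q ^ (n + 1)) q"
      and "C = qpoch (q / x) q n" and "D = qpoch_inf (q ^ (n + 1) / x) q"
    have "theta_prod x q = A * B * (C * D)"
      unfolding theta_prod_def A_def B_def C_def D_def
      using qpoch_inf_split[OF assms(1), of x "n + 1"] qpoch_inf_split[OF assms(1), of "q / x" n]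
      by simp
    with assms(3) show ?thesis
      unfolding A_def[symmetric] B_def[symmetric] C_def[symmetric] D_def[symmetric]
      by (auto simp: field_simps)
  qed
  then have "mock_g x q = inverse x * (- 1 + rank_num x q / theta_prod x q)"
    unfolding mock_g_def rank_num_def
    using suminf_divide[OF summable_rank_num[OF assms(1)]] by simp
  then show ?thesis
    using assms by (simp add: rank_num_eq field_simps)
qed

text \<open>The Eulerian form with n + 1 factors in both denominators. For x q and base q^2 these
  become the generating functions of the two rows of a symbol.\<close>

lemma mock_g_sums:
  assumes "norm q < 1" "x \<noteq> 0" "theta_prod x q \<noteq> 0"
  shows "(\<lambda>n. q ^ (n * (n + 1)) / (qpoch x q (n + 1) * qpoch (q / x) q (n + 1))) sums mock_g x q"
proof -
  have "q ^ (n * (n + 1)) / (qpoch x q (n + 1) * qpoch (q / x) q (n + 1)) =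
      q ^ (n * (n + 1)) * (qpoch_inf (x * q ^ (n + 1)) q * qpoch_inf (q ^ (n + 2) / x) q) / theta_prod x q" for n
  proof -
    define A B C D where "A = qpoch x q (n + 1)" and "B = qpoch_inf (x * q ^ (n + 1)) q"
      and "C = qpoch (q / x) q (n + 1)" and "D = qpoch_inf (q ^ (n + 2) / x) q"
    have "theta_prod x q = A * B * (C * D)"
      unfolding theta_prod_def A_def B_def C_def D_def
      using qpoch_inf_split[OF assms(1), of x "n + 1"] qpoch_inf_split[OF assms(1), of "q / x" "n + 1"]
      by simp
    with assms(3) show ?thesis
      unfolding A_def[symmetric] B_def[symmetric] C_def[symmetric] D_def[symmetric]
      by (auto simp: field_simps)
  qed
  then show ?thesis
    unfolding mock_g_eq[OF assms] mock_num_def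
    using sums_divide[OF summable_sums[OF summable_mock_num[OF assms(1)]]] by simp
qed

lemma mock_g_shift:
  assumes "norm q < 1" "q \<noteq> 0" "x \<noteq> 0" "theta_prod x q \<noteq> 0"
  shows "mock_g (q * x) q = - x - x\<^sup>2 - x ^ 3 * mock_g x q"
proof -
  have t: "theta_prod (q * x) q = - theta_prod x q / x"
    by (rule theta_prod_shift[OF assms(1-3)])
  then have "mock_g (q * x) q = mock_num (q * x) q / (- theta_prod x q / x)"
    using mock_g_eq[of q "q * x"] assms by simp
  then show ?thesis
    unfolding mock_num_shift[OF assms(1-3)] mock_g_eq[OF assms(1,3,4)]
    using assms by (simp add: field_simps power2_eq_square power3_eq_cube)
qed

lemma mock_g_reflect:
  assumes "norm q < 1" "q \<noteq> 0" "x \<noteq> 0" "theta_prod x q \<noteq> 0"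
  shows "mock_g (q / x) q = mock_g x q"
  using assms mock_g_eq[of q x] mock_g_eq[of q "q / x"]
  by (simp add: theta_prod_reflect mock_num_reflect)

section \<open>Liouville's theorem for multiplicatively periodic functions\<close>

text \<open>Powers of \<open>p\<close> move every nonzero point into the compact annulus between the
  radii \<open>norm p\<close> and 1.\<close>

lemma bounded_multiplicatively_periodic:
  fixes f :: "complex \<Rightarrow> complex"
  assumes "continuous_on (- {0}) f" and p: "p \<noteq> 0" "norm p < 1"
    and per: "\<And>x. x \<noteq> 0 \<Longrightarrow> f (p * x) = f x"
  shows "bounded (f ` (- {0}))"
proof -
  let ?K = "cball 0 1 - ball 0 (norm p)"
  have per': "f (p ^ n * x) = f x" if "x \<noteq> 0" for n x
    by (induction n) (use per that p in \<open>simp_all add: mult.assoc\<close>)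
  have "\<exists>y\<in>?K. f y = f x" if x: "x \<noteq> 0" for x
  proof (cases "norm x \<le> 1")
    case True
    obtain n0 where "norm p ^ n0 < norm x"
      using real_arch_pow_inv[of "norm x" "norm p"] x p by auto
    moreover have "norm p ^ Suc n0 \<le> norm p ^ n0"
      using p by (intro power_decreasing) auto
    ultimately have n0: "norm p ^ Suc n0 \<le> norm x"
      by linarith
    \<comment> \<open>Minimality places \<open>norm x\<close> between consecutive powers of
      \<open>norm p\<close>, so x / p^n lies in the annulus.\<close>
    define n where "n = (LEAST n. norm p ^ Suc n \<le> norm x)"
    have n: "norm p ^ Suc n \<le> norm x"
      unfolding n_def by (rule LeastI[where P = "\<lambda>n. norm p ^ Suc n \<le> norm x", OF n0])
    have "norm x \<le> norm p ^ n"
    proof (cases n)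
      case (Suc m)
      then show ?thesis
        using not_less_Least[of m "\<lambda>n. norm p ^ Suc n \<le> norm x"] by (auto simp: n_def)
    qed (use True in simp)
    with n have "x / p ^ n \<in> ?K"
      using p by (auto simp: norm_divide norm_power field_simps)
    then show ?thesis
      using per'[of "x / p ^ n" n] x p by (intro bexI[of _ "x / p ^ n"]) auto
  next
    case False
    obtain n0 where n0: "norm p ^ n0 < inverse (norm x)"
      using real_arch_pow_inv[of "inverse (norm x)" "norm p"] x p by auto
    \<comment> \<open>The first power that brings x into the unit disc; the previous one failed, so
      p^n x still has norm at least \<open>norm p\<close>.\<close>
    define n where "n = (LEAST n. norm p ^ n * norm x \<le> 1)"
    have n: "norm p ^ n * norm x \<le> 1"
      unfolding n_def
      by (intro LeastI[where P = "\<lambda>n. norm p ^ n * norm x \<le> 1" and k = n0])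
         (use n0 x in \<open>auto simp: field_simps\<close>)
    then obtain m where m: "n = Suc m"
      using False by (cases n) auto
    have "norm p ^ m * norm x > 1"
      using not_less_Least[of m "\<lambda>n. norm p ^ n * norm x \<le> 1"] m by (auto simp: n_def)
    then have "norm p * 1 \<le> norm p * (norm p ^ m * norm x)"
      by (intro mult_left_mono) auto
    with n m have "p ^ n * x \<in> ?K"
      by (auto simp: norm_mult norm_power mult.assoc)
    then show ?thesis
      using per'[OF x] by blast
  qed
  then have "f ` (- {0}) \<subseteq> f ` ?K"
    by (auto simp: image_iff) metis
  moreover have "compact (f ` ?K)"
    using p by (intro compact_continuous_image continuous_on_subset[OF assms(1)] compact_diff) auto
  ultimately show ?thesis
    using bounded_subset compact_imp_bounded by blast
qed

text \<open>Composition with \<open>exp\<close> turns a function on the punctured plane into an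
  entire one.\<close>

lemma multiplicatively_periodic_constant:
  assumes "f holomorphic_on - {0}" "p \<noteq> 0" "norm p < 1"
    and "\<And>x. x \<noteq> 0 \<Longrightarrow> f (p * x) = f x" and "x \<noteq> 0" "y \<noteq> 0"
  shows "f x = f y"
proof -
  have "(f \<circ> exp) holomorphic_on UNIV"
    by (intro holomorphic_on_compose_gen[OF _ assms(1)] holomorphic_intros) auto
  moreover have "bounded (range (f \<circ> exp))"
    by (rule bounded_subset[OF bounded_multiplicatively_periodic[OF
          holomorphic_on_imp_continuous_on[OF assms(1)] assms(2-4)]]) auto
  ultimately have "(f \<circ> exp) constant_on UNIV"
    by (rule Liouville_theorem)
  then have "f (exp (Ln x)) = f (exp (Ln y))"
    by (auto simp: constant_on_def)
  then show ?thesis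
    using assms by simp
qed

section \<open>Theta products at special arguments\<close>

lemma qJ_nonzero:
  assumes "norm q < 1" "m > 0"
  shows "qJ m q \<noteq> 0"
  unfolding qJ_def using assms by (intro qpoch_inf_nonzero_norm norm_power_less_one)

lemma qJ_power: "qJ m (q ^ k) = qJ (k * m) q"
  by (simp add: qJ_def power_mult)

lemma qpoch_inf_minus_self:
  assumes "norm q < 1"
  shows "qpoch_inf (- q) q = qJ 2 q / qJ 1 q"
  using qpoch_inf_mult_minus[OF assms, of q] qJ_nonzero[OF assms, of 1]
  by (simp add: qJ_def field_simps)

lemma qpoch_inf_odd:
  assumes "norm q < 1"
  shows "qpoch_inf q (q\<^sup>2) = qJ 1 q / qJ 2 q"
  using qpoch_inf_square[OF assms, of q] qJ_nonzero[OF assms, of 2]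
  by (simp add: qJ_def field_simps power2_eq_square)

lemma qpoch_inf_minus_odd:
  assumes "norm q < 1"
  shows "qpoch_inf (- q) (q\<^sup>2) = (qJ 2 q)\<^sup>2 / (qJ 1 q * qJ 4 q)"
proof -
  have q2: "norm (q\<^sup>2) < 1"
    using assms by (simp add: norm_power_less_one)
  have "qpoch_inf q (q\<^sup>2) * qpoch_inf (- q) (q\<^sup>2) = qJ 2 q / qJ 4 q"
    using qpoch_inf_mult_minus[OF q2, of q] qpoch_inf_odd[OF q2] by (simp add: qJ_power)
  then show ?thesis
    unfolding qpoch_inf_odd[OF assms] using qJ_nonzero[OF assms]
    by (simp add: field_simps power2_eq_square)
qed

text \<open>The zeros are integer powers of q, and of these only 1 lies in this annulus.\<close>

lemma theta_prod_nonzero: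
  assumes "norm q < norm x" "norm x \<le> 1" "x \<noteq> 1"
  shows "theta_prod x q \<noteq> 0"
proof -
  have q: "norm q < 1"
    using assms by simp
  have x: "norm x > 0"
    using assms(1) norm_ge_zero[of q] by linarith
  have "norm (x * q) < 1"
    using mult_right_mono[OF assms(2), of "norm q"] q by (simp add: norm_mult)
  then have "qpoch_inf x q \<noteq> 0"
    using qpoch_inf_step[OF q, of x] qpoch_inf_nonzero_norm[OF q, of "x * q"] assms(3) by simp
  moreover have "norm (q / x) < 1"
    using assms(1) x by (simp add: norm_divide)
  ultimately show ?thesis
    using qpoch_inf_nonzero_norm[OF q] by (simp add: theta_prod_def)
qed

lemma theta_prod_mult_minus:
  assumes "norm q < 1"
  shows "theta_prod x q * theta_prod (- x) q = theta_prod (x\<^sup>2) (q\<^sup>2)"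
  using qpoch_inf_mult_minus[OF assms, of x] qpoch_inf_mult_minus[OF assms, of "q / x"]
  by (simp add: theta_prod_def power_divide algebra_simps)

lemma theta_prod_odd:
  assumes "norm q < 1" "q \<noteq> 0"
  shows "theta_prod q (q\<^sup>2) = (qJ 1 q / qJ 2 q)\<^sup>2"
  using qpoch_inf_odd[OF assms(1)] assms(2) by (simp add: theta_prod_def power2_eq_square)

lemma theta_prod_minus_odd:
  assumes "norm q < 1" "q \<noteq> 0"
  shows "theta_prod (- q) (q\<^sup>2) = ((qJ 2 q)\<^sup>2 / (qJ 1 q * qJ 4 q))\<^sup>2"
  using qpoch_inf_minus_odd[OF assms(1)] assms(2) by (simp add: theta_prod_def power2_eq_square)

lemma theta_prod_ii_odd:
  assumes "norm q < 1" "q \<noteq> 0"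
  shows "theta_prod (\<i> * q) (q\<^sup>2) = (qJ 4 q)\<^sup>2 / (qJ 2 q * qJ 8 q)"
    and "theta_prod (- (\<i> * q)) (q\<^sup>2) = (qJ 4 q)\<^sup>2 / (qJ 2 q * qJ 8 q)"
proof -
  have q2: "norm (q\<^sup>2) < 1"
    using assms by (simp add: norm_power_less_one)
  have *: "qpoch_inf (\<i> * q) (q\<^sup>2) * qpoch_inf (- (\<i> * q)) (q\<^sup>2) = (qJ 4 q)\<^sup>2 / (qJ 2 q * qJ 8 q)"
    using qpoch_inf_mult_minus[OF q2, of "\<i> * q"] qpoch_inf_minus_odd[OF q2]
    by (simp add: qJ_power power_mult_distrib)
  have "q\<^sup>2 / (\<i> * q) = - (\<i> * q)" "q\<^sup>2 / (- (\<i> * q)) = \<i> * q"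
    using assms(2) by (simp_all add: field_simps power2_eq_square)
  with * show "theta_prod (\<i> * q) (q\<^sup>2) = (qJ 4 q)\<^sup>2 / (qJ 2 q * qJ 8 q)"
    and "theta_prod (- (\<i> * q)) (q\<^sup>2) = (qJ 4 q)\<^sup>2 / (qJ 2 q * qJ 8 q)"
    by (simp_all add: theta_prod_def mult.commute)
qed

lemma theta_prod_minus_one:
  assumes "norm q < 1"
  shows "theta_prod (- 1) q = 2 * (qJ 2 q / qJ 1 q)\<^sup>2"
  using qpoch_inf_minus_self[OF assms] qpoch_inf_step[OF assms, of "- 1"]
  by (simp add: theta_prod_def power2_eq_square)

lemma theta_prod_ii:
  assumes "norm q < 1"
  shows "theta_prod \<i> q = (1 - \<i>) * (qJ 4 q / qJ 2 q)"
proof -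
  have q2: "norm (q\<^sup>2) < 1"
    using assms by (simp add: norm_power_less_one)
  have "qpoch_inf (\<i> * q) q * qpoch_inf (- (\<i> * q)) q = qJ 4 q / qJ 2 q"
    using qpoch_inf_mult_minus[OF assms, of "\<i> * q"] qpoch_inf_minus_self[OF q2]
    by (simp add: qJ_power power_mult_distrib)
  moreover have "q / \<i> = - (\<i> * q)"
    by (simp add: field_simps)
  ultimately show ?thesis
    using qpoch_inf_step[OF assms, of \<i>] by (simp add: theta_prod_def mult.assoc)
qed

text \<open>The exponents congruent to 1 and to 3 modulo 4 together are all the odd ones, so the two
  products with base q^4 merge into one with base q^2.\<close>

lemma theta_prod_self_power4:
  assumes "norm q < 1" "q \<noteq> 0"
  shows "theta_prod q (q ^ 4) = qJ 1 q / qJ 2 q" "theta_prod (- q) (q ^ 4) = (qJ 2 q)\<^sup>2 / (qJ 1 q * qJ 4 q)"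
proof -
  have q2: "norm (q\<^sup>2) < 1"
    using assms by (simp add: norm_power_less_one)
  have *: "q * q\<^sup>2 = q ^ 4 / q" "- q * q\<^sup>2 = q ^ 4 / - q"
    using assms(2) by (simp_all add: field_simps eval_nat_numeral)
  show "theta_prod q (q ^ 4) = qJ 1 q / qJ 2 q"
    using qpoch_inf_square[OF q2, of q] qpoch_inf_odd[OF assms(1)] unfolding * theta_prod_def by simp
  show "theta_prod (- q) (q ^ 4) = (qJ 2 q)\<^sup>2 / (qJ 1 q * qJ 4 q)"
    using qpoch_inf_square[OF q2, of "- q"] qpoch_inf_minus_odd[OF assms(1)] unfolding * theta_prod_def by simp
qed

section \<open>The bisection identity for the universal mock theta function\<close>

text \<open>The identity with denominators cleared. The period is q^2 and not q because -q x^2 has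
  to move by a power of its own base q^4.\<close>

lemma mock_num_bisection:
  assumes "norm q < 1" "q \<noteq> 0" "x \<noteq> 0"
  shows "theta_prod (- q * x\<^sup>2) (q ^ 4) *
           (theta_prod (- x) q * mock_num x q + theta_prod x q * mock_num (- x) q)
         + 2 * q * theta_prod x q * theta_prod (- x) q * mock_num (- q * x\<^sup>2) (q ^ 4)
         = 2 * qJ 2 q ^ 4 / ((qJ 1 q)\<^sup>2 * qJ 4 q)"
proof -
  define W where "W x = theta_prod (- q * x\<^sup>2) (q ^ 4) *
           (theta_prod (- x) q * mock_num x q + theta_prod x q * mock_num (- x) q)
         + 2 * q * theta_prod x q * theta_prod (- x) q * mock_num (- q * x\<^sup>2) (q ^ 4)" for x
  have q4: "norm (q ^ 4) < 1" "q ^ 4 \<noteq> 0" and q2: "norm (q\<^sup>2) < 1" "q\<^sup>2 \<noteq> 0"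
    using assms by (simp_all add: norm_power_less_one)
  have "W x = W 1"
  proof (rule multiplicatively_periodic_constant[where p = "q\<^sup>2" and f = W])
    show "W holomorphic_on - {0}"
      unfolding W_def using assms q4 by (intro holomorphic_intros) auto
    fix x :: complex assume x: "x \<noteq> 0"
    have shift: "theta_prod (q\<^sup>2 * y) q = theta_prod y q / (q * y\<^sup>2)"
      "mock_num (q\<^sup>2 * y) q = (- (1 / y) - q + q\<^sup>2 * y\<^sup>2 + q\<^sup>2 * y ^ 3) * theta_prod y q
         + q\<^sup>2 * y ^ 4 * mock_num y q" if "y \<noteq> 0" for y
    proof -
      have "q\<^sup>2 * y = q * (q * y)"
        by (simp add: power2_eq_square)
      then show "theta_prod (q\<^sup>2 * y) q = theta_prod y q / (q * y\<^sup>2)"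
        "mock_num (q\<^sup>2 * y) q = (- (1 / y) - q + q\<^sup>2 * y\<^sup>2 + q\<^sup>2 * y ^ 3) * theta_prod y q
           + q\<^sup>2 * y ^ 4 * mock_num y q"
        using assms that
        by (simp_all add: theta_prod_shift mock_num_shift field_simps eval_nat_numeral)
    qed
    have y: "- q * (q\<^sup>2 * x)\<^sup>2 = q ^ 4 * (- q * x\<^sup>2)" "- (q\<^sup>2 * x) = q\<^sup>2 * (- x)" "- q * x\<^sup>2 \<noteq> 0"
      using x assms by (simp_all add: power_mult_distrib)
    define A B G H C K where "A = theta_prod x q" and "B = theta_prod (- x) q"
      and "G = mock_num x q" and "H = mock_num (- x) q"
      and "C = theta_prod (- q * x\<^sup>2) (q ^ 4)" and "K = mock_num (- q * x\<^sup>2) (q ^ 4)"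
    have s: "theta_prod (q\<^sup>2 * x) q = A / (q * x\<^sup>2)" "theta_prod (q\<^sup>2 * - x) q = B / (q * x\<^sup>2)"
      "mock_num (q\<^sup>2 * x) q = (- (1 / x) - q + q\<^sup>2 * x\<^sup>2 + q\<^sup>2 * x ^ 3) * A + q\<^sup>2 * x ^ 4 * G"
      "mock_num (q\<^sup>2 * - x) q = (1 / x - q + q\<^sup>2 * x\<^sup>2 - q\<^sup>2 * x ^ 3) * B + q\<^sup>2 * x ^ 4 * H"
      using shift[of x] shift[of "- x"] x by (simp_all add: A_def B_def G_def H_def)
    have "W (q\<^sup>2 * x) = - C / (- q * x\<^sup>2) *
        (B / (q * x\<^sup>2) * ((- (1 / x) - q + q\<^sup>2 * x\<^sup>2 + q\<^sup>2 * x ^ 3) * A + q\<^sup>2 * x ^ 4 * G)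
         + A / (q * x\<^sup>2) * ((1 / x - q + q\<^sup>2 * x\<^sup>2 - q\<^sup>2 * x ^ 3) * B + q\<^sup>2 * x ^ 4 * H))
        + 2 * q * (A / (q * x\<^sup>2)) * (B / (q * x\<^sup>2)) *
          ((1 + - q * x\<^sup>2) * C + (- q * x\<^sup>2)\<^sup>2 * K)"
      unfolding W_def y(1,2) theta_prod_shift[OF q4 y(3)] mock_num_shift[OF q4 y(3)]
        s C_def[symmetric] K_def[symmetric] ..
    \<comment> \<open>The multiples of \<open>A * B * C\<close> cancel: the odd powers of x between
      the arguments x and -x, the remaining ones against the inhomogeneous term of the shift with
      base q^4.\<close>
    also have "\<dots> = C * (B * G + A * H) + 2 * q * A * B * K"
      using x assms(2) by (simp add: field_simps) algebra
    finally show "W (q\<^sup>2 * x) = W x"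
      by (simp add: W_def A_def B_def C_def G_def H_def K_def)
  qed (use assms q2 in auto)
  \<comment> \<open>The other two summands contain \<open>theta_prod 1 q\<close>, which is
    0.\<close>
  also have "W 1 = theta_prod (- q) (q ^ 4) * (theta_prod (- 1) q * mock_num 1 q)"
    using assms by (simp add: W_def theta_prod_def)
  also have "\<dots> = 2 * qJ 2 q ^ 4 / ((qJ 1 q)\<^sup>2 * qJ 4 q)"
  proof -
    have "mock_num 1 q = qJ 1 q"
      using mock_num_1[OF assms(1,2)] by (simp add: qJ_def)
    then show ?thesis
      unfolding theta_prod_minus_one[OF assms(1)] theta_prod_self_power4(2)[OF assms(1,2)]
      using qJ_nonzero[OF assms(1), of 1] qJ_nonzero[OF assms(1), of 4]
      by (simp add: field_simps power2_eq_square power4_eq_xxxx)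
  qed
  finally show ?thesis
    by (simp add: W_def)
qed

lemma mock_g_bisection_sum:
  assumes "norm q < 1" "q \<noteq> 0" "x \<noteq> 0"
    and nz: "theta_prod (x\<^sup>2) (q\<^sup>2) \<noteq> 0" "theta_prod (- q * x\<^sup>2) (q ^ 4) \<noteq> 0"
  shows "mock_g x q + mock_g (- x) q + 2 * q * mock_g (- q * x\<^sup>2) (q ^ 4) =
           2 * qJ 2 q ^ 4 / ((qJ 1 q)\<^sup>2 * qJ 4 q) / (theta_prod (x\<^sup>2) (q\<^sup>2) * theta_prod (- q * x\<^sup>2) (q ^ 4))"
proof -
  have q4: "norm (q ^ 4) < 1"
    using assms by (simp add: norm_power_less_one)
  have nz': "theta_prod x q \<noteq> 0" "theta_prod (- x) q \<noteq> 0"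
    using nz(1) unfolding theta_prod_mult_minus[OF assms(1), symmetric] by auto
  have y: "- q * x\<^sup>2 \<noteq> 0"
    using assms by simp
  show ?thesis
    unfolding mock_num_bisection[OF assms(1-3), symmetric] theta_prod_mult_minus[OF assms(1), symmetric]
      mock_g_eq[OF assms(1,3) nz'(1)] mock_g_eq[OF assms(1) _ nz'(2)] mock_g_eq[OF q4 y nz(2)]
    using nz' nz(2) assms mock_g_eq[OF assms(1) _ nz'(2)] by (simp add: field_simps)
qed

text \<open>The sum formula taken at q x: the multiplier of the shift is odd in x, so the sum of the
  shifted values turns into a difference of the original ones.\<close>

lemma mock_g_bisection_diff:
  assumes "norm q < 1" "q \<noteq> 0" "x \<noteq> 0"
    and nz: "theta_prod (x\<^sup>2) (q\<^sup>2) \<noteq> 0" "theta_prod (- q / x\<^sup>2) (q ^ 4) \<noteq> 0"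
  shows "mock_g x q - mock_g (- x) q = - 2 / x + 2 * q / x ^ 3 * mock_g (- q / x\<^sup>2) (q ^ 4)
           + 2 * qJ 2 q ^ 4 / ((qJ 1 q)\<^sup>2 * qJ 4 q) /
             (x * (theta_prod (x\<^sup>2) (q\<^sup>2) * theta_prod (- q / x\<^sup>2) (q ^ 4)))"
proof -
  have q4: "norm (q ^ 4) < 1" "q ^ 4 \<noteq> 0" and q2: "norm (q\<^sup>2) < 1" "q\<^sup>2 \<noteq> 0"
    using assms by (simp_all add: norm_power_less_one)
  have nz': "theta_prod x q \<noteq> 0" "theta_prod (- x) q \<noteq> 0"
    using nz(1) unfolding theta_prod_mult_minus[OF assms(1), symmetric] by auto
  \<comment> \<open>The argument of the third term is reflected, which leaves both its theta product
    and its mock theta value unchanged.\<close>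
  have 1: "- q * (q * x)\<^sup>2 = q ^ 4 / (- q / x\<^sup>2)" and y: "- q / x\<^sup>2 \<noteq> 0"
    using assms by (simp_all add: field_simps eval_nat_numeral)
  have 2: "theta_prod ((q * x)\<^sup>2) (q\<^sup>2) = - theta_prod (x\<^sup>2) (q\<^sup>2) / x\<^sup>2"
    using theta_prod_shift[OF q2, of "x\<^sup>2"] assms by (simp add: power_mult_distrib)
  have 3: "theta_prod (- q * (q * x)\<^sup>2) (q ^ 4) = theta_prod (- q / x\<^sup>2) (q ^ 4)"
    unfolding 1 by (rule theta_prod_reflect[OF q4(2) y])
  have 4: "mock_g (- q * (q * x)\<^sup>2) (q ^ 4) = mock_g (- q / x\<^sup>2) (q ^ 4)"
    unfolding 1 by (rule mock_g_reflect[OF q4 y nz(2)])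
  have 5: "mock_g (- (q * x)) q = x - x\<^sup>2 + x ^ 3 * mock_g (- x) q"
    using mock_g_shift[OF assms(1,2) _ nz'(2)] assms(3) by simp
  have "mock_g (q * x) q + mock_g (- (q * x)) q + 2 * q * mock_g (- q * (q * x)\<^sup>2) (q ^ 4) =
      2 * qJ 2 q ^ 4 / ((qJ 1 q)\<^sup>2 * qJ 4 q) /
        (theta_prod ((q * x)\<^sup>2) (q\<^sup>2) * theta_prod (- q * (q * x)\<^sup>2) (q ^ 4))"
    by (rule mock_g_bisection_sum) (use assms nz 2 3 in auto)
  then have *: "- x - x\<^sup>2 - x ^ 3 * mock_g x q + (x - x\<^sup>2 + x ^ 3 * mock_g (- x) q)
      + 2 * q * mock_g (- q / x\<^sup>2) (q ^ 4) =
      2 * qJ 2 q ^ 4 / ((qJ 1 q)\<^sup>2 * qJ 4 q) /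
        (- theta_prod (x\<^sup>2) (q\<^sup>2) / x\<^sup>2 * theta_prod (- q / x\<^sup>2) (q ^ 4))"
    unfolding 2 3 4 5 mock_g_shift[OF assms(1-3) nz'(1)] .
  define C D where "C = 2 * qJ 2 q ^ 4 / ((qJ 1 q)\<^sup>2 * qJ 4 q)"
    and "D = theta_prod (x\<^sup>2) (q\<^sup>2) * theta_prod (- q / x\<^sup>2) (q ^ 4)"
  have "x ^ 3 * (mock_g x q - mock_g (- x) q) =
      - 2 * x\<^sup>2 + 2 * q * mock_g (- q / x\<^sup>2) (q ^ 4) + C * x\<^sup>2 / D"
    using * by (simp add: C_def D_def algebra_simps)
  then have "mock_g x q - mock_g (- x) q =
      (- 2 * x\<^sup>2 + 2 * q * mock_g (- q / x\<^sup>2) (q ^ 4) + C * x\<^sup>2 / D) / x ^ 3"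
    using assms(3) by (simp add: field_simps)
  also have "\<dots> = - 2 / x + 2 * q / x ^ 3 * mock_g (- q / x\<^sup>2) (q ^ 4) + C / (x * D)"
    using assms(3) by (simp add: add_divide_distrib diff_divide_distrib eval_nat_numeral mult.commute)
  finally show ?thesis
    by (simp add: C_def D_def)
qed

section \<open>Odd Durfee symbols\<close>

lemma has_sum_product_complex:
  fixes f :: "'a \<Rightarrow> complex" and g :: "'b \<Rightarrow> complex"
  assumes f: "(f has_sum a) A" and g: "(g has_sum b) B"
  shows "((\<lambda>(x, y). f x * g y) has_sum (a * b)) (A \<times> B)"
proof (rule has_sum_SigmaI)
  show "((\<lambda>y. case (x, y) of (x, y) \<Rightarrow> f x * g y) has_sum (f x * b)) B" for x
    using has_sum_cmult_right[OF g, of "f x"] by simp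
  show "((\<lambda>x. f x * b) has_sum (a * b)) A"
    by (rule has_sum_cmult_left[OF f])
  have f': "(\<lambda>x. norm (f x)) summable_on A" and g': "(\<lambda>y. norm (g y)) summable_on B"
    using f g summable_on_iff_abs_summable_on_complex has_sum_imp_summable by blast+
  have "(\<lambda>(x, y). norm (f x) * norm (g y)) summable_on (A \<times> B)"
  proof (rule summable_on_SigmaI)
    show "((\<lambda>y. case (x, y) of (x, y) \<Rightarrow> norm (f x) * norm (g y)) has_sum
        (norm (f x) * (\<Sum>\<^sub>\<infinity>y\<in>B. norm (g y)))) B" for x
      using has_sum_cmult_right[OF has_sum_infsum[OF g'], of "norm (f x)"] by simp
    show "(\<lambda>x. norm (f x) * (\<Sum>\<^sub>\<infinity>y\<in>B. norm (g y))) summable_on A"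
      by (rule summable_on_cmult_left[OF f'])
  qed auto
  then have "(\<lambda>p. norm (case p of (x, y) \<Rightarrow> f x * g y)) summable_on (A \<times> B)"
    by (simp add: case_prod_unfold norm_mult)
  then show "(\<lambda>(x, y). f x * g y) summable_on A \<times> B"
    by (rule abs_summable_summable)
qed

text \<open>With this bound, \<open>d\<close> counts the admissible entries 1, 3, ..., 2d - 1, and
  an induction on \<open>d\<close> can start from the empty list alone. A row of a symbol has d = D
  + 1.\<close>

definition odd_lists :: "nat \<Rightarrow> nat list set" where
  "odd_lists d = {xs. sorted_wrt (\<ge>) xs \<and> (\<forall>x\<in>set xs. odd x \<and> x < 2 * d)}"

lemma replicate_append_filter:
  fixes xs :: "nat list"
  assumes "sorted_wrt (\<ge>) xs" "\<forall>x\<in>set xs. x \<le> M"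
  shows "replicate (length (filter (\<lambda>x. x = M) xs)) M @ filter (\<lambda>x. x \<noteq> M) xs = xs"
  using assms
proof (induction xs)
  case (Cons x xs)
  show ?case
  proof (cases "x = M")
    case False
    with Cons.prems have "\<forall>y\<in>set xs. y \<noteq> M"
      by fastforce
    then have "filter (\<lambda>x. x = M) xs = []" "filter (\<lambda>x. x \<noteq> M) xs = xs"
      by (auto simp: filter_empty_conv filter_id_conv)
    with False show ?thesis
      by simp
  qed (use Cons in auto)
qed simp

text \<open>Splits off the copies of the largest admissible entry, which stand in front.\<close>

lemma bij_betw_odd_lists_Suc:
  "bij_betw (\<lambda>(m, ys). replicate m (2 * d + 1) @ ys) (UNIV \<times> odd_lists d) (odd_lists (Suc d))"
proof (rule bij_betwI)
  let ?M = "2 * d + 1"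
  show "(\<lambda>(m, ys). replicate m ?M @ ys) \<in> UNIV \<times> odd_lists d \<rightarrow> odd_lists (Suc d)"
  proof (clarify, goal_cases)
    case (1 m ys)
    have "sorted_wrt (\<ge>) (replicate m ?M)"
      by (induction m) auto
    then show ?case
      using 1 by (auto simp: odd_lists_def sorted_wrt_append)
  qed
  show "(\<lambda>xs. (length (filter (\<lambda>x. x = ?M) xs), filter (\<lambda>x. x \<noteq> ?M) xs))
      \<in> odd_lists (Suc d) \<rightarrow> UNIV \<times> odd_lists d"
  proof -
    have "x < 2 * d" if "odd x" "x < 2 * Suc d" "x \<noteq> ?M" for x
      using that by presburger
    then show ?thesis
      by (auto simp: odd_lists_def intro: sorted_wrt_filter)
  qed
next
  let ?M = "2 * d + 1"
  fix p :: "nat \<times> nat list" assume "p \<in> UNIV \<times> odd_lists d"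
  then obtain m ys where p: "p = (m, ys)" and "\<forall>y\<in>set ys. y \<noteq> ?M"
    by (force simp: odd_lists_def)
  then have "filter (\<lambda>x. x = ?M) ys = []" "filter (\<lambda>x. x \<noteq> ?M) ys = ys"
    by (auto simp: filter_empty_conv filter_id_conv)
  then show "(\<lambda>xs. (length (filter (\<lambda>x. x = ?M) xs), filter (\<lambda>x. x \<noteq> ?M) xs))
      ((\<lambda>(m, ys). replicate m ?M @ ys) p) = p"
    by (simp add: p)
next
  let ?M = "2 * d + 1"
  fix xs assume "xs \<in> odd_lists (Suc d)"
  then have "replicate (length (filter (\<lambda>x. x = ?M) xs)) ?M @ filter (\<lambda>x. x \<noteq> ?M) xs = xs"
    by (intro replicate_append_filter) (auto simp: odd_lists_def)
  then show "(\<lambda>(m, ys). replicate m ?M @ ys)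
      (length (filter (\<lambda>x. x = ?M) xs), filter (\<lambda>x. x \<noteq> ?M) xs) = xs"
    by simp
qed

text \<open>One geometric series per admissible entry. The weight \<open>z\<close> may lie on the
  unit circle, as every entry also carries a positive power of q.\<close>

lemma has_sum_odd_lists:
  fixes z q :: complex
  assumes "norm z \<le> 1" "norm q < 1"
  shows "((\<lambda>xs. z ^ length xs * q ^ sum_list xs) has_sum (1 / qpoch (z * q) (q\<^sup>2) d)) (odd_lists d)"
proof (induction d)
  case 0
  have "odd_lists 0 = {[]}"
    by (auto simp: odd_lists_def neq_Nil_conv)
  then show ?case
    using has_sum_finite[of "{[]}" "\<lambda>xs. z ^ length xs * q ^ sum_list xs"] by simp
next
  case (Suc d)
  let ?w = "z * q ^ (2 * d + 1)"
  have "norm ?w \<le> norm (q ^ (2 * d + 1))"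
    using assms mult_right_mono[of "norm z" 1 "norm (q ^ (2 * d + 1))"] by (simp add: norm_mult)
  also have "\<dots> < 1"
    using assms by (intro norm_power_less_one) auto
  finally have w: "norm ?w < 1" .
  have "(\<lambda>m. ?w ^ m) sums (1 / (1 - ?w))"
    using w by (rule geometric_sums)
  moreover have "summable (\<lambda>m. norm (?w ^ m))"
    using w unfolding norm_power by (intro summable_geometric) auto
  ultimately have "((\<lambda>m. ?w ^ m) has_sum (1 / (1 - ?w))) UNIV"
    by (intro norm_summable_imp_has_sum)
  from has_sum_product_complex[OF this Suc]
  have "((\<lambda>(m, ys). ?w ^ m * (z ^ length ys * q ^ sum_list ys)) has_sum
      (1 / (1 - ?w) * (1 / qpoch (z * q) (q\<^sup>2) d))) (UNIV \<times> odd_lists d)" .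
  also have "1 / (1 - ?w) * (1 / qpoch (z * q) (q\<^sup>2) d) = 1 / qpoch (z * q) (q\<^sup>2) (Suc d)"
    by (simp add: qpoch_Suc power_mult[symmetric] mult.assoc)
  also have "(\<lambda>(m, ys). ?w ^ m * (z ^ length ys * q ^ sum_list ys)) =
      (\<lambda>p. (\<lambda>xs. z ^ length xs * q ^ sum_list xs) ((\<lambda>(m, ys). replicate m (2 * d + 1) @ ys) p))"
    by (auto simp: fun_eq_iff sum_list_replicate power_add power_mult_distrib power_mult[symmetric]
        algebra_simps)
  finally show ?case
    by (subst (asm) has_sum_reindex_bij_betw[OF bij_betw_odd_lists_Suc])
qed

section \<open>The two-variable generating function of symbols\<close>

text \<open>Symbols of every size together: grouped by D they give the Eulerian series, grouped by
  size the counting function.\<close>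

definition all_symbols :: "(nat \<times> nat list \<times> nat list) set" where
  "all_symbols = (SIGMA D:UNIV. odd_lists (D + 1) \<times> odd_lists (D + 1))"

definition symbol_size :: "nat \<times> nat list \<times> nat list \<Rightarrow> nat" where
  "symbol_size = (\<lambda>(D, as, bs). sum_list as + sum_list bs + 2 * D\<^sup>2 + 2 * D + 1)"

lemma odd_Durfee_symbols_eq: "odd_Durfee_symbols n = {S \<in> all_symbols. symbol_size S = n}"
proof -
  have "x \<le> 2 * D + 1 \<longleftrightarrow> x < 2 * (D + 1)" for x D :: nat
    by auto
  then show ?thesis
    by (auto simp: odd_Durfee_symbols_def all_symbols_def odd_lists_def symbol_size_def)
qed

text \<open>The common majorant for all x on the unit circle, where the rank contributes a factor of
  norm 1.\<close>

lemma summable_all_symbols: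
  fixes q :: complex
  assumes "norm q < 1"
  shows "(\<lambda>S. norm q ^ symbol_size S) summable_on all_symbols"
proof -
  \<comment> \<open>A complex copy of the real number \<open>norm q\<close>, so that the
    complex-valued \<open>has_sum_odd_lists\<close> applies.\<close>
  define p where "p = complex_of_real (norm q)"
  define c where "c d = 1 / qpoch p (p\<^sup>2) d" for d
  have p: "norm p < 1" "norm (p\<^sup>2) < 1"
    using assms norm_power_less_one[of p 2] by (simp_all add: p_def)
  have "c \<longlonglongrightarrow> 1 / qpoch_inf p (p\<^sup>2)"
    unfolding c_def by (intro tendsto_divide tendsto_const qpoch_LIMSEQ qpoch_inf_nonzero_norm p)
  then obtain K where K: "norm (c d) \<le> K" for d
    using convergent_imp_Bseq[of c] by (auto simp: convergent_def Bseq_def)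
  have "((\<lambda>y. case (D, y) of (D, as, bs) \<Rightarrow> norm q ^ (2 * D\<^sup>2 + 2 * D + 1) * norm q ^ (sum_list as + sum_list bs))
      has_sum (norm q ^ (2 * D\<^sup>2 + 2 * D + 1) * Re (c (D + 1) * c (D + 1))))
      (odd_lists (D + 1) \<times> odd_lists (D + 1))" for D
  proof -
    have "((\<lambda>xs. p ^ sum_list xs) has_sum c d) (odd_lists d)" for d
      using has_sum_odd_lists[of 1 p d] p by (simp add: c_def)
    from has_sum_Re[OF has_sum_product_complex[OF this this]]
    have "((\<lambda>(as, bs). norm q ^ (sum_list as + sum_list bs)) has_sum Re (c (D + 1) * c (D + 1)))
        (odd_lists (D + 1) \<times> odd_lists (D + 1))"
      by (simp add: p_def case_prod_unfold power_add flip: of_real_power of_real_mult)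
    from has_sum_cmult_right[OF this] show ?thesis
      by (simp add: case_prod_unfold)
  qed
  moreover have "(\<lambda>D. norm q ^ (2 * D\<^sup>2 + 2 * D + 1) * Re (c (D + 1) * c (D + 1))) summable_on UNIV"
  proof (rule norm_summable_imp_summable_on, rule summable_comparison_test')
    show "summable (\<lambda>D. norm q ^ D * (K * K))"
      using assms by (intro summable_mult2 summable_geometric) auto
    fix D
    have "\<bar>Re (c (D + 1) * c (D + 1))\<bar> \<le> norm (c (D + 1) * c (D + 1))"
      by (rule abs_Re_le_cmod)
    also have "\<dots> \<le> K * K"
      unfolding norm_mult using K[of "D + 1"] order_trans[OF norm_ge_zero K]
      by (intro mult_mono) auto
    finally have "\<bar>Re (c (D + 1) * c (D + 1))\<bar> \<le> K * K" .
    moreover have "norm q ^ (2 * D\<^sup>2 + 2 * D + 1) \<le> norm q ^ D"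
      using assms by (intro power_decreasing) auto
    ultimately have "norm q ^ (2 * D\<^sup>2 + 2 * D + 1) * \<bar>Re (c (D + 1) * c (D + 1))\<bar> \<le> norm q ^ D * (K * K)"
      by (intro mult_mono) auto
    then show "norm (norm (norm q ^ (2 * D\<^sup>2 + 2 * D + 1) * Re (c (D + 1) * c (D + 1)))) \<le> norm q ^ D * (K * K)"
      unfolding real_norm_def abs_idempotent abs_mult by simp
  qed
  ultimately have "(\<lambda>(D, as, bs). norm q ^ (2 * D\<^sup>2 + 2 * D + 1) * norm q ^ (sum_list as + sum_list bs))
      summable_on all_symbols"
    unfolding all_symbols_def by (rule summable_on_SigmaI) auto
  then show ?thesis
    by (simp add: symbol_size_def case_prod_unfold power_add mult_ac)
qed

text \<open>Absolute summability shows that some value exists; summing over the rows for each fixed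
  D then identifies it with \<open>T\<close>.\<close>

lemma has_sum_all_symbols:
  fixes x q :: complex
  assumes "norm q < 1" "norm x = 1"
    and T: "(\<lambda>D. q ^ (2 * D\<^sup>2 + 2 * D + 1) / (qpoch (x * q) (q\<^sup>2) (D + 1) * qpoch (q / x) (q\<^sup>2) (D + 1))) sums T"
  shows "((\<lambda>S. x powi odd_rank S * q ^ symbol_size S) has_sum T) all_symbols"
proof -
  define F where "F S = x powi odd_rank S * q ^ symbol_size S" for S
  have x: "x \<noteq> 0" "norm (inverse x) \<le> 1" "norm x \<le> 1"
    using assms(2) by (auto simp: norm_inverse)
  have "(\<lambda>S. norm (F S)) summable_on all_symbols"
    using summable_all_symbols[OF assms(1)] assms(2)
    by (simp add: F_def norm_mult norm_power norm_power_int)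
  then have "F summable_on all_symbols"
    by (rule abs_summable_summable)
  then obtain T' where T': "(F has_sum T') all_symbols"
    by (auto simp: summable_on_def)
  have "((\<lambda>y. F (D, y)) has_sum (q ^ (2 * D\<^sup>2 + 2 * D + 1) / (qpoch (x * q) (q\<^sup>2) (D + 1) * qpoch (q / x) (q\<^sup>2) (D + 1))))
      (odd_lists (D + 1) \<times> odd_lists (D + 1))" for D
  proof -
    have "((\<lambda>y. q ^ (2 * D\<^sup>2 + 2 * D + 1) * (case y of (as, bs) \<Rightarrow>
        x ^ length as * q ^ sum_list as * (inverse x ^ length bs * q ^ sum_list bs))) has_sum
        (q ^ (2 * D\<^sup>2 + 2 * D + 1) * (1 / qpoch (x * q) (q\<^sup>2) (D + 1) * (1 / qpoch (inverse x * q) (q\<^sup>2) (D + 1)))))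
        (odd_lists (D + 1) \<times> odd_lists (D + 1))"
      by (intro has_sum_cmult_right has_sum_product_complex has_sum_odd_lists assms x)
    moreover have "(\<lambda>y. q ^ (2 * D\<^sup>2 + 2 * D + 1) * (case y of (as, bs) \<Rightarrow>
        x ^ length as * q ^ sum_list as * (inverse x ^ length bs * q ^ sum_list bs))) = (\<lambda>y. F (D, y))"
      using x(1)
      by (auto simp: fun_eq_iff F_def odd_rank_def symbol_size_def power_int_diff power_add field_simps)
    ultimately show ?thesis
      by (simp add: field_simps)
  qed
  from has_sum_SigmaD[OF T'[unfolded all_symbols_def] this]
  have "(\<lambda>D. q ^ (2 * D\<^sup>2 + 2 * D + 1) / (qpoch (x * q) (q\<^sup>2) (D + 1) * qpoch (q / x) (q\<^sup>2) (D + 1))) sums T'"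
    by (intro has_sum_imp_sums) simp
  with T have "T = T'"
    by (rule sums_unique2)
  with T' show ?thesis
    by (simp add: F_def[abs_def])
qed

text \<open>The family is regrouped into the finite sets of symbols of equal size.\<close>

lemma sums_N0:
  fixes q :: complex
  assumes "((\<lambda>S. of_bool [odd_rank S = a] (mod M) * q ^ symbol_size S) has_sum T) all_symbols"
  shows "(\<lambda>n. of_nat (N0 a M n) * q ^ n) sums T"
proof (rule has_sum_imp_sums, rule has_sum_SigmaD)
  let ?f = "\<lambda>(n :: nat, S). of_bool [odd_rank S = a] (mod M) * q ^ symbol_size S"
  have "bij_betw (\<lambda>S. (symbol_size S, S)) all_symbols (Sigma UNIV odd_Durfee_symbols)"
    by (auto simp: bij_betw_def inj_on_def odd_Durfee_symbols_eq)
  from has_sum_reindex_bij_betw[OF this, of ?f] assms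
  show "(?f has_sum T) (Sigma UNIV odd_Durfee_symbols)"
    by simp
  fix n
  have "(\<Sum>S\<in>odd_Durfee_symbols n. ?f (n, S)) = (\<Sum>S\<in>odd_Durfee_symbols n. of_bool [odd_rank S = a] (mod M) * q ^ n)"
    by (intro sum.cong) (auto simp: odd_Durfee_symbols_eq)
  also have "\<dots> = of_nat (N0 a M n) * q ^ n"
    using finite_odd_Durfee_symbols[of n]
    by (simp add: N0_def sum_distrib_right[symmetric] Int_def)
  finally show "((\<lambda>S. ?f (n, S)) has_sum (of_nat (N0 a M n) * q ^ n)) (odd_Durfee_symbols n)"
    using has_sum_finite[OF finite_odd_Durfee_symbols, of "\<lambda>S. ?f (n, S)" n] by simp
qed

definition odd_rank_gf :: "complex \<Rightarrow> complex \<Rightarrow> complex" where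
  "odd_rank_gf x q = q * mock_g (x * q) (q\<^sup>2)"

lemma theta_prod_unit_nonzero:
  assumes "norm q < 1" "q \<noteq> 0" "norm x = 1"
  shows "theta_prod (x * q) (q\<^sup>2) \<noteq> 0"
proof (rule theta_prod_nonzero)
  show "norm (q\<^sup>2) < norm (x * q)" "norm (x * q) \<le> 1"
    using assms by (simp_all add: norm_mult norm_power power2_eq_square)
  show "x * q \<noteq> 1"
    using assms by (metis less_irrefl mult_1 norm_mult norm_one)
qed

lemma odd_rank_gf_has_sum:
  assumes "norm q < 1" "q \<noteq> 0" "norm x = 1"
  shows "((\<lambda>S. x powi odd_rank S * q ^ symbol_size S) has_sum odd_rank_gf x q) all_symbols"
proof (rule has_sum_all_symbols[OF assms(1,3)])
  have x: "x \<noteq> 0"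
    using assms(3) by auto
  have "(\<lambda>D. q * ((q\<^sup>2) ^ (D * (D + 1)) / (qpoch (x * q) (q\<^sup>2) (D + 1) * qpoch (q\<^sup>2 / (x * q)) (q\<^sup>2) (D + 1))))
      sums odd_rank_gf x q"
    unfolding odd_rank_gf_def using x assms
    by (intro sums_mult mock_g_sums norm_power_less_one theta_prod_unit_nonzero) auto
  moreover have "q\<^sup>2 / (x * q) = q / x"
    using assms(2) by (simp add: power2_eq_square)
  moreover have "q * (q\<^sup>2) ^ (D * (D + 1)) = q ^ (2 * D\<^sup>2 + 2 * D + 1)" for D
  proof -
    have "2 * D\<^sup>2 + 2 * D + 1 = 2 * (D * (D + 1)) + 1"
      by (simp add: power2_eq_square)
    then show ?thesis
      by (simp only: power_add power_mult) simp
  qed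
  ultimately show "(\<lambda>D. q ^ (2 * D\<^sup>2 + 2 * D + 1) / (qpoch (x * q) (q\<^sup>2) (D + 1) * qpoch (q / x) (q\<^sup>2) (D + 1)))
      sums odd_rank_gf x q"
    by (simp only: times_divide_eq_right)
qed

text \<open>The analytic counterpart of exchanging the two rows, which negates the rank.\<close>

lemma odd_rank_gf_inverse:
  assumes "norm q < 1" "q \<noteq> 0" "norm x = 1" "x * y = 1"
  shows "odd_rank_gf y q = odd_rank_gf x q"
proof -
  have x: "x \<noteq> 0"
    using assms(3) by auto
  then have "y = 1 / x"
    using assms(4) by (simp add: field_simps)
  then have "y * q = q\<^sup>2 / (x * q)"
    using assms(2) by (simp add: power2_eq_square)
  with x show ?thesis
    unfolding odd_rank_gf_def
    using mock_g_reflect[of "q\<^sup>2" "x * q"] theta_prod_unit_nonzero[OF assms(1-3)] assms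
    by (simp add: norm_power_less_one)
qed

section \<open>The filter by eighth roots of unity\<close>

lemma has_sum_sum_fun:
  fixes f :: "'a \<Rightarrow> 'b \<Rightarrow> complex"
  assumes "finite I" "\<And>i. i \<in> I \<Longrightarrow> (f i has_sum s i) A"
  shows "((\<lambda>x. \<Sum>i\<in>I. f i x) has_sum (\<Sum>i\<in>I. s i)) A"
  using assms by (induction I rule: finite_induct) (auto intro!: has_sum_add)

definition zeta8 :: complex where
  "zeta8 = cis (pi / 4)"

lemma zeta8_square: "zeta8\<^sup>2 = \<i>"
  by (simp add: zeta8_def power2_eq_square cis_mult)

lemma zeta8_powers:
  "zeta8 ^ 3 = \<i> * zeta8" "zeta8 ^ 4 = - 1" "zeta8 ^ 5 = - zeta8" "zeta8 ^ 6 = - \<i>"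
  "zeta8 ^ 7 = - (\<i> * zeta8)" "zeta8 ^ 8 = 1"
proof -
  have "zeta8 ^ 3 = zeta8\<^sup>2 * zeta8" "zeta8 ^ 4 = zeta8\<^sup>2 * zeta8\<^sup>2" "zeta8 ^ 5 = zeta8\<^sup>2 * zeta8\<^sup>2 * zeta8"
    "zeta8 ^ 6 = zeta8\<^sup>2 * zeta8\<^sup>2 * zeta8\<^sup>2" "zeta8 ^ 7 = zeta8\<^sup>2 * zeta8\<^sup>2 * zeta8\<^sup>2 * zeta8"
    "zeta8 ^ 8 = zeta8\<^sup>2 * zeta8\<^sup>2 * zeta8\<^sup>2 * zeta8\<^sup>2"
    by (simp_all add: eval_nat_numeral)
  then show "zeta8 ^ 3 = \<i> * zeta8" "zeta8 ^ 4 = - 1" "zeta8 ^ 5 = - zeta8" "zeta8 ^ 6 = - \<i>"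
    "zeta8 ^ 7 = - (\<i> * zeta8)" "zeta8 ^ 8 = 1"
    by (simp_all add: zeta8_square)
qed

lemma norm_zeta8: "norm zeta8 = 1" and zeta8_nonzero: "zeta8 \<noteq> 0"
  by (simp_all add: zeta8_def)

text \<open>Raising the hypothesis to the powers 4, 2 and 1 shows in turn that k, k/2 and k/4 are
  even, since each time a power of -1 equals 1.\<close>

lemma zeta8_powi_eq_1:
  assumes "zeta8 powi k = 1"
  shows "8 dvd k"
proof -
  have pw: "(zeta8 ^ n) powi k = 1" for n
    using assms by (simp add: power_int_power power_int_mult mult.commute[of "int n"])
  have minus1: "even k" if "(- 1 :: complex) powi k = 1" for k
    using that by (cases "even k") auto
  have "even k"
    using pw[of 4] by (intro minus1) (simp add: zeta8_powers)
  then obtain l where l: "k = 2 * l"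
    by blast
  have "even l"
    using pw[of 2] by (intro minus1) (simp add: l power_int_mult zeta8_square)
  then obtain m where m: "l = 2 * m"
    by blast
  have "even m"
    using pw[of 1] by (intro minus1) (simp add: l m power_int_mult zeta8_powers)
  then show ?thesis
    by (auto simp: l m)
qed

lemma sum_zeta8_powi: "(\<Sum>j<8. (zeta8 ^ j) powi k) = 8 * of_bool (8 dvd k)"
proof -
  define y where "y = zeta8 powi k"
  have "(zeta8 ^ j) powi k = y ^ j" for j
    by (simp add: y_def power_int_power power_int_power' mult.commute)
  then have sum: "(\<Sum>j<8. (zeta8 ^ j) powi k) = (\<Sum>j<8. y ^ j)"
    by simp
  have y8: "y ^ 8 = 1"
    using zeta8_powers(6) by (simp add: y_def power_int_power' mult.commute[of k] power_int_mult)
  show ?thesis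
  proof (cases "8 dvd k")
    case True
    then obtain m where "k = 8 * m"
      by blast
    then have "y = 1"
      by (simp add: y_def power_int_mult zeta8_powers)
    with True sum show ?thesis
      by simp
  next
    case False
    then have "y \<noteq> 1"
      using zeta8_powi_eq_1 by (auto simp: y_def)
    moreover have "(1 - y) * (\<Sum>j<8. y ^ j) = 1 - y ^ 8"
      by (rule one_diff_power_eq[symmetric])
    ultimately show ?thesis
      using y8 sum False by simp
  qed
qed

text \<open>\<open>b\<close> is a natural representative of -a modulo 8, which keeps the weights
  ordinary powers.\<close>

lemma N0_8_sums:
  assumes "norm q < 1" "q \<noteq> 0" and ab: "[int b = - a] (mod 8)"
  shows "(\<lambda>n. of_nat (N0 a 8 n) * q ^ n) sums (1/8 * (\<Sum>j<8. (zeta8 ^ j) ^ b * odd_rank_gf (zeta8 ^ j) q))"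
proof (rule sums_N0)
  have *: "((\<lambda>S. 1/8 * (\<Sum>j<8. (zeta8 ^ j) ^ b * ((zeta8 ^ j) powi odd_rank S * q ^ symbol_size S))) has_sum
      (1/8 * (\<Sum>j<8. (zeta8 ^ j) ^ b * odd_rank_gf (zeta8 ^ j) q))) all_symbols"
    by (intro has_sum_cmult_right has_sum_sum_fun odd_rank_gf_has_sum assms)
       (simp_all add: norm_power norm_zeta8)
  have "1/8 * (\<Sum>j<8. (zeta8 ^ j) ^ b * ((zeta8 ^ j) powi odd_rank S * q ^ symbol_size S)) =
      of_bool [odd_rank S = a] (mod 8) * q ^ symbol_size S" for S
  proof -
    have "(\<Sum>j<8. (zeta8 ^ j) ^ b * ((zeta8 ^ j) powi odd_rank S * q ^ symbol_size S)) =
        (\<Sum>j<8. (zeta8 ^ j) powi (odd_rank S + int b)) * q ^ symbol_size S"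
      by (simp add: sum_distrib_left power_int_add zeta8_nonzero mult_ac)
    also have "8 dvd odd_rank S + int b \<longleftrightarrow> [odd_rank S = a] (mod 8)"
    proof -
      have "8 dvd int b + a"
        using ab by (simp add: cong_iff_dvd_diff)
      then show ?thesis
        using dvd_diff_commute[of 8 "odd_rank S" a] dvd_add_left_iff[of 8 "int b + a" "odd_rank S - a"]
        by (simp add: cong_iff_dvd_diff algebra_simps)
    qed
    ultimately show ?thesis
      by (simp add: sum_zeta8_powi)
  qed
  with * show "((\<lambda>S. of_bool [odd_rank S = a] (mod 8) * q ^ symbol_size S) has_sum
      (1/8 * (\<Sum>j<8. (zeta8 ^ j) ^ b * odd_rank_gf (zeta8 ^ j) q))) all_symbols"
    by (simp only:)
qed

text \<open>Pairs of mutually inverse roots; the values at 1, -1, \<open>\<i>\<close>,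
  \<open>zeta8\<close> and \<open>- zeta8\<close> remain.\<close>

lemma odd_rank_gf_zeta8:
  assumes "norm q < 1" "q \<noteq> 0"
  shows "odd_rank_gf (- \<i>) q = odd_rank_gf \<i> q"
    "odd_rank_gf (\<i> * zeta8) q = odd_rank_gf (- zeta8) q"
    "odd_rank_gf (- (\<i> * zeta8)) q = odd_rank_gf zeta8 q"
  using zeta8_square
  by (intro odd_rank_gf_inverse assms; simp add: norm_zeta8 power2_eq_square algebra_simps)+

text \<open>The coefficient \<open>(1 - \<i>) * zeta8\<close> is zeta8 + 1/zeta8, that is, the
  square root of 2. In this form it is handled by \<open>zeta8_square\<close> alone.\<close>

lemma N0_8_cases_sums:
  assumes "norm q < 1" "q \<noteq> 0"
  defines "R \<equiv> \<lambda>x. odd_rank_gf x q"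
  shows "(\<lambda>n. of_nat (N0 0 8 n) * q ^ n) sums
      (1/8 * (R 1 + R (- 1) + 2 * R \<i> + 2 * (R zeta8 + R (- zeta8))))"
    "(\<lambda>n. of_nat (N0 1 8 n) * q ^ n) sums
      (1/8 * (R 1 - R (- 1) + (1 - \<i>) * zeta8 * (R zeta8 - R (- zeta8))))"
    "(\<lambda>n. of_nat (N0 2 8 n) * q ^ n) sums (1/8 * (R 1 + R (- 1) - 2 * R \<i>))"
    "(\<lambda>n. of_nat (N0 3 8 n) * q ^ n) sums
      (1/8 * (R 1 - R (- 1) - (1 - \<i>) * zeta8 * (R zeta8 - R (- zeta8))))"
    "(\<lambda>n. of_nat (N0 4 8 n) * q ^ n) sums
      (1/8 * (R 1 + R (- 1) + 2 * R \<i> - 2 * (R zeta8 + R (- zeta8))))"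
proof -
  have set8: "{..<8} = {0, 1, 2, 3, 4, 5, 6, 7 :: nat}"
    by auto
  have ipow: "\<i> ^ 3 = - \<i>" "\<i> ^ 4 = 1" "\<i> ^ 5 = \<i>" "\<i> ^ 6 = - 1" "\<i> ^ 7 = - \<i>"
    by (simp_all add: eval_nat_numeral)
  note simps = set8 zeta8_square zeta8_powers odd_rank_gf_zeta8[OF assms(1,2)] power_mult_distrib ipow
    R_def algebra_simps
  show "(\<lambda>n. of_nat (N0 0 8 n) * q ^ n) sums
      (1/8 * (R 1 + R (- 1) + 2 * R \<i> + 2 * (R zeta8 + R (- zeta8))))"
    using N0_8_sums[OF assms(1,2), of 0 0] by (simp add: simps)
  show "(\<lambda>n. of_nat (N0 1 8 n) * q ^ n) sums
      (1/8 * (R 1 - R (- 1) + (1 - \<i>) * zeta8 * (R zeta8 - R (- zeta8))))"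
    using N0_8_sums[OF assms(1,2), of 7 1] by (simp add: simps cong_def)
  show "(\<lambda>n. of_nat (N0 2 8 n) * q ^ n) sums (1/8 * (R 1 + R (- 1) - 2 * R \<i>))"
    using N0_8_sums[OF assms(1,2), of 6 2] by (simp add: simps cong_def)
  show "(\<lambda>n. of_nat (N0 3 8 n) * q ^ n) sums
      (1/8 * (R 1 - R (- 1) - (1 - \<i>) * zeta8 * (R zeta8 - R (- zeta8))))"
    using N0_8_sums[OF assms(1,2), of 5 3] by (simp add: simps cong_def)
  show "(\<lambda>n. of_nat (N0 4 8 n) * q ^ n) sums
      (1/8 * (R 1 + R (- 1) + 2 * R \<i> - 2 * (R zeta8 + R (- zeta8))))"
    using N0_8_sums[OF assms(1,2), of 4 4] by (simp add: simps cong_def)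
qed

section \<open>The rank function at eighth roots of unity\<close>

text \<open>For argument x q and base q^2 the third term of the bisection is again a rank function,
  at -x^2 and q^4. The map x -> -x^2 sends primitive eighth roots to \<open>\<i>\<close> or
  \<open>- \<i>\<close>, these to 1, and both 1 and -1 to -1.\<close>

lemma odd_rank_gf_sum:
  assumes q: "norm q < 1" "q \<noteq> 0" and x: "norm x = 1"
  shows "odd_rank_gf x q + odd_rank_gf (- x) q + 2 / q * odd_rank_gf (- (x\<^sup>2)) (q ^ 4) =
    2 * q * qJ 4 q ^ 4 / ((qJ 2 q)\<^sup>2 * qJ 8 q) /
      (theta_prod (x\<^sup>2 * q\<^sup>2) ((q\<^sup>2)\<^sup>2) * theta_prod (- (x\<^sup>2) * q ^ 4) ((q ^ 4)\<^sup>2))"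
proof -
  have q2: "norm (q\<^sup>2) < 1" "q\<^sup>2 \<noteq> 0" and q4: "norm (q ^ 4) < 1" "q ^ 4 \<noteq> 0"
    using q by (simp_all add: norm_power_less_one)
  have eq: "(x * q)\<^sup>2 = x\<^sup>2 * q\<^sup>2" "- (q\<^sup>2) * (x\<^sup>2 * q\<^sup>2) = - (x\<^sup>2) * q ^ 4" "(q\<^sup>2) ^ 4 = (q ^ 4)\<^sup>2"
    by (simp_all add: power_mult_distrib flip: power_mult power_add)
  have xq: "x * q \<noteq> 0"
    using x q by auto
  have nz: "theta_prod (x\<^sup>2 * q\<^sup>2) ((q\<^sup>2)\<^sup>2) \<noteq> 0" "theta_prod (- (x\<^sup>2) * q ^ 4) ((q ^ 4)\<^sup>2) \<noteq> 0"
    by (rule theta_prod_unit_nonzero; use q2 q4 x in \<open>simp add: norm_power\<close>)+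
  have "mock_g (x * q) (q\<^sup>2) + mock_g (- (x * q)) (q\<^sup>2) + 2 * q\<^sup>2 * mock_g (- (x\<^sup>2) * q ^ 4) ((q ^ 4)\<^sup>2) =
      2 * qJ 2 (q\<^sup>2) ^ 4 / ((qJ 1 (q\<^sup>2))\<^sup>2 * qJ 4 (q\<^sup>2)) /
      (theta_prod (x\<^sup>2 * q\<^sup>2) ((q\<^sup>2)\<^sup>2) * theta_prod (- (x\<^sup>2) * q ^ 4) ((q ^ 4)\<^sup>2))"
    using mock_g_bisection_sum[OF q2 xq] nz unfolding eq by simp
  then have "q * (mock_g (x * q) (q\<^sup>2) + mock_g (- (x * q)) (q\<^sup>2) + 2 * q\<^sup>2 * mock_g (- (x\<^sup>2) * q ^ 4) ((q ^ 4)\<^sup>2)) =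
      2 * q * qJ 4 q ^ 4 / ((qJ 2 q)\<^sup>2 * qJ 8 q) /
      (theta_prod (x\<^sup>2 * q\<^sup>2) ((q\<^sup>2)\<^sup>2) * theta_prod (- (x\<^sup>2) * q ^ 4) ((q ^ 4)\<^sup>2))"
    by (simp add: qJ_power)
  moreover have "2 / q * odd_rank_gf (- (x\<^sup>2)) (q ^ 4) = q * (2 * q\<^sup>2 * mock_g (- (x\<^sup>2) * q ^ 4) ((q ^ 4)\<^sup>2))"
    using q(2) by (simp add: odd_rank_gf_def eval_nat_numeral)
  ultimately show ?thesis
    by (simp add: odd_rank_gf_def algebra_simps)
qed

text \<open>Here the power of q cancels from the argument of the third term, which therefore lies on
  the unit circle. For x^2 = -1 it would be the pole 1.\<close>

lemma odd_rank_gf_diff: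
  assumes q: "norm q < 1" "q \<noteq> 0" and x: "norm x = 1" "x\<^sup>2 \<noteq> - 1"
  shows "odd_rank_gf x q - odd_rank_gf (- x) q = - 2 / x + 2 / x ^ 3 * mock_g (- 1 / x\<^sup>2) (q ^ 8)
    + 2 * qJ 4 q ^ 4 / ((qJ 2 q)\<^sup>2 * qJ 8 q) /
      (x * (theta_prod (x\<^sup>2 * q\<^sup>2) ((q\<^sup>2)\<^sup>2) * theta_prod (- 1 / x\<^sup>2) (q ^ 8)))"
proof -
  have q2: "norm (q\<^sup>2) < 1" "q\<^sup>2 \<noteq> 0" and q8: "norm (q ^ 8) < 1"
    using q by (simp_all add: norm_power_less_one)
  have x0: "x \<noteq> 0"
    using x by auto
  have eq: "(x * q)\<^sup>2 = x\<^sup>2 * q\<^sup>2" "- (q\<^sup>2) / (x\<^sup>2 * q\<^sup>2) = - 1 / x\<^sup>2" "(q\<^sup>2) ^ 4 = q ^ 8"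
    using q by (simp_all add: power_mult_distrib flip: power_mult power_add)
  have xq: "x * q \<noteq> 0"
    using x0 q by auto
  have nz1: "theta_prod (x\<^sup>2 * q\<^sup>2) ((q\<^sup>2)\<^sup>2) \<noteq> 0"
    by (rule theta_prod_unit_nonzero; use q2 x in \<open>simp add: norm_power\<close>)
  have "- 1 / x\<^sup>2 \<noteq> 1"
    using x0 x(2) by (simp add: field_simps eq_commute[of "- 1"])
  then have nz2: "theta_prod (- 1 / x\<^sup>2) (q ^ 8) \<noteq> 0"
    using q8 x(1) by (intro theta_prod_nonzero) (simp_all add: norm_divide norm_power)
  define M N T where "M = mock_g (- 1 / x\<^sup>2) (q ^ 8)" and "N = 2 * qJ 4 q ^ 4 / ((qJ 2 q)\<^sup>2 * qJ 8 q)"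
    and "T = theta_prod (x\<^sup>2 * q\<^sup>2) ((q\<^sup>2)\<^sup>2) * theta_prod (- 1 / x\<^sup>2) (q ^ 8)"
  have "mock_g (x * q) (q\<^sup>2) - mock_g (- (x * q)) (q\<^sup>2) =
      - 2 / (x * q) + 2 * q\<^sup>2 / (x * q) ^ 3 * M + N / (x * q * T)"
    using mock_g_bisection_diff[OF q2 xq] nz1 nz2 unfolding eq M_def N_def T_def by (simp add: qJ_power)
  moreover have "odd_rank_gf x q - odd_rank_gf (- x) q =
      q * (mock_g (x * q) (q\<^sup>2) - mock_g (- (x * q)) (q\<^sup>2))"
    by (simp add: odd_rank_gf_def algebra_simps)
  ultimately have "odd_rank_gf x q - odd_rank_gf (- x) q =
      q * (- 2 / (x * q) + 2 * q\<^sup>2 / (x * q) ^ 3 * M + N / (x * q * T))"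
    by simp
  also have "\<dots> = - 2 / x + 2 / x ^ 3 * M + N / (x * T)"
    using q(2) x0 by (simp add: ring_distribs power_mult_distrib power2_eq_square power3_eq_cube)
  finally show ?thesis
    by (simp add: M_def N_def T_def)
qed

lemma odd_rank_gf_sum_1:
  assumes q: "norm q < 1" "q \<noteq> 0"
  shows "odd_rank_gf 1 q + odd_rank_gf (- 1) q =
    - 2 / q * odd_rank_gf (- 1) (q ^ 4) + 2 * q * (qJ 4 q ^ 8 * (qJ 16 q)\<^sup>2 / (qJ 2 q ^ 4 * qJ 8 q ^ 5))"
proof -
  have q2: "norm (q\<^sup>2) < 1" "q\<^sup>2 \<noteq> 0" and q4: "norm (q ^ 4) < 1" "q ^ 4 \<noteq> 0"
    using q by (simp_all add: norm_power_less_one)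
  have "odd_rank_gf 1 q + odd_rank_gf (- 1) q + 2 / q * odd_rank_gf (- 1) (q ^ 4) =
    2 * q * qJ 4 q ^ 4 / ((qJ 2 q)\<^sup>2 * qJ 8 q) /
      ((qJ 2 q / qJ 4 q)\<^sup>2 * ((qJ 8 q)\<^sup>2 / (qJ 4 q * qJ 16 q))\<^sup>2)"
    using odd_rank_gf_sum[OF q, of 1] theta_prod_odd[OF q2] theta_prod_minus_odd[OF q4]
    by (simp add: qJ_power)
  also have "\<dots> = 2 * q * (qJ 4 q ^ 8 * (qJ 16 q)\<^sup>2 / (qJ 2 q ^ 4 * qJ 8 q ^ 5))"
    using qJ_nonzero[OF q(1)] by (simp add: field_simps eval_nat_numeral)
  finally show ?thesis
    by (simp add: algebra_simps)
qed

text \<open>The values at \<open>\<i>\<close> and \<open>- \<i>\<close> agree, so the sum formula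
  determines a single value.\<close>

lemma odd_rank_gf_ii:
  assumes q: "norm q < 1" "q \<noteq> 0"
  shows "odd_rank_gf \<i> q = - 1 / q * odd_rank_gf 1 (q ^ 4) + q * (qJ 8 q ^ 3 / (qJ 4 q)\<^sup>2)"
proof -
  have q2: "norm (q\<^sup>2) < 1" "q\<^sup>2 \<noteq> 0" and q4: "norm (q ^ 4) < 1" "q ^ 4 \<noteq> 0"
    using q by (simp_all add: norm_power_less_one)
  have "2 * (odd_rank_gf \<i> q + 1 / q * odd_rank_gf 1 (q ^ 4)) =
    2 * q * qJ 4 q ^ 4 / ((qJ 2 q)\<^sup>2 * qJ 8 q) /
      (((qJ 4 q)\<^sup>2 / (qJ 2 q * qJ 8 q))\<^sup>2 * (qJ 4 q / qJ 8 q)\<^sup>2)"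
    using odd_rank_gf_sum[OF q, of \<i>] theta_prod_minus_odd[OF q2] theta_prod_odd[OF q4]
    by (simp add: qJ_power odd_rank_gf_zeta8[OF q] ring_distribs)
  also have "\<dots> = 2 * (q * (qJ 8 q ^ 3 / (qJ 4 q)\<^sup>2))"
    using qJ_nonzero[OF q(1)] by (simp add: field_simps eval_nat_numeral)
  finally have "odd_rank_gf \<i> q + 1 / q * odd_rank_gf 1 (q ^ 4) = q * (qJ 8 q ^ 3 / (qJ 4 q)\<^sup>2)"
    by (simp only: mult_cancel_left) simp
  then show ?thesis
    by (simp add: algebra_simps)
qed

text \<open>The sum formula leads to \<open>\<i>\<close> at q^4, and \<open>odd_rank_gf_ii\<close>
  from there to 1 at q^16.\<close>

lemma odd_rank_gf_sum_zeta8: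
  assumes q: "norm q < 1" "q \<noteq> 0"
  shows "odd_rank_gf zeta8 q + odd_rank_gf (- zeta8) q =
    2 / q ^ 5 * odd_rank_gf 1 (q ^ 16) - 2 * q ^ 3 * (qJ 32 q ^ 3 / (qJ 16 q)\<^sup>2)
    + 2 * q * (qJ 4 q ^ 5 * qJ 32 q / ((qJ 2 q)\<^sup>2 * (qJ 8 q)\<^sup>2 * qJ 16 q))"
proof -
  have q2: "norm (q\<^sup>2) < 1" "q\<^sup>2 \<noteq> 0" and q4: "norm (q ^ 4) < 1" "q ^ 4 \<noteq> 0"
    using q by (simp_all add: norm_power_less_one)
  have "odd_rank_gf zeta8 q + odd_rank_gf (- zeta8) q + 2 / q * odd_rank_gf \<i> (q ^ 4) =
    2 * q * qJ 4 q ^ 4 / ((qJ 2 q)\<^sup>2 * qJ 8 q) /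
      ((qJ 8 q)\<^sup>2 / (qJ 4 q * qJ 16 q) * ((qJ 16 q)\<^sup>2 / (qJ 8 q * qJ 32 q)))"
    using odd_rank_gf_sum[OF q norm_zeta8] theta_prod_ii_odd(1)[OF q2] theta_prod_ii_odd(2)[OF q4]
    by (simp add: qJ_power zeta8_square odd_rank_gf_zeta8[OF q4])
  also have "\<dots> = 2 * q * (qJ 4 q ^ 5 * qJ 32 q / ((qJ 2 q)\<^sup>2 * (qJ 8 q)\<^sup>2 * qJ 16 q))"
    using qJ_nonzero[OF q(1)] by (simp add: field_simps eval_nat_numeral)
  finally have "odd_rank_gf zeta8 q + odd_rank_gf (- zeta8) q = - 2 / q * odd_rank_gf \<i> (q ^ 4) +
      2 * q * (qJ 4 q ^ 5 * qJ 32 q / ((qJ 2 q)\<^sup>2 * (qJ 8 q)\<^sup>2 * qJ 16 q))"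
    by (simp add: algebra_simps)
  moreover have "odd_rank_gf \<i> (q ^ 4) =
      - 1 / q ^ 4 * odd_rank_gf 1 (q ^ 16) + q ^ 4 * (qJ 32 q ^ 3 / (qJ 16 q)\<^sup>2)"
    using odd_rank_gf_ii[OF q4] by (simp add: qJ_power flip: power_mult)
  moreover have "- 2 / q * (- 1 / q ^ 4 * X + q ^ 4 * Y) = 2 / q ^ 5 * X - 2 * q ^ 3 * Y" for X Y
    using q(2) by (simp add: field_simps eval_nat_numeral)
  ultimately show ?thesis
    by (simp only:)
qed

lemma odd_rank_gf_diff_1:
  assumes q: "norm q < 1" "q \<noteq> 0"
  shows "odd_rank_gf 1 q - odd_rank_gf (- 1) q =
    - 2 + 2 * mock_g (- 1) (q ^ 8) + qJ 4 q ^ 6 * qJ 8 q / (qJ 2 q ^ 4 * (qJ 16 q)\<^sup>2)"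
proof -
  have q2: "norm (q\<^sup>2) < 1" "q\<^sup>2 \<noteq> 0" and q8: "norm (q ^ 8) < 1"
    using q by (simp_all add: norm_power_less_one)
  have "odd_rank_gf 1 q - odd_rank_gf (- 1) q = - 2 + 2 * mock_g (- 1) (q ^ 8) +
    2 * qJ 4 q ^ 4 / ((qJ 2 q)\<^sup>2 * qJ 8 q) / ((qJ 2 q / qJ 4 q)\<^sup>2 * (2 * (qJ 16 q / qJ 8 q)\<^sup>2))"
    using odd_rank_gf_diff[OF q, of 1] theta_prod_odd[OF q2] theta_prod_minus_one[OF q8]
    by (simp add: qJ_power)
  also have "2 * qJ 4 q ^ 4 / ((qJ 2 q)\<^sup>2 * qJ 8 q) / ((qJ 2 q / qJ 4 q)\<^sup>2 * (2 * (qJ 16 q / qJ 8 q)\<^sup>2)) =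
      qJ 4 q ^ 6 * qJ 8 q / (qJ 2 q ^ 4 * (qJ 16 q)\<^sup>2)"
    using qJ_nonzero[OF q(1)] by (simp add: field_simps eval_nat_numeral)
  finally show ?thesis .
qed

text \<open>Since q / (- \<open>\<i>\<close>) = q \<open>\<i>\<close>, reflection and shift express
  g(- \<open>\<i>\<close>) through g(\<open>\<i>\<close>), and the sum formula then concerns
  g(\<open>\<i>\<close>) alone. The factor on the left is the one that occurs in
  \<open>odd_rank_gf_diff_zeta8\<close>.\<close>

lemma mock_g_ii:
  assumes q: "norm q < 1" "q \<noteq> 0"
  shows "(1 + \<i>) * mock_g \<i> q = \<i> - 1 - 2 * q * mock_g q (q ^ 4) + qJ 2 q ^ 7 / (qJ 1 q ^ 3 * qJ 4 q ^ 3)"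
proof -
  have q2: "norm (q\<^sup>2) < 1" and q4: "norm (q ^ 4) < 1"
    using q by (simp_all add: norm_power_less_one)
  have nz: "theta_prod (- 1) (q\<^sup>2) \<noteq> 0" "theta_prod q (q ^ 4) \<noteq> 0" "theta_prod \<i> q \<noteq> 0" "theta_prod (- \<i>) q \<noteq> 0"
    using theta_prod_minus_one[OF q2] theta_prod_self_power4(1)[OF q] qJ_nonzero[OF q(1)]
      theta_prod_mult_minus[OF q(1), of \<i>]
    by (auto simp: qJ_power)
  have "mock_g (q * \<i>) q = - \<i> + 1 + \<i> * mock_g \<i> q"
    using mock_g_shift[OF q _ nz(3)] by (simp add: power3_eq_cube)
  moreover have "q / (- \<i>) = q * \<i>"
    by (simp add: field_simps)
  ultimately have minus: "mock_g (- \<i>) q = - \<i> + 1 + \<i> * mock_g \<i> q"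
    using mock_g_reflect[OF q _ nz(4)] by (simp add: mult.commute)
  have "mock_g \<i> q + mock_g (- \<i>) q + 2 * q * mock_g q (q ^ 4) =
      2 * qJ 2 q ^ 4 / ((qJ 1 q)\<^sup>2 * qJ 4 q) / (2 * (qJ 4 q / qJ 2 q)\<^sup>2 * (qJ 1 q / qJ 2 q))"
    using mock_g_bisection_sum[OF q, of \<i>] nz
    by (simp add: theta_prod_minus_one[OF q2] theta_prod_self_power4(1)[OF q] qJ_power)
  also have "\<dots> = qJ 2 q ^ 7 / (qJ 1 q ^ 3 * qJ 4 q ^ 3)"
    using qJ_nonzero[OF q(1)] by (simp add: field_simps eval_nat_numeral)
  finally show ?thesis
    unfolding minus by (simp add: algebra_simps)
qed

lemma odd_rank_gf_diff_zeta8: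
  assumes q: "norm q < 1" "q \<noteq> 0"
  shows "(1 - \<i>) * zeta8 * (odd_rank_gf zeta8 q - odd_rank_gf (- zeta8) q) =
    4 * q ^ 8 * mock_g (q ^ 8) (q ^ 32) - 2 * (qJ 16 q ^ 7 / (qJ 8 q ^ 3 * qJ 32 q ^ 3))
    + 2 * (qJ 4 q ^ 5 * (qJ 16 q)\<^sup>2 / ((qJ 2 q)\<^sup>2 * qJ 8 q ^ 3 * qJ 32 q))"
proof -
  have q2: "norm (q\<^sup>2) < 1" "q\<^sup>2 \<noteq> 0" and q8: "norm (q ^ 8) < 1" "q ^ 8 \<noteq> 0"
    using q by (simp_all add: norm_power_less_one)
  define M where "M = mock_g \<i> (q ^ 8)"
  define N where "N = 2 * qJ 4 q ^ 4 / ((qJ 2 q)\<^sup>2 * qJ 8 q) /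
    ((qJ 8 q)\<^sup>2 / (qJ 4 q * qJ 16 q) * (qJ 32 q / qJ 16 q))"
  have ii: "- 1 / \<i> = \<i>" "\<i> \<noteq> - 1" "1 - \<i> \<noteq> 0"
    by (simp_all add: complex_eq_iff field_simps)
  have "odd_rank_gf zeta8 q - odd_rank_gf (- zeta8) q = - 2 / zeta8 + 2 / (\<i> * zeta8) * M
      + N / (zeta8 * (1 - \<i>))"
    using odd_rank_gf_diff[OF q norm_zeta8] theta_prod_ii_odd(1)[OF q2] theta_prod_ii[OF q8(1)] ii(1,2)
    by (simp add: qJ_power zeta8_square zeta8_powers M_def N_def mult_ac)
  then have "(1 - \<i>) * zeta8 * (odd_rank_gf zeta8 q - odd_rank_gf (- zeta8) q) =
      (1 - \<i>) * zeta8 * (- 2 / zeta8 + 2 / (\<i> * zeta8) * M + N / (zeta8 * (1 - \<i>)))"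
    by simp
  also have "\<dots> = - 2 * (1 - \<i>) - 2 * ((1 + \<i>) * M) + N"
    using zeta8_nonzero ii(3) by (simp add: field_simps)
  also have "(1 + \<i>) * M = \<i> - 1 - 2 * q ^ 8 * mock_g (q ^ 8) (q ^ 32) + qJ 16 q ^ 7 / (qJ 8 q ^ 3 * qJ 32 q ^ 3)"
    using mock_g_ii[OF q8] by (simp add: M_def qJ_power flip: power_mult)
  also have "N = 2 * (qJ 4 q ^ 5 * (qJ 16 q)\<^sup>2 / ((qJ 2 q)\<^sup>2 * qJ 8 q ^ 3 * qJ 32 q))"
    unfolding N_def using qJ_nonzero[OF q(1)] by (simp add: field_simps eval_nat_numeral)
  finally show ?thesis
    by (simp add: algebra_simps)
qed

section \<open>Two-dissections of theta quotients\<close>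

text \<open>The limit step for finite identities of Shanks type: the summand s = 0 is
  \<open>P n\<close>, and each of the other n summands is at most K^3 |q|^n because its exponent is
  at least n.\<close>

lemma shanks_limit_bounded:
  fixes P w :: "nat \<Rightarrow> complex"
  assumes q: "norm q < 1" and L: "P \<longlonglongrightarrow> L"
    and bound: "\<And>n. norm (P n) \<le> K" "\<And>n. norm (1 / P n) \<le> K" "\<And>n. norm (w n) \<le> K"
    and start: "P 0 = 1" "w 0 = 1" "\<And>n. e 0 n = 0" and e: "\<And>s n. s * n \<le> e s n"
  shows "(\<lambda>n. \<Sum>s\<le>n. P n / P s * w s * q ^ e s n) \<longlonglongrightarrow> L"
proof -
  have K: "K \<ge> 0"
    using order_trans[OF norm_ge_zero bound(1)] .
  have "(\<lambda>n. \<Sum>s=1..n. P n / P s * w s * q ^ e s n) \<longlonglongrightarrow> 0"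
  proof (rule tendsto_0_le[where K = 1])
    have "(\<lambda>n. K ^ 3 * (of_nat n * norm q ^ n)) \<longlonglongrightarrow> K ^ 3 * 0"
      by (intro tendsto_mult_left powser_times_n_limit_0) (use q in simp)
    then show "(\<lambda>n. K ^ 3 * (of_nat n * norm q ^ n)) \<longlonglongrightarrow> 0"
      by simp
    show "\<forall>\<^sub>F n in sequentially. norm (\<Sum>s=1..n. P n / P s * w s * q ^ e s n) \<le>
        norm (K ^ 3 * (of_nat n * norm q ^ n)) * 1"
    proof (intro always_eventually allI)
      fix n
      have "norm (\<Sum>s=1..n. P n / P s * w s * q ^ e s n) \<le> (\<Sum>s=1..n. K ^ 3 * norm q ^ n)"
      proof (rule sum_norm_le)
        fix s assume "s \<in> {1..n}"
        then have "n \<le> e s n"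
          using e[of s n] by (cases s) auto
        then have "norm q ^ e s n \<le> norm q ^ n"
          using q by (intro power_decreasing) auto
        moreover have "norm (P n) * norm (1 / P s) * norm (w s) \<le> K * K * K"
          using bound K by (intro mult_mono) auto
        ultimately have "norm (P n) * norm (1 / P s) * norm (w s) * norm q ^ e s n \<le> K * K * K * norm q ^ n"
          using K by (intro mult_mono[where a = "norm (P n) * norm (1 / P s) * norm (w s)"]) auto
        then show "norm (P n / P s * w s * q ^ e s n) \<le> K ^ 3 * norm q ^ n"
          by (simp add: norm_mult norm_divide norm_power power3_eq_cube)
      qed
      also have "\<dots> = norm (K ^ 3 * (of_nat n * norm q ^ n)) * 1"
        using K by (simp add: abs_mult)
      finally show "norm (\<Sum>s=1..n. P n / P s * w s * q ^ e s n) \<le>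
        norm (K ^ 3 * (of_nat n * norm q ^ n)) * 1" .
    qed
  qed
  from tendsto_add[OF L this]
  have "(\<lambda>n. P n + (\<Sum>s=1..n. P n / P s * w s * q ^ e s n)) \<longlonglongrightarrow> L"
    by simp
  moreover have "(\<Sum>s\<le>n. P n / P s * w s * q ^ e s n) = P n + (\<Sum>s=1..n. P n / P s * w s * q ^ e s n)" for n
    by (simp add: atMost_atLeast0 sum.atLeast_Suc_atMost start)
  ultimately show ?thesis
    by simp
qed

lemma one_minus_power_nonzero:
  fixes q :: complex
  assumes "norm q < 1" "n > 0"
  shows "1 - q ^ n \<noteq> 0" "1 + q ^ n \<noteq> 0"
proof -
  have "norm (q ^ n) \<noteq> 1"
    using norm_power_less_one[OF assms] by simp
  then show "1 - q ^ n \<noteq> 0" "1 + q ^ n \<noteq> 0"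
    by (metis norm_one right_minus_eq, metis add_eq_0_iff norm_minus_cancel norm_one)
qed

text \<open>Finite forms of Gauss's series for \<open>\<phi>\<close> and \<open>\<psi>\<close>, after Shanks: the difference of the
  right-hand sides for \<open>n + 1\<close> and \<open>n\<close> telescopes in \<open>s\<close>.\<close>

lemma shanks_phi:
  fixes q :: complex
  assumes "norm q < 1" "q \<noteq> 0"
  defines "P \<equiv> \<lambda>n. \<Prod>k=1..n. (1 - q ^ k) / (1 + q ^ k)"
  shows "1 + 2 * (\<Sum>s=1..n. (- 1) ^ s * q ^ (s\<^sup>2)) =
    (\<Sum>s\<le>n. P n / P s * ((- 1) ^ s * (2 / (1 + q ^ s))) * q ^ (s * (n + 1)))"
proof (induction n)
  case 0
  show ?case by (simp add: P_def)
next
  case (Suc n)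
  note nz = one_minus_power_nonzero[OF assms(1)]
  have P0: "P s \<noteq> 0" for s
    unfolding P_def using nz by (subst prod_zero_iff) auto
  have PSuc: "P (Suc s) = P s * ((1 - q ^ Suc s) / (1 + q ^ Suc s))" for s
    by (simp add: P_def prod.nat_ivl_Suc')
  have nz': "1 + q ^ s \<noteq> 0" for s
    using nz(2)[of s] by (cases "s = 0") auto
  define t where "t n s = P n / P s * ((- 1) ^ s * (2 / (1 + q ^ s))) * q ^ (s * (n + 1))" for n s
  \<comment> \<open>The telescoping certificate: 1 - q^s makes \<open>U 0\<close> vanish, while
    \<open>U (Suc n)\<close> reduces to the next term of the theta series.\<close>
  define U where "U s = (- 1) ^ s * (P n / P s) * ((1 - q ^ s) / (1 + q ^ s)) * q ^ (s * (n + 1))" for s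
  have "t (Suc n) s - t n s = 2 / (1 + q ^ Suc n) * (U (Suc s) - U s)" for s
  proof -
    define x y X a where "x = q ^ s" and "y = q ^ Suc n" and "X = q ^ (s * (n + 1))" and "a = P n / P s"
    have U1: "U (Suc s) = - ((- 1) ^ s * a * (X * y))"
      unfolding U_def PSuc using nz[of "Suc s"] P0[of s]
      by (simp add: a_def X_def y_def power_add)
    have U0: "U s = (- 1) ^ s * a * ((1 - x) / (1 + x)) * X"
      by (simp add: U_def a_def x_def X_def)
    have e: "q ^ (s * (Suc n + 1)) = X * x"
      by (simp add: X_def x_def algebra_simps flip: power_add)
    have t1: "t (Suc n) s = a * ((1 - y) / (1 + y)) * ((- 1) ^ s * (2 / (1 + x))) * (X * x)"
      unfolding t_def PSuc e by (simp add: a_def x_def y_def mult_ac)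
    have t0: "t n s = a * ((- 1) ^ s * (2 / (1 + x))) * X"
      by (simp add: t_def a_def x_def X_def)
    have "1 + x \<noteq> 0" "1 + y \<noteq> 0"
      using nz' by (simp_all add: x_def y_def del: power_Suc)
    then show ?thesis
      unfolding U1 U0 t1 t0 y_def[symmetric] by (simp add: divide_simps) algebra
  qed
  then have "(\<Sum>s\<le>n. t (Suc n) s) - (\<Sum>s\<le>n. t n s) = 2 / (1 + q ^ Suc n) * (\<Sum>s\<le>n. U (Suc s) - U s)"
    by (simp add: sum_distrib_left flip: sum_subtractf)
  also have "(\<Sum>s\<le>n. U (Suc s) - U s) = U (Suc n) - U 0"
    using sum_lessThan_telescope[of U "Suc n"] by (simp add: lessThan_Suc_atMost)
  also have "U (Suc n) - U 0 = (- 1) ^ Suc n * q ^ ((Suc n)\<^sup>2)"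
    using nz[of "Suc n"] P0[of n] by (simp add: U_def PSuc power2_eq_square)
  finally have "(\<Sum>s\<le>Suc n. t (Suc n) s) =
      (\<Sum>s\<le>n. t n s) + 2 / (1 + q ^ Suc n) * ((- 1) ^ Suc n * q ^ ((Suc n)\<^sup>2)) + t (Suc n) (Suc n)"
    by (simp add: algebra_simps)
  \<comment> \<open>The new summand is q^(n+1) times the telescoped contribution, so adding the two
    cancels the denominator 1 + q^(n+1).\<close>
  also have "t (Suc n) (Suc n) = 2 / (1 + q ^ Suc n) * ((- 1) ^ Suc n * q ^ ((Suc n)\<^sup>2)) * q ^ Suc n"
  proof -
    have "q ^ (Suc n * (Suc n + 1)) = q ^ ((Suc n)\<^sup>2) * q ^ Suc n"
      by (simp add: power2_eq_square algebra_simps flip: power_add power_Suc)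
    then show ?thesis
      using P0[of "Suc n"] by (simp add: t_def mult_ac)
  qed
  also have "(\<Sum>s\<le>n. t n s) + 2 / (1 + q ^ Suc n) * ((- 1) ^ Suc n * q ^ ((Suc n)\<^sup>2))
      + 2 / (1 + q ^ Suc n) * ((- 1) ^ Suc n * q ^ ((Suc n)\<^sup>2)) * q ^ Suc n
      = (\<Sum>s\<le>n. t n s) + 2 * ((- 1) ^ Suc n * q ^ ((Suc n)\<^sup>2))"
  proof -
    have "2 / (1 + y) * z + 2 / (1 + y) * z * y = 2 * z" if "1 + y \<noteq> 0" for y z :: complex
      using that by (simp add: divide_simps) algebra
    from this[OF nz'[of "Suc n"]] show ?thesis
      by (simp only: add.assoc)
  qed
  also have "(\<Sum>s\<le>n. t n s) = 1 + 2 * (\<Sum>s=1..n. (- 1) ^ s * q ^ (s\<^sup>2))"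
    using Suc by (simp add: t_def)
  finally show ?case
    by (simp add: t_def algebra_simps)
qed

lemma shanks_psi:
  fixes q :: complex
  assumes "norm q < 1" "q \<noteq> 0"
  defines "P \<equiv> \<lambda>n. \<Prod>k=1..n. (1 - q ^ (2 * k)) / (1 - q ^ (2 * k - 1))"
  shows "(\<Sum>m\<le>n. q ^ (m * (2 * m + 1))) + (\<Sum>m<n. q ^ ((m + 1) * (2 * m + 1))) =
    (\<Sum>s\<le>n. P n / P s * 1 * q ^ (s * (2 * n + 1)))"
proof (induction n)
  case 0
  show ?case by (simp add: P_def)
next
  case (Suc n)
  note nz = one_minus_power_nonzero(1)[OF assms(1)]
  have P0: "P s \<noteq> 0" for s
    unfolding P_def using nz by (subst prod_zero_iff) auto
  have PSuc: "P (Suc s) = P s * ((1 - q ^ (2 * s + 2)) / (1 - q ^ (2 * s + 1)))" for s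
    by (simp add: P_def prod.nat_ivl_Suc')
  define t where "t n s = P n / P s * 1 * q ^ (s * (2 * n + 1))" for n s
  define U where "U s = P n / P s * (1 - q ^ (2 * s)) * q ^ (s * (2 * n + 1))" for s
  have "t (Suc n) s - t n s = 1 / (1 - q ^ (2 * n + 1)) * (U (Suc s) - U s)" for s
  proof -
    define x y X a where "x = q ^ (2 * s)" and "y = q ^ (2 * n + 1)" and "X = q ^ (s * (2 * n + 1))" and "a = P n / P s"
    have U1: "U (Suc s) = a * (1 - x * q) * (X * y)"
      unfolding U_def PSuc using nz[of "2 * s + 2"] nz[of "2 * s + 1"] P0[of s]
      by (simp add: a_def X_def x_def y_def power_add mult_ac)
    have U0: "U s = a * (1 - x) * X"
      by (simp add: U_def a_def x_def X_def)
    have e: "q ^ (s * (2 * Suc n + 1)) = X * x"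
      by (simp add: X_def x_def algebra_simps flip: power_add)
    have t1: "t (Suc n) s = a * ((1 - y * q) / (1 - y)) * (X * x)"
      unfolding t_def PSuc e by (simp add: a_def y_def power_add mult_ac)
    have t0: "t n s = a * X"
      by (simp add: t_def a_def X_def)
    have "1 - y \<noteq> 0"
      using nz[of "2 * n + 1"] by (simp add: y_def)
    then show ?thesis
      unfolding U1 U0 t1 t0 y_def[symmetric] by (simp add: divide_simps) algebra
  qed
  then have "(\<Sum>s\<le>n. t (Suc n) s) - (\<Sum>s\<le>n. t n s) = 1 / (1 - q ^ (2 * n + 1)) * (\<Sum>s\<le>n. U (Suc s) - U s)"
    by (simp add: sum_distrib_left flip: sum_subtractf)
  also have "(\<Sum>s\<le>n. U (Suc s) - U s) = U (Suc n) - U 0"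
    using sum_lessThan_telescope[of U "Suc n"] by (simp add: lessThan_Suc_atMost)
  \<comment> \<open>Each induction step produces two consecutive triangular exponents: (n+1)(2n+1)
    here, and (n+1)(2n+3) from the new summand s = n + 1.\<close>
  also have "U (Suc n) - U 0 = (1 - q ^ (2 * n + 1)) * q ^ ((n + 1) * (2 * n + 1))"
    using nz[of "2 * n + 2"] nz[of "2 * n + 1"] P0[of n] by (simp add: U_def PSuc)
  also have "1 / (1 - q ^ (2 * n + 1)) * ((1 - q ^ (2 * n + 1)) * q ^ ((n + 1) * (2 * n + 1))) = q ^ ((n + 1) * (2 * n + 1))"
    using nz[of "2 * n + 1"] by simp
  finally have "(\<Sum>s\<le>Suc n. t (Suc n) s) =
      (\<Sum>s\<le>n. t n s) + q ^ ((n + 1) * (2 * n + 1)) + t (Suc n) (Suc n)"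
    by (simp add: algebra_simps)
  also have "t (Suc n) (Suc n) = q ^ (Suc n * (2 * Suc n + 1))"
    using P0[of "Suc n"] by (simp add: t_def)
  also have "(\<Sum>s\<le>n. t n s) = (\<Sum>m\<le>n. q ^ (m * (2 * m + 1))) + (\<Sum>m<n. q ^ ((m + 1) * (2 * m + 1)))"
    using Suc by (simp add: t_def)
  finally show ?case
    by (simp add: t_def algebra_simps)
qed

lemma tendsto_imp_norm_bounded:
  fixes a :: "nat \<Rightarrow> complex"
  assumes "a \<longlonglongrightarrow> l"
  obtains K where "\<And>n. norm (a n) \<le> K"
  using convergent_imp_Bseq[of a] assms by (auto simp: convergent_def Bseq_def)

lemma shanks_limit:
  fixes P w :: "nat \<Rightarrow> complex"
  assumes "norm q < 1" "P \<longlonglongrightarrow> L" "L \<noteq> 0" "\<And>n. norm (w n) \<le> C"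
    and "P 0 = 1" "w 0 = 1" "\<And>n. e 0 n = 0" "\<And>s n. s * n \<le> e s n"
  shows "(\<lambda>n. \<Sum>s\<le>n. P n / P s * w s * q ^ e s n) \<longlonglongrightarrow> L"
proof -
  obtain K1 where K1: "\<And>n. norm (P n) \<le> K1"
    using tendsto_imp_norm_bounded[OF assms(2)] by blast
  obtain K2 where K2: "\<And>n. norm (1 / P n) \<le> K2"
    using tendsto_imp_norm_bounded[OF tendsto_divide[OF tendsto_const[of 1] assms(2,3)]] by blast
  show ?thesis
  proof (rule shanks_limit_bounded[OF assms(1,2), where K = "max K1 (max K2 C)"])
    show "norm (P n) \<le> max K1 (max K2 C)" "norm (1 / P n) \<le> max K1 (max K2 C)"
      "norm (w n) \<le> max K1 (max K2 C)" for n
      using K1[of n] K2[of n] assms(4)[of n] by auto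
  qed (use assms in auto)
qed

lemma phi_minus_sums:
  assumes "norm q < 1" "q \<noteq> 0"
  shows "(\<lambda>n. 2 * ((- 1) ^ Suc n * q ^ ((Suc n)\<^sup>2))) sums ((qJ 1 q)\<^sup>2 / qJ 2 q - 1)"
proof -
  define P where "P n = (\<Prod>k=1..n. (1 - q ^ k) / (1 + q ^ k))" for n
  have P: "P = (\<lambda>n. qpoch q q n / qpoch (- q) q n)"
    by (simp add: fun_eq_iff P_def qpoch_def prod.atLeast1_atMost_eq prod_dividef)
  have nz: "qpoch_inf q q \<noteq> 0" "qpoch_inf (- q) q \<noteq> 0"
    using assms by (simp_all add: qpoch_inf_nonzero_norm)
  have "P \<longlonglongrightarrow> qpoch_inf q q / qpoch_inf (- q) q"
    unfolding P using nz by (intro tendsto_divide qpoch_LIMSEQ assms)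
  also have "qpoch_inf q q / qpoch_inf (- q) q = (qJ 1 q)\<^sup>2 / qJ 2 q"
    unfolding qpoch_inf_minus_self[OF assms(1)] by (simp add: qJ_def power2_eq_square)
  finally have L: "P \<longlonglongrightarrow> (qJ 1 q)\<^sup>2 / qJ 2 q" .
  have "(\<lambda>s. 2 / (1 + q ^ s)) \<longlonglongrightarrow> 2 / (1 + 0)"
    by (intro tendsto_intros LIMSEQ_power_zero assms) auto
  then obtain C where "\<And>s. norm (2 / (1 + q ^ s)) \<le> C"
    using tendsto_imp_norm_bounded by blast
  then have C: "norm ((- 1) ^ s * (2 / (1 + q ^ s))) \<le> C" for s
    unfolding norm_mult[of "(- 1) ^ s"] by (simp add: norm_power)
  have "(\<lambda>n. \<Sum>s\<le>n. P n / P s * ((- 1) ^ s * (2 / (1 + q ^ s))) * q ^ (s * (n + 1)))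
      \<longlonglongrightarrow> (qJ 1 q)\<^sup>2 / qJ 2 q"
    by (rule shanks_limit[OF assms(1) L _ C]) (use qJ_nonzero[OF assms(1)] in \<open>auto simp: P_def\<close>)
  then have "(\<lambda>n. 1 + 2 * (\<Sum>s=1..n. (- 1) ^ s * q ^ (s\<^sup>2))) \<longlonglongrightarrow> (qJ 1 q)\<^sup>2 / qJ 2 q"
    using shanks_phi[OF assms] by (simp add: P_def)
  from tendsto_diff[OF this tendsto_const[of 1]]
  have "(\<lambda>n. 2 * (\<Sum>s=1..n. (- 1) ^ s * q ^ (s\<^sup>2))) \<longlonglongrightarrow> (qJ 1 q)\<^sup>2 / qJ 2 q - 1"
    by simp
  then show ?thesis
    by (simp add: sums_def sum.atLeast1_atMost_eq sum_distrib_left)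
qed

lemma qJ_1_minus:
  assumes "norm q < 1"
  shows "qJ 1 (- q) = qJ 2 q ^ 3 / (qJ 1 q * qJ 4 q)"
  using qpoch_inf_square[of "- q" "- q"] qpoch_inf_minus_odd[OF assms] assms
  by (simp add: qJ_def power2_eq_square power3_eq_cube)

lemma qJ_even_minus: "even m \<Longrightarrow> qJ m (- q) = qJ m q"
  by (simp add: qJ_def)

section \<open>Ramanujan's theta functions and their two-dissections\<close>

text \<open>The product form of the sum of q^(n^2) over all integers n; \<open>phi_sums\<close>
  supplies the series.\<close>

definition phi :: "complex \<Rightarrow> complex" where
  "phi q = qJ 2 q ^ 5 / ((qJ 1 q)\<^sup>2 * (qJ 4 q)\<^sup>2)"

lemma phi_minus:
  assumes "norm q < 1"
  shows "phi (- q) = (qJ 1 q)\<^sup>2 / qJ 2 q"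
proof -
  have "qJ 2 (- q) = qJ 2 q" "qJ 4 (- q) = qJ 4 q"
    by (simp_all add: qJ_even_minus)
  then show ?thesis
    using qJ_nonzero[OF assms] unfolding phi_def qJ_1_minus[OF assms]
    by (simp add: field_simps) (simp add: eval_nat_numeral)
qed

lemma phi_sums:
  assumes "norm q < 1" "q \<noteq> 0"
  shows "(\<lambda>n. 2 * q ^ ((Suc n)\<^sup>2)) sums (phi q - 1)"
proof -
  have "(- 1) ^ Suc n * (- q) ^ ((Suc n)\<^sup>2) = q ^ ((Suc n)\<^sup>2)" for n
  proof -
    have "(- q) ^ ((Suc n)\<^sup>2) = (- 1) ^ ((Suc n)\<^sup>2) * q ^ ((Suc n)\<^sup>2)"
      by (rule power_minus)
    moreover have "(- 1 :: complex) ^ Suc n * (- 1) ^ ((Suc n)\<^sup>2) = 1"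
      unfolding power_add[symmetric] by (rule neg_one_even_power) simp
    ultimately show ?thesis
      by (simp only: mult.assoc[symmetric] mult_1)
  qed
  moreover have "phi q = (qJ 1 (- q))\<^sup>2 / qJ 2 (- q)"
    using phi_minus[of "- q"] assms by simp
  ultimately show ?thesis
    using phi_minus_sums[of "- q", unfolded norm_minus_cancel neg_equal_0_iff_equal, OF assms]
    by (simp only:)
qed

text \<open>The explicit O(q) estimate for \<open>phi_square_sum\<close>. The radius 1/2 bounds the
  geometric factor 1 / (1 - |q|) by 2.\<close>

lemma norm_phi_minus_1_le:
  assumes "norm q \<le> 1 / 2" "q \<noteq> 0"
  shows "norm (phi q - 1) \<le> 4 * norm q"
proof -
  have q: "norm q < 1"
    using assms by simp
  have geo: "(\<lambda>n. 2 * norm q * norm q ^ n) sums (2 * norm q * (1 / (1 - norm q)))"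
    using q by (intro sums_mult geometric_sums) simp
  have "norm (2 * q ^ ((Suc n)\<^sup>2)) \<le> 2 * norm q * norm q ^ n" for n
  proof -
    have "norm q ^ ((Suc n)\<^sup>2) \<le> norm q ^ Suc n"
      using q by (intro power_decreasing) (simp_all add: power2_eq_square)
    then show ?thesis
      by (simp add: norm_mult norm_power)
  qed
  then have "norm (\<Sum>n. 2 * q ^ ((Suc n)\<^sup>2)) \<le> (\<Sum>n. 2 * norm q * norm q ^ n)"
    using sums_summable[OF geo] by (intro norm_suminf_le) auto
  then have "norm (phi q - 1) \<le> 2 * norm q * (1 / (1 - norm q))"
    using sums_unique[OF phi_sums[OF q assms(2)]] sums_unique[OF geo] by simp
  also have "1 / (1 - norm q) \<le> 2"
    using assms by (simp add: field_simps)
  then have "2 * norm q * (1 / (1 - norm q)) \<le> 2 * norm q * 2"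
    by (intro mult_left_mono) auto
  finally show ?thesis
    by simp
qed

text \<open>Gauss's series for psi(q^2), where psi is the generating function of the triangular
  numbers; the square avoids halving n (n + 1).\<close>

lemma psi_sums:
  assumes "norm q < 1" "q \<noteq> 0"
  shows "(\<lambda>n. q ^ (n * (n + 1))) sums ((qJ 4 q)\<^sup>2 / qJ 2 q)"
proof -
  define p where "p = q\<^sup>2"
  have p: "norm p < 1" "p \<noteq> 0" and p2: "norm (p\<^sup>2) < 1"
    using assms by (simp_all add: p_def norm_power_less_one)
  define P where "P n = (\<Prod>k=1..n. (1 - p ^ (2 * k)) / (1 - p ^ (2 * k - 1)))" for n
  have P: "P = (\<lambda>n. qpoch (p\<^sup>2) (p\<^sup>2) n / qpoch p (p\<^sup>2) n)"
    by (simp add: fun_eq_iff P_def qpoch_def prod.atLeast1_atMost_eq prod_dividef power_mult)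
  have nz: "qpoch_inf (p\<^sup>2) (p\<^sup>2) \<noteq> 0" "qpoch_inf p (p\<^sup>2) \<noteq> 0"
    using p p2 by (simp_all add: qpoch_inf_nonzero_norm)
  have "P \<longlonglongrightarrow> qpoch_inf (p\<^sup>2) (p\<^sup>2) / qpoch_inf p (p\<^sup>2)"
    unfolding P using nz by (intro tendsto_divide qpoch_LIMSEQ p2)
  also have "qpoch_inf (p\<^sup>2) (p\<^sup>2) / qpoch_inf p (p\<^sup>2) = (qJ 2 p)\<^sup>2 / qJ 1 p"
    unfolding qpoch_inf_odd[OF p(1)] by (simp add: qJ_def power2_eq_square)
  also have "(qJ 2 p)\<^sup>2 / qJ 1 p = (qJ 4 q)\<^sup>2 / qJ 2 q"
    by (simp add: p_def qJ_power)
  finally have L: "P \<longlonglongrightarrow> (qJ 4 q)\<^sup>2 / qJ 2 q" .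
  have "(\<lambda>n. \<Sum>s\<le>n. P n / P s * 1 * p ^ (s * (2 * n + 1))) \<longlonglongrightarrow> (qJ 4 q)\<^sup>2 / qJ 2 q"
    by (rule shanks_limit[where C = 1, OF p(1) L]) (use qJ_nonzero[OF assms(1)] in \<open>auto simp: P_def\<close>)
  moreover have "(\<Sum>s\<le>n. P n / P s * 1 * p ^ (s * (2 * n + 1))) = (\<Sum>s<2 * n + 1. q ^ (s * (s + 1)))" for n
  proof -
    have 1: "p ^ (m * (2 * m + 1)) = q ^ (2 * m * (2 * m + 1))"
      and 2: "p ^ ((m + 1) * (2 * m + 1)) = q ^ ((2 * m + 1) * (2 * m + 1 + 1))" for m
      unfolding p_def power_mult[symmetric] by (rule arg_cong[where f = "(^) q"], simp)+
    have "(\<Sum>m\<le>n. h (2 * m)) + (\<Sum>m<n. h (2 * m + 1)) = (\<Sum>s<2 * n + 1. h s)" for h :: "nat \<Rightarrow> complex"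
      by (induction n) (simp_all add: algebra_simps)
    from this[of "\<lambda>s. q ^ (s * (s + 1))"]
    have "(\<Sum>m\<le>n. p ^ (m * (2 * m + 1))) + (\<Sum>m<n. p ^ ((m + 1) * (2 * m + 1))) =
        (\<Sum>s<2 * n + 1. q ^ (s * (s + 1)))"
      unfolding 1 2 .
    then show ?thesis
      using shanks_psi[OF p, of n] by (simp add: P_def)
  qed
  ultimately have lim: "(\<lambda>n. \<Sum>s<2 * n + 1. q ^ (s * (s + 1))) \<longlonglongrightarrow> (qJ 4 q)\<^sup>2 / qJ 2 q"
    by simp
  \<comment> \<open>The finite identities control only partial sums of odd length, so convergence of
    the whole series is established separately.\<close>
  have "summable (\<lambda>n. q ^ (n * (n + 1)))"
  proof (rule summable_comparison_test')
    show "summable (\<lambda>n. norm q ^ n)"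
      using assms by (simp add: summable_geometric)
    show "norm (q ^ (n * (n + 1))) \<le> norm q ^ n" for n
      unfolding norm_power using assms by (intro power_decreasing) auto
  qed
  then obtain S where S: "(\<lambda>n. q ^ (n * (n + 1))) sums S"
    by (auto simp: summable_def)
  have "filterlim (\<lambda>n. 2 * n + 1) sequentially (sequentially :: nat filter)"
    by (rule filterlim_subseq) (auto simp: strict_mono_def)
  from filterlim_compose[OF S[unfolded sums_def] this] lim have "S = (qJ 4 q)\<^sup>2 / qJ 2 q"
    by (rule LIMSEQ_unique)
  with S show ?thesis
    by simp
qed

lemma sums_parity_unique:
  fixes f :: "nat \<Rightarrow> complex"
  assumes "f sums S" "(\<lambda>n. f (2 * n)) sums a" "(\<lambda>n. f (2 * n + 1)) sums b"
  shows "S = a + b"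
proof (rule LIMSEQ_unique)
  have "filterlim (\<lambda>n. 2 * n) sequentially (sequentially :: nat filter)"
    by (rule filterlim_subseq) (auto simp: strict_mono_def)
  from filterlim_compose[OF assms(1)[unfolded sums_def] this]
  show "(\<lambda>n. \<Sum>k<2 * n. f k) \<longlonglongrightarrow> S" .
  have "(\<Sum>k<2 * n. f k) = (\<Sum>k<n. f (2 * k)) + (\<Sum>k<n. f (2 * k + 1))" for n
    by (induction n) (simp_all add: algebra_simps)
  then show "(\<lambda>n. \<Sum>k<2 * n. f k) \<longlonglongrightarrow> a + b"
    using tendsto_add[OF assms(2,3)[unfolded sums_def]] by simp
qed

text \<open>Even squares 4 m^2 give phi(q^4), and odd squares 4 m (m + 1) + 1 give 2 q
  psi(q^8).\<close>

lemma phi_bisection: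
  assumes "norm q < 1" "q \<noteq> 0"
  shows "phi q = phi (q ^ 4) + 2 * q * ((qJ 16 q)\<^sup>2 / qJ 8 q)"
proof -
  have q4: "norm (q ^ 4) < 1" "q ^ 4 \<noteq> 0"
    using assms by (simp_all add: norm_power_less_one)
  have 1: "q * (q ^ 4) ^ (n * (n + 1)) = q ^ ((Suc (2 * n))\<^sup>2)"
    and 2: "(q ^ 4) ^ ((Suc n)\<^sup>2) = q ^ ((Suc (2 * n + 1))\<^sup>2)" for n
  proof -
    have "(Suc (2 * n))\<^sup>2 = 4 * (n * (n + 1)) + 1" "(Suc (2 * n + 1))\<^sup>2 = 4 * (Suc n)\<^sup>2"
      by (simp_all add: power2_eq_square)
    then show "q * (q ^ 4) ^ (n * (n + 1)) = q ^ ((Suc (2 * n))\<^sup>2)"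
      "(q ^ 4) ^ ((Suc n)\<^sup>2) = q ^ ((Suc (2 * n + 1))\<^sup>2)"
      by (simp_all only: power_add power_mult power_one_right mult.commute)
  qed
  have "(\<lambda>n. 2 * (q * (q ^ 4) ^ (n * (n + 1)))) sums (2 * (q * ((qJ 16 q)\<^sup>2 / qJ 8 q)))"
    using sums_mult[OF sums_mult[OF psi_sums[OF q4]]] by (simp add: qJ_power)
  then have odd: "(\<lambda>n. 2 * q ^ ((Suc (2 * n))\<^sup>2)) sums (2 * (q * ((qJ 16 q)\<^sup>2 / qJ 8 q)))"
    unfolding 1 .
  have even: "(\<lambda>n. 2 * q ^ ((Suc (2 * n + 1))\<^sup>2)) sums (phi (q ^ 4) - 1)"
    using phi_sums[OF q4] unfolding 2 .
  \<comment> \<open>The series in \<open>phi_sums\<close> starts with the square 1, so its even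
    indices carry the odd squares.\<close>
  have "phi q - 1 = 2 * (q * ((qJ 16 q)\<^sup>2 / qJ 8 q)) + (phi (q ^ 4) - 1)"
    by (rule sums_parity_unique[OF phi_sums[OF assms] odd even])
  then show ?thesis
    by simp
qed

lemma phi_minus_bisection:
  assumes "norm q < 1" "q \<noteq> 0"
  shows "phi (- q) = phi (q ^ 4) - 2 * q * ((qJ 16 q)\<^sup>2 / qJ 8 q)"
  using phi_bisection[of "- q"] assms by (simp add: qJ_even_minus)

text \<open>The deviation \<open>u q = phi q ^ 2 + phi (- q) ^ 2 - 2 * phi (q ^ 2) ^ 2\<close> satisfies
  \<open>u q = - 2 * u (q ^ 2)\<close> and is \<open>O(q)\<close>, hence vanishes.\<close>

lemma phi_square_sum:
  assumes "norm q < 1" "q \<noteq> 0"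
  shows "(phi q)\<^sup>2 + (phi (- q))\<^sup>2 = 2 * (phi (q\<^sup>2))\<^sup>2"
proof -
  define u where "u q = (phi q)\<^sup>2 + (phi (- q))\<^sup>2 - 2 * (phi (q\<^sup>2))\<^sup>2" for q
  have step: "u q = - 2 * u (q\<^sup>2)" if q: "norm q < 1" "q \<noteq> 0" for q
  proof -
    have q2: "norm (q\<^sup>2) < 1"
      using q by (simp add: norm_power_less_one)
    have "phi q + phi (- q) = 2 * phi (q ^ 4)"
      using phi_bisection[OF q] phi_minus_bisection[OF q] by simp
    moreover have "phi q * phi (- q) = (phi (- (q\<^sup>2)))\<^sup>2"
      unfolding phi_minus[OF q2, unfolded qJ_power, simplified] phi_minus[OF q(1)]
      unfolding phi_def using qJ_nonzero[OF q(1)] by (simp add: field_simps eval_nat_numeral)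
    moreover have "(phi q)\<^sup>2 + (phi (- q))\<^sup>2 = (phi q + phi (- q))\<^sup>2 - 2 * (phi q * phi (- q))"
      by (simp add: power2_eq_square algebra_simps)
    ultimately have "(phi q)\<^sup>2 + (phi (- q))\<^sup>2 = (2 * phi (q ^ 4))\<^sup>2 - 2 * (phi (- (q\<^sup>2)))\<^sup>2"
      by (simp only:)
    then show ?thesis
      by (simp add: u_def power_mult_distrib algebra_simps flip: power_mult)
  qed
  have iter: "u q = (- 2) ^ n * u (q ^ (2 ^ n))" for n
  proof (induction n)
    case (Suc n)
    have "u (q ^ (2 ^ n)) = - 2 * u (q ^ (2 ^ Suc n))"
      using step[of "q ^ (2 ^ n)"] assms by (simp add: norm_power_less_one mult.commute flip: power_mult)
    with Suc show ?case
      by simp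
  qed simp
  have bound: "norm (u p) \<le> 64 * norm p" if p: "norm p \<le> 1 / 2" "p \<noteq> 0" for p
  proof -
    define s where "s p = (phi p)\<^sup>2 - 1" for p
    have s: "norm (s r) \<le> 16 * norm p" if r: "norm r \<le> norm p" "r \<noteq> 0" for r
    proof -
      have d: "norm (phi r - 1) \<le> 4 * norm r"
        using norm_phi_minus_1_le[of r] r p by simp
      have "norm (phi r + 1) \<le> norm (phi r - 1) + norm (2 :: complex)"
        using norm_triangle_ineq[of "phi r - 1" 2] by (simp add: add.commute)
      also have "\<dots> \<le> 4"
        using d r p by simp
      finally have "norm (phi r - 1) * norm (phi r + 1) \<le> (4 * norm r) * 4"
        using d by (intro mult_mono) auto
      moreover have "s r = (phi r - 1) * (phi r + 1)"
        by (simp add: s_def power2_eq_square algebra_simps)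
      ultimately show ?thesis
        using r(1) by (simp add: norm_mult)
    qed
    have "norm (p\<^sup>2) \<le> norm p"
      using p mult_left_le[of "norm p" "norm p"] by (simp add: norm_mult power2_eq_square)
    then have "norm (s p) \<le> 16 * norm p" "norm (s (- p)) \<le> 16 * norm p" "norm (s (p\<^sup>2)) \<le> 16 * norm p"
      using p by (auto intro!: s)
    moreover have "u p = s p + s (- p) - 2 * s (p\<^sup>2)"
      by (simp add: u_def s_def)
    moreover have "norm (s p + s (- p) - 2 * s (p\<^sup>2)) \<le> norm (s p) + norm (s (- p)) + 2 * norm (s (p\<^sup>2))"
      by (rule order_trans[OF norm_triangle_ineq4]) (simp add: norm_mult norm_triangle_ineq)
    ultimately show ?thesis
      by simp
  qed
  \<comment> \<open>The factor 2^n produced by the iteration is absorbed because N |q|^N tends to 0,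
    here along N = 2^n.\<close>
  have sub: "filterlim (\<lambda>n. 2 ^ n) sequentially (sequentially :: nat filter)"
    by (rule filterlim_subseq) (simp add: strict_mono_def)
  have "(\<lambda>n. of_nat n * norm q ^ n) \<longlonglongrightarrow> 0"
    by (rule powser_times_n_limit_0) (use assms in simp)
  from filterlim_compose[OF this sub]
  have lim: "(\<lambda>n. of_nat (2 ^ n) * norm q ^ (2 ^ n)) \<longlonglongrightarrow> 0" .
  have "(\<lambda>n. norm q ^ n) \<longlonglongrightarrow> 0"
    using assms by (intro LIMSEQ_power_zero) simp
  from filterlim_compose[OF this sub]
  have "\<forall>\<^sub>F n in sequentially. norm q ^ (2 ^ n) < 1 / 2"
    by (rule order_tendstoD) simp
  then have ev: "\<forall>\<^sub>F n in sequentially. norm (u q) \<le> 64 * (of_nat (2 ^ n) * norm q ^ (2 ^ n))"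
  proof eventually_elim
    case (elim n)
    then have "norm (u (q ^ (2 ^ n))) \<le> 64 * norm q ^ (2 ^ n)"
      using bound[of "q ^ (2 ^ n)"] assms by (simp add: norm_power)
    then have "2 ^ n * norm (u (q ^ (2 ^ n))) \<le> 2 ^ n * (64 * norm q ^ (2 ^ n))"
      by (intro mult_left_mono) auto
    then show ?case
      using iter[of n] by (simp add: norm_mult norm_power mult_ac)
  qed
  have "norm (u q) \<le> 64 * 0"
    by (rule tendsto_lowerbound[OF tendsto_mult_left[OF lim] ev]) simp
  then show ?thesis
    by (simp add: u_def)
qed

text \<open>Half the sum and half the difference of the squares of phi(q) and phi(-q). The sum is
  \<open>phi_square_sum\<close>; the difference factors as 2 phi(q^4) times 4 q psi(q^8) and so is a
  single product.\<close>

lemma phi_square_bisection: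
  assumes "norm q < 1" "q \<noteq> 0"
  shows "(phi q)\<^sup>2 = (phi (q\<^sup>2))\<^sup>2 + 4 * q * (qJ 8 q ^ 4 / (qJ 4 q)\<^sup>2)"
proof -
  have "(phi q)\<^sup>2 - (phi (- q))\<^sup>2 = (phi q + phi (- q)) * (phi q - phi (- q))"
    by (simp add: power2_eq_square algebra_simps)
  also have "\<dots> = (2 * phi (q ^ 4)) * (4 * q * ((qJ 16 q)\<^sup>2 / qJ 8 q))"
    unfolding phi_bisection[OF assms] phi_minus_bisection[OF assms] by simp
  also have "\<dots> = 8 * q * (qJ 8 q ^ 4 / (qJ 4 q)\<^sup>2)"
    unfolding phi_def[of "q ^ 4", unfolded qJ_power, simplified] using qJ_nonzero[OF assms(1)]
    by (simp add: field_simps eval_nat_numeral)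
  finally have "(phi q)\<^sup>2 - (phi (- q))\<^sup>2 = 8 * q * (qJ 8 q ^ 4 / (qJ 4 q)\<^sup>2)" .
  moreover have "2 * A = 2 * (C + 4 * q * X)" if "A - B = 8 * q * X" "A + B = 2 * C" for A B C X :: complex
    using that by algebra
  ultimately have "2 * (phi q)\<^sup>2 = 2 * ((phi (q\<^sup>2))\<^sup>2 + 4 * q * (qJ 8 q ^ 4 / (qJ 4 q)\<^sup>2))"
    using phi_square_sum[OF assms] by blast
  then show ?thesis
    by (simp only: mult_cancel_left) simp
qed

section \<open>Dissections of the individual quotients\<close>

text \<open>For even m, \<open>qJ m q\<close> is a function of q^2. Up to such factors 1 / J_1^2 is
  phi(q), and in the same way 1 / J_1^4 is phi(q)^2.\<close>

lemma inverse_qJ_1_power2: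
  assumes "norm q < 1" "q \<noteq> 0"
  shows "1 / (qJ 1 q)\<^sup>2 = qJ 8 q ^ 5 / (qJ 2 q ^ 5 * (qJ 16 q)\<^sup>2)
    + 2 * q * ((qJ 4 q)\<^sup>2 * (qJ 16 q)\<^sup>2 / (qJ 2 q ^ 5 * qJ 8 q))"
proof -
  have "1 / (qJ 1 q)\<^sup>2 = phi q * ((qJ 4 q)\<^sup>2 / qJ 2 q ^ 5)"
    unfolding phi_def using qJ_nonzero[OF assms(1)] by simp
  also have "\<dots> = phi (q ^ 4) * ((qJ 4 q)\<^sup>2 / qJ 2 q ^ 5)
      + 2 * q * ((qJ 16 q)\<^sup>2 / qJ 8 q) * ((qJ 4 q)\<^sup>2 / qJ 2 q ^ 5)"
    unfolding phi_bisection[OF assms] by (rule distrib_right)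
  also have "phi (q ^ 4) * ((qJ 4 q)\<^sup>2 / qJ 2 q ^ 5) = qJ 8 q ^ 5 / (qJ 2 q ^ 5 * (qJ 16 q)\<^sup>2)"
    unfolding phi_def using qJ_nonzero[OF assms(1)] by (simp add: qJ_power)
  finally show ?thesis
    by (simp add: mult_ac)
qed

lemma inverse_qJ_1_power4:
  assumes "norm q < 1" "q \<noteq> 0"
  shows "1 / qJ 1 q ^ 4 = qJ 4 q ^ 14 / (qJ 2 q ^ 14 * qJ 8 q ^ 4)
    + 4 * q * ((qJ 4 q)\<^sup>2 * qJ 8 q ^ 4 / qJ 2 q ^ 10)"
proof -
  have "1 / qJ 1 q ^ 4 = (phi q)\<^sup>2 * (qJ 4 q ^ 4 / qJ 2 q ^ 10)"
    unfolding phi_def using qJ_nonzero[OF assms(1)]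
    by (simp add: power_divide power_mult_distrib flip: power_mult)
  also have "\<dots> = (phi (q\<^sup>2))\<^sup>2 * (qJ 4 q ^ 4 / qJ 2 q ^ 10)
      + 4 * q * (qJ 8 q ^ 4 / (qJ 4 q)\<^sup>2 * (qJ 4 q ^ 4 / qJ 2 q ^ 10))"
    unfolding phi_square_bisection[OF assms] by (simp add: algebra_simps)
  also have "(phi (q\<^sup>2))\<^sup>2 * (qJ 4 q ^ 4 / qJ 2 q ^ 10) = qJ 4 q ^ 14 / (qJ 2 q ^ 14 * qJ 8 q ^ 4)"
    unfolding phi_def using qJ_nonzero[OF assms(1)]
    by (simp add: qJ_power power_divide power_mult_distrib flip: power_mult)
  also have "qJ 8 q ^ 4 / (qJ 4 q)\<^sup>2 * (qJ 4 q ^ 4 / qJ 2 q ^ 10) = (qJ 4 q)\<^sup>2 * qJ 8 q ^ 4 / qJ 2 q ^ 10"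
    using qJ_nonzero[OF assms(1)] by (simp add: field_simps eval_nat_numeral)
  finally show ?thesis .
qed

text \<open>Here and in the following dissections the power of J_1 in the denominator, one of 2, 4,
  6 and 8, is isolated and composed from 1 / J_1^2 and 1 / J_1^4. The right-hand sides have the
  shape that \<open>has_gf_bisect\<close> expects.\<close>

lemma bisect_J2_8_J8_2_over_J1_4_J4_5:
  assumes "norm q < 1" "q \<noteq> 0"
  shows "qJ 2 q ^ 8 * qJ 8 q ^ 2 / (qJ 1 q ^ 4 * qJ 4 q ^ 5) =
    qJ 4 q ^ 9 / (qJ 2 q ^ 6 * qJ 8 q ^ 2)
    + q * (4 * (qJ 8 q ^ 6 / (qJ 2 q ^ 2 * qJ 4 q ^ 3)))"
    (is "?l = ?r")
proof -
  have "?l = qJ 2 q ^ 8 * qJ 8 q ^ 2 / qJ 4 q ^ 5 * (1 / qJ 1 q ^ 4)"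
    by (simp flip: power_add)
  also have "\<dots> = ?r"
    unfolding inverse_qJ_1_power4[OF assms] inverse_qJ_1_power2[OF assms]
    by (simp add: field_simps qJ_nonzero[OF assms(1)]; algebra)
  finally show ?thesis .
qed

lemma bisect_J2_5_J16_over_J1_2_J4_2_J8:
  assumes "norm q < 1" "q \<noteq> 0"
  shows "qJ 2 q ^ 5 * qJ 16 q / (qJ 1 q ^ 2 * qJ 4 q ^ 2 * qJ 8 q) =
    qJ 8 q ^ 4 / (qJ 16 q * qJ 4 q ^ 2)
    + q * (2 * (qJ 16 q ^ 3 / qJ 8 q ^ 2))"
    (is "?l = ?r")
proof -
  have "?l = qJ 2 q ^ 5 * qJ 16 q / (qJ 4 q ^ 2 * qJ 8 q) * (1 / qJ 1 q ^ 2)"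
    by (simp flip: power_add)
  also have "\<dots> = ?r"
    unfolding inverse_qJ_1_power4[OF assms] inverse_qJ_1_power2[OF assms]
    by (simp add: field_simps qJ_nonzero[OF assms(1)]; algebra)
  finally show ?thesis .
qed

lemma bisect_J2_9_over_J1_6_J4_2:
  assumes "norm q < 1" "q \<noteq> 0"
  shows "qJ 2 q ^ 9 / (qJ 1 q ^ 6 * qJ 4 q ^ 2) =
    qJ 4 q ^ 12 * qJ 8 q / (qJ 2 q ^ 10 * qJ 16 q ^ 2)
    + 8 * q ^ 2 * (qJ 4 q ^ 2 * qJ 8 q ^ 3 * qJ 16 q ^ 2 / qJ 2 q ^ 6)
    + q * (2 * (qJ 4 q ^ 14 * qJ 16 q ^ 2 / (qJ 2 q ^ 10 * qJ 8 q ^ 5))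
      + 4 * (qJ 8 q ^ 9 / (qJ 2 q ^ 6 * qJ 16 q ^ 2)))"
    (is "?l = ?r")
proof -
  have "?l = qJ 2 q ^ 9 / qJ 4 q ^ 2 * (1 / qJ 1 q ^ 4 * (1 / qJ 1 q ^ 2))"
    by (simp flip: power_add)
  also have "\<dots> = ?r"
    unfolding inverse_qJ_1_power4[OF assms] inverse_qJ_1_power2[OF assms]
    by (simp add: field_simps qJ_nonzero[OF assms(1)]; algebra)
  finally show ?thesis .
qed

lemma bisect_J2_3_over_J1_2:
  assumes "norm q < 1" "q \<noteq> 0"
  shows "qJ 2 q ^ 3 / qJ 1 q ^ 2 =
    qJ 8 q ^ 5 / (qJ 2 q ^ 2 * qJ 16 q ^ 2)
    + q * (2 * (qJ 4 q ^ 2 * qJ 16 q ^ 2 / (qJ 2 q ^ 2 * qJ 8 q)))"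
    (is "?l = ?r")
proof -
  have "?l = qJ 2 q ^ 3 * (1 / qJ 1 q ^ 2)"
    by (simp flip: power_add)
  also have "\<dots> = ?r"
    unfolding inverse_qJ_1_power4[OF assms] inverse_qJ_1_power2[OF assms]
    by (simp add: field_simps qJ_nonzero[OF assms(1)]; algebra)
  finally show ?thesis .
qed

lemma bisect_J4_6_over_J1_2_J2_3:
  assumes "norm q < 1" "q \<noteq> 0"
  shows "qJ 4 q ^ 6 / (qJ 1 q ^ 2 * qJ 2 q ^ 3) =
    qJ 4 q ^ 6 * qJ 8 q ^ 5 / (qJ 2 q ^ 8 * qJ 16 q ^ 2)
    + q * (2 * (qJ 4 q ^ 8 * qJ 16 q ^ 2 / (qJ 2 q ^ 8 * qJ 8 q)))"
    (is "?l = ?r")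
proof -
  have "?l = qJ 4 q ^ 6 / qJ 2 q ^ 3 * (1 / qJ 1 q ^ 2)"
    by (simp flip: power_add)
  also have "\<dots> = ?r"
    unfolding inverse_qJ_1_power4[OF assms] inverse_qJ_1_power2[OF assms]
    by (simp add: field_simps qJ_nonzero[OF assms(1)]; algebra)
  finally show ?thesis .
qed

lemma bisect_J2_6_J4_over_J1_4_J8_2:
  assumes "norm q < 1" "q \<noteq> 0"
  shows "qJ 2 q ^ 6 * qJ 4 q / (qJ 1 q ^ 4 * qJ 8 q ^ 2) =
    qJ 4 q ^ 15 / (qJ 2 q ^ 8 * qJ 8 q ^ 6)
    + q * (4 * (qJ 4 q ^ 3 * qJ 8 q ^ 2 / qJ 2 q ^ 4))"
    (is "?l = ?r")
proof -
  have "?l = qJ 2 q ^ 6 * qJ 4 q / qJ 8 q ^ 2 * (1 / qJ 1 q ^ 4)"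
    by (simp flip: power_add)
  also have "\<dots> = ?r"
    unfolding inverse_qJ_1_power4[OF assms] inverse_qJ_1_power2[OF assms]
    by (simp add: field_simps qJ_nonzero[OF assms(1)]; algebra)
  finally show ?thesis .
qed

lemma bisect_J2_5_J8_2_over_J1_2_J4_3_J16:
  assumes "norm q < 1" "q \<noteq> 0"
  shows "qJ 2 q ^ 5 * qJ 8 q ^ 2 / (qJ 1 q ^ 2 * qJ 4 q ^ 3 * qJ 16 q) =
    qJ 8 q ^ 7 / (qJ 4 q ^ 3 * qJ 16 q ^ 3)
    + q * (2 * (qJ 8 q * qJ 16 q / qJ 4 q))"
    (is "?l = ?r")
proof -
  have "?l = qJ 2 q ^ 5 * qJ 8 q ^ 2 / (qJ 4 q ^ 3 * qJ 16 q) * (1 / qJ 1 q ^ 2)"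
    by (simp flip: power_add)
  also have "\<dots> = ?r"
    unfolding inverse_qJ_1_power4[OF assms] inverse_qJ_1_power2[OF assms]
    by (simp add: field_simps qJ_nonzero[OF assms(1)]; algebra)
  finally show ?thesis .
qed

lemma bisect_J2_15_over_J1_8_J4_6:
  assumes "norm q < 1" "q \<noteq> 0"
  shows "qJ 2 q ^ 15 / (qJ 1 q ^ 8 * qJ 4 q ^ 6) =
    qJ 4 q ^ 22 / (qJ 2 q ^ 13 * qJ 8 q ^ 8)
    + 16 * q ^ 2 * (qJ 8 q ^ 8 / (qJ 2 q ^ 5 * qJ 4 q ^ 2))
    + q * (8 * (qJ 4 q ^ 10 / qJ 2 q ^ 9))"
    (is "?l = ?r")
proof -
  have "?l = qJ 2 q ^ 15 / qJ 4 q ^ 6 * (1 / qJ 1 q ^ 4 * (1 / qJ 1 q ^ 4))"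
    by (simp flip: power_add)
  also have "\<dots> = ?r"
    unfolding inverse_qJ_1_power4[OF assms] inverse_qJ_1_power2[OF assms]
    by (simp add: field_simps qJ_nonzero[OF assms(1)]; algebra)
  finally show ?thesis .
qed

lemma bisect_J2_3_J4_2_over_J1_4:
  assumes "norm q < 1" "q \<noteq> 0"
  shows "qJ 2 q ^ 3 * qJ 4 q ^ 2 / qJ 1 q ^ 4 =
    qJ 4 q ^ 16 / (qJ 2 q ^ 11 * qJ 8 q ^ 4)
    + q * (4 * (qJ 4 q ^ 4 * qJ 8 q ^ 4 / qJ 2 q ^ 7))"
    (is "?l = ?r")
proof -
  have "?l = qJ 2 q ^ 3 * qJ 4 q ^ 2 * (1 / qJ 1 q ^ 4)"
    by (simp flip: power_add)
  also have "\<dots> = ?r"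
    unfolding inverse_qJ_1_power4[OF assms] inverse_qJ_1_power2[OF assms]
    by (simp add: field_simps qJ_nonzero[OF assms(1)]; algebra)
  finally show ?thesis .
qed

lemma bisect_J2_4_J16_2_over_J1_4_J8:
  assumes "norm q < 1" "q \<noteq> 0"
  shows "qJ 2 q ^ 4 * qJ 16 q ^ 2 / (qJ 1 q ^ 4 * qJ 8 q) =
    qJ 4 q ^ 14 * qJ 16 q ^ 2 / (qJ 2 q ^ 10 * qJ 8 q ^ 5)
    + q * (4 * (qJ 4 q ^ 2 * qJ 8 q ^ 3 * qJ 16 q ^ 2 / qJ 2 q ^ 6))"
    (is "?l = ?r")
proof -
  have "?l = qJ 2 q ^ 4 * qJ 16 q ^ 2 / qJ 8 q * (1 / qJ 1 q ^ 4)"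
    by (simp flip: power_add)
  also have "\<dots> = ?r"
    unfolding inverse_qJ_1_power4[OF assms] inverse_qJ_1_power2[OF assms]
    by (simp add: field_simps qJ_nonzero[OF assms(1)]; algebra)
  finally show ?thesis .
qed

text \<open>The difference phi(q) - phi(-q) is a single product. This merges the two quotients that
  arise for residue 2 on 4n + 1.\<close>

lemma J_quotient_diff:
  assumes "norm q < 1" "q \<noteq> 0"
  shows "qJ 2 q ^ 9 / (qJ 1 q ^ 6 * qJ 4 q ^ 2) - qJ 2 q ^ 3 / qJ 1 q ^ 2
    = 4 * q * (qJ 2 q ^ 4 * qJ 16 q ^ 2 / (qJ 1 q ^ 4 * qJ 8 q))"
proof -
  have "qJ 2 q ^ 9 / (qJ 1 q ^ 6 * qJ 4 q ^ 2) - qJ 2 q ^ 3 / qJ 1 q ^ 2 =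
      (phi q - phi (- q)) * (qJ 2 q ^ 4 / qJ 1 q ^ 4)"
    unfolding phi_minus[OF assms(1)] unfolding phi_def
    by (simp add: field_simps qJ_nonzero[OF assms(1)]; algebra)
  also have "\<dots> = 4 * q * (qJ 2 q ^ 4 * qJ 16 q ^ 2 / (qJ 1 q ^ 4 * qJ 8 q))"
    unfolding phi_bisection[OF assms] phi_minus_bisection[OF assms] by (simp add: mult_ac)
  finally show ?thesis .
qed

text \<open>This is \<open>phi_square_sum\<close> multiplied by a common quotient.\<close>

lemma J_quotient_sum:
  assumes "norm q < 1" "q \<noteq> 0"
  shows "qJ 2 q ^ 14 * qJ 8 q ^ 2 / (qJ 1 q ^ 10 * qJ 4 q ^ 5) + qJ 2 q ^ 2 * qJ 8 q ^ 2 / (qJ 1 q ^ 2 * qJ 4 q)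
    = 2 * (qJ 4 q ^ 9 / (qJ 1 q ^ 6 * qJ 8 q ^ 2))"
proof -
  have "qJ 2 q ^ 14 * qJ 8 q ^ 2 / (qJ 1 q ^ 10 * qJ 4 q ^ 5) + qJ 2 q ^ 2 * qJ 8 q ^ 2 / (qJ 1 q ^ 2 * qJ 4 q)
      = ((phi q)\<^sup>2 + (phi (- q))\<^sup>2) * (qJ 2 q ^ 4 * qJ 8 q ^ 2 / (qJ 1 q ^ 6 * qJ 4 q))"
    unfolding phi_minus[OF assms(1)] unfolding phi_def
    by (simp add: field_simps qJ_nonzero[OF assms(1)]; algebra)
  also have "\<dots> = 2 * (qJ 4 q ^ 9 / (qJ 1 q ^ 6 * qJ 8 q ^ 2))"
    unfolding phi_square_sum[OF assms] phi_def[of "q\<^sup>2", unfolded qJ_power, simplified]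
    by (simp add: field_simps qJ_nonzero[OF assms(1)]; algebra)
  finally show ?thesis .
qed

text \<open>The dissection of the sum of J_2^9 / (J_1^6 J_4^2) and J_2^3 / J_1^2, solved for the
  first. The sum occurs for residues 0 and 4 on 4n + 1, and its odd part collapses to one product by
  \<open>J_quotient_sum\<close>.\<close>

lemma bisect_J2_9_over_J1_6_J4_2':
  assumes "norm q < 1" "q \<noteq> 0"
  shows "qJ 2 q ^ 9 / (qJ 1 q ^ 6 * qJ 4 q ^ 2) = qJ 4 q ^ 12 * qJ 8 q / (qJ 2 q ^ 10 * qJ 16 q ^ 2)
    + 8 * q ^ 2 * (qJ 4 q ^ 2 * qJ 8 q ^ 3 * qJ 16 q ^ 2 / qJ 2 q ^ 6) + qJ 8 q ^ 5 / (qJ 2 q ^ 2 * qJ 16 q ^ 2)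
    + q * (8 * (qJ 8 q ^ 9 / (qJ 2 q ^ 6 * qJ 16 q ^ 2))) - qJ 2 q ^ 3 / qJ 1 q ^ 2"
proof -
  have q2: "norm (q\<^sup>2) < 1" "q\<^sup>2 \<noteq> 0"
    using assms by (simp_all add: norm_power_less_one)
  have "qJ 4 q ^ 14 * qJ 16 q ^ 2 / (qJ 2 q ^ 10 * qJ 8 q ^ 5) + qJ 4 q ^ 2 * qJ 16 q ^ 2 / (qJ 2 q ^ 2 * qJ 8 q)
      = 2 * (qJ 8 q ^ 9 / (qJ 2 q ^ 6 * qJ 16 q ^ 2))"
    using J_quotient_sum[OF q2] unfolding qJ_power by simp
  moreover have "A + B + q * (2 * S1 + 4 * T) = A + B + C + q * (8 * T) - (C + q * (2 * S2))"
    if "S1 + S2 = 2 * T" for A B C S1 S2 T :: complex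
    using that by algebra
  ultimately show ?thesis
    unfolding bisect_J2_9_over_J1_6_J4_2[OF assms] bisect_J2_3_over_J1_2[OF assms] by blast
qed

section \<open>Generating functions in residue classes\<close>

text \<open>Quantified over the whole punctured disc because a bisection at w uses the expansions at
  both square roots of w. At 0 the negative powers and \<open>mock_g\<close> would only have default
  values.\<close>

definition has_gf :: "(nat \<Rightarrow> nat) \<Rightarrow> (complex \<Rightarrow> complex) \<Rightarrow> bool" where
  "has_gf c F \<longleftrightarrow> (\<forall>q. q \<noteq> 0 \<longrightarrow> norm q < 1 \<longrightarrow>
    (\<lambda>n. of_nat (c n) * q ^ n) sums F q)"

lemma has_gfD:
  assumes "has_gf c F" "q \<noteq> 0" "norm q < 1"
  shows "(\<lambda>n. of_nat (c n) * q ^ n) sums F q"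
  using assms by (simp add: has_gf_def)

text \<open>\<open>A\<close> and \<open>B\<close> take the same values at r and -r, so adding and
  subtracting the expansions at the two square roots of w separates them without comparing
  coefficients.\<close>

lemma has_gf_bisect:
  assumes gf: "has_gf c F"
    and F: "\<And>q. q \<noteq> 0 \<Longrightarrow> norm q < 1 \<Longrightarrow> F q = A (q\<^sup>2) + q * B (q\<^sup>2)"
    and c: "\<And>n. ce n = c (2 * n)" "\<And>n. co n = c (2 * n + 1)"
  shows "has_gf ce A \<and> has_gf co B"
proof -
  have "(\<lambda>n. of_nat (c (2 * n)) * w ^ n) sums A w \<and> (\<lambda>n. of_nat (c (2 * n + 1)) * w ^ n) sums B w"
    if w: "w \<noteq> 0" "norm w < 1" for w
  proof -
    define r where "r = csqrt w"
    have r2: "r\<^sup>2 = w"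
      by (simp add: r_def)
    have r: "r \<noteq> 0" "norm r < 1"
      using w by (auto simp: r_def real_sqrt_lt_1_iff)
    define f where "f n = of_nat (c n) * r ^ n" for n
    have plus: "f sums (A w + r * B w)"
      using has_gfD[OF gf r] F[OF r] by (simp add: f_def[abs_def] r2)
    have minus: "(\<lambda>n. (- 1) ^ n * f n) sums (A w - r * B w)"
      using has_gfD[OF gf, of "- r"] F[of "- r"] r
      by (simp add: f_def[abs_def] r2 power_minus[of r] mult_ac)
    have "(\<lambda>n. (f n + (- 1) ^ n * f n) / 2) sums ((A w + r * B w + (A w - r * B w)) / 2)"
      by (intro sums_divide sums_add plus minus)
    moreover have "(f n + (- 1) ^ n * f n) / 2 = 0" if "n \<notin> range (\<lambda>n. 2 * n)" for n
    proof -
      have "odd n"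
        using that by (auto elim!: evenE)
      then show ?thesis
        by simp
    qed
    ultimately have "(\<lambda>n. (f (2 * n) + (- 1) ^ (2 * n) * f (2 * n)) / 2) sums A w"
      by (subst sums_mono_reindex[of "\<lambda>n. 2 * n" "\<lambda>n. (f n + (- 1) ^ n * f n) / 2"])
         (auto simp: strict_mono_def)
    moreover have "(f (2 * n) + (- 1) ^ (2 * n) * f (2 * n)) / 2 = of_nat (c (2 * n)) * w ^ n" for n
      by (simp add: f_def power_mult r2)
    ultimately have A: "(\<lambda>n. of_nat (c (2 * n)) * w ^ n) sums A w"
      by (simp only:)
    have "(\<lambda>n. (f n - (- 1) ^ n * f n) / (2 * r)) sums ((A w + r * B w - (A w - r * B w)) / (2 * r))"
      by (intro sums_divide sums_diff plus minus)
    moreover have "(f n - (- 1) ^ n * f n) / (2 * r) = 0" if "n \<notin> range (\<lambda>n. 2 * n + 1)" for n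
    proof -
      have "even n"
        using that by (metis oddE rangeI)
      then show ?thesis
        by simp
    qed
    ultimately have "(\<lambda>n. (f (2 * n + 1) - (- 1) ^ (2 * n + 1) * f (2 * n + 1)) / (2 * r)) sums B w"
      using r
      by (subst sums_mono_reindex[of "\<lambda>n. 2 * n + 1" "\<lambda>n. (f n - (- 1) ^ n * f n) / (2 * r)"])
         (auto simp: strict_mono_def)
    moreover have "(f (2 * n + 1) - (- 1) ^ (2 * n + 1) * f (2 * n + 1)) / (2 * r) = of_nat (c (2 * n + 1)) * w ^ n" for n
      using r(1) by (simp add: f_def power_mult power_add r2)
    ultimately have B: "(\<lambda>n. of_nat (c (2 * n + 1)) * w ^ n) sums B w"
      by (simp only:)
    from A B show ?thesis ..
  qed
  then show ?thesis
    by (auto simp: has_gf_def c)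
qed

lemma qJ_power_simps:
  "qJ (numeral m) (q ^ k) = qJ (k * numeral m) q" "qJ 1 (q ^ k) = qJ k q" "qJ (Suc 0) (q ^ k) = qJ k q"
  by (simp_all add: qJ_power)

lemma mult_power_numeral:
  fixes q :: complex
  shows "q * q ^ numeral k = q ^ Suc (numeral k)" "q * (q ^ numeral k * x) = q ^ Suc (numeral k) * x"
  by (simp_all only: power_Suc mult.assoc)

lemma negative_powi:
  fixes q :: complex
  shows "q powi (- 1) = 1 / q" "q powi (- 2) = 1 / (q * q)" "q powi (- 3) = 1 / (q * (q * q))"
    "(q\<^sup>2) powi (- 1) = 1 / (q * q)" "(q\<^sup>2) powi (- 2) = 1 / (q * (q * (q * q)))"
    "(q\<^sup>2) powi (- 3) = 1 / (q * q ^ 5)"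
  by (simp_all add: power_int_minus divide_inverse eval_nat_numeral)

text \<open>The reductions lead to the values at 1 and -1 for q^4 with the same weight -2/q, so the
  sum formula applies once more.\<close>

lemma odd_rank_gf_sum_1_ii:
  assumes q: "norm q < 1" "q \<noteq> 0"
  shows "odd_rank_gf 1 q + odd_rank_gf (- 1) q + 2 * odd_rank_gf \<i> q =
    4 / q ^ 5 * odd_rank_gf (- 1) (q ^ 16)
    - 4 * q ^ 3 * (qJ 16 q ^ 8 * (qJ 64 q)\<^sup>2 / (qJ 8 q ^ 4 * qJ 32 q ^ 5))
    + 2 * q * (qJ 4 q ^ 8 * (qJ 16 q)\<^sup>2 / (qJ 2 q ^ 4 * qJ 8 q ^ 5)) + 2 * q * (qJ 8 q ^ 3 / (qJ 4 q)\<^sup>2)"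
proof -
  have q4: "norm (q ^ 4) < 1" "q ^ 4 \<noteq> 0"
    using q by (simp_all add: norm_power_less_one)
  define X where "X = qJ 16 q ^ 8 * (qJ 64 q)\<^sup>2 / (qJ 8 q ^ 4 * qJ 32 q ^ 5)"
  define Y where "Y = qJ 4 q ^ 8 * (qJ 16 q)\<^sup>2 / (qJ 2 q ^ 4 * qJ 8 q ^ 5)"
  define Z where "Z = qJ 8 q ^ 3 / (qJ 4 q)\<^sup>2"
  have 4: "odd_rank_gf 1 (q ^ 4) + odd_rank_gf (- 1) (q ^ 4) =
      - 2 / q ^ 4 * odd_rank_gf (- 1) (q ^ 16) + 2 * q ^ 4 * X"
    using odd_rank_gf_sum_1[OF q4] by (simp add: X_def qJ_power_simps flip: power_mult)
  have "odd_rank_gf 1 q + odd_rank_gf (- 1) q + 2 * odd_rank_gf \<i> q =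
      - 2 / q * (odd_rank_gf 1 (q ^ 4) + odd_rank_gf (- 1) (q ^ 4)) + 2 * q * Y + 2 * q * Z"
    unfolding odd_rank_gf_sum_1[OF q] odd_rank_gf_ii[OF q] Y_def Z_def by (simp add: ring_distribs diff_divide_distrib)
  also have "- 2 / q * (odd_rank_gf 1 (q ^ 4) + odd_rank_gf (- 1) (q ^ 4)) =
      4 / q ^ 5 * odd_rank_gf (- 1) (q ^ 16) - 4 * q ^ 3 * X"
    unfolding 4 using q(2) by (simp add: field_simps eval_nat_numeral)
  finally show ?thesis
    by (simp add: X_def Y_def Z_def)
qed

section \<open>Progressions modulo 2\<close>

lemma N0_8_has_gf:
  "has_gf (N0 0 8) (\<lambda>q. 1/8 * (odd_rank_gf 1 q + odd_rank_gf (- 1) q + 2 * odd_rank_gf \<i> q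
    + 2 * (odd_rank_gf zeta8 q + odd_rank_gf (- zeta8) q)))"
  "has_gf (N0 1 8) (\<lambda>q. 1/8 * (odd_rank_gf 1 q - odd_rank_gf (- 1) q
    + (1 - \<i>) * zeta8 * (odd_rank_gf zeta8 q - odd_rank_gf (- zeta8) q)))"
  "has_gf (N0 2 8) (\<lambda>q. 1/8 * (odd_rank_gf 1 q + odd_rank_gf (- 1) q - 2 * odd_rank_gf \<i> q))"
  "has_gf (N0 3 8) (\<lambda>q. 1/8 * (odd_rank_gf 1 q - odd_rank_gf (- 1) q
    - (1 - \<i>) * zeta8 * (odd_rank_gf zeta8 q - odd_rank_gf (- zeta8) q)))"
  "has_gf (N0 4 8) (\<lambda>q. 1/8 * (odd_rank_gf 1 q + odd_rank_gf (- 1) q + 2 * odd_rank_gf \<i> q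
    - 2 * (odd_rank_gf zeta8 q + odd_rank_gf (- zeta8) q)))"
  using N0_8_cases_sums by (simp_all add: has_gf_def)

lemma N0_0_odd:
  "has_gf (\<lambda>n. N0 0 8 (2 * n + 1))
    (\<lambda>q. - (q ^ 21) * mock_g (- (q ^ 32)) (q ^ 64)
    + q ^ 5 * (qJ 32 q ^ 8 * qJ 128 q ^ 2 / (qJ 16 q ^ 4 * qJ 64 q ^ 5))
    + 1/4 * (qJ 2 q ^ 8 * qJ 8 q ^ 2 / (qJ 1 q ^ 4 * qJ 4 q ^ 5))
    + 1/4 * (qJ 4 q ^ 3 / qJ 2 q ^ 2)
    + 1/2 * (qJ 2 q ^ 5 * qJ 16 q / (qJ 1 q ^ 2 * qJ 4 q ^ 2 * qJ 8 q))
    - 1/2 * q * (qJ 8 q ^ 8 * qJ 32 q ^ 2 / (qJ 4 q ^ 4 * qJ 16 q ^ 5))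
    - 1/2 * q * (qJ 16 q ^ 3 / qJ 8 q ^ 2))"
proof (rule has_gf_bisect[OF N0_8_has_gf(1), where A = "\<lambda>_. 0" and ce = "\<lambda>n. N0 0 8 (2 * n)"
      and co = "\<lambda>n. N0 0 8 (2 * n + 1)", THEN conjunct2], goal_cases)
  case q: (1 q)
  note nq = q(2,1)
  have q16: "norm (q ^ 16) < 1" "q ^ 16 \<noteq> 0"
    using q by (simp_all add: norm_power_less_one)
  define X where "X = qJ 64 q ^ 8 * (qJ 256 q)\<^sup>2 / (qJ 32 q ^ 4 * qJ 128 q ^ 5)"
  \<comment> \<open>Both values at q^16 enter the total with the same weight and combine into one
    mock theta term. Its exponent is 64 - 16 - 5 = 43, which becomes 21 in the odd part.\<close>
  have 16: "odd_rank_gf 1 (q ^ 16) + odd_rank_gf (- 1) (q ^ 16) =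
      - 2 * q ^ 48 * mock_g (- (q ^ 64)) (q ^ 128) + 2 * q ^ 16 * X"
    using odd_rank_gf_sum_1[OF q16] q(1)
    by (simp add: X_def qJ_power_simps odd_rank_gf_def flip: power_mult) (simp add: field_simps)
  have "2 / q ^ 5 * (odd_rank_gf 1 (q ^ 16) + odd_rank_gf (- 1) (q ^ 16)) =
      - 4 * q ^ 43 * mock_g (- (q ^ 64)) (q ^ 128) + 4 * q ^ 11 * X"
    unfolding 16 using q(1) by (simp add: field_simps)
  then have 5: "2 / q ^ 5 * odd_rank_gf 1 (q ^ 16) =
      - 4 * q ^ 43 * mock_g (- (q ^ 64)) (q ^ 128) + 4 * q ^ 11 * X - 2 / q ^ 5 * odd_rank_gf (- 1) (q ^ 16)"
    by (simp add: algebra_simps)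
  show ?case
    unfolding odd_rank_gf_sum_1_ii[OF nq] odd_rank_gf_sum_zeta8[OF nq] 5 X_def
    by (simp add: qJ_power_simps algebra_simps mult_power_numeral flip: power_mult)
qed simp_all

lemma N0_1_even:
  "has_gf (\<lambda>n. N0 1 8 (2 * n))
    (\<lambda>q. - 1/4 + 1/4 * mock_g (-1) (q ^ 4) + 1/2 * q ^ 4 * mock_g (q ^ 4) (q ^ 16)
    + 1/8 * (qJ 2 q ^ 6 * qJ 4 q / (qJ 1 q ^ 4 * qJ 8 q ^ 2))
    - 1/4 * (qJ 8 q ^ 7 / (qJ 4 q ^ 3 * qJ 16 q ^ 3))
    + 1/4 * (qJ 2 q ^ 5 * qJ 8 q ^ 2 / (qJ 1 q ^ 2 * qJ 4 q ^ 3 * qJ 16 q)))"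
proof (rule has_gf_bisect[OF N0_8_has_gf(2), where B = "\<lambda>_. 0" and ce = "\<lambda>n. N0 1 8 (2 * n)"
      and co = "\<lambda>n. N0 1 8 (2 * n + 1)", THEN conjunct1], goal_cases)
  case q: (1 q)
  note nq = q(2,1)
  show ?case
    unfolding odd_rank_gf_diff_1[OF nq] odd_rank_gf_diff_zeta8[OF nq]
    by (simp add: qJ_power_simps algebra_simps flip: power_mult power_Suc)
qed simp_all

text \<open>The sign of the term at \<open>\<i>\<close> is reversed compared with residue 0, so at
  q^4 the difference formula applies and brings in g(-1) together with a pole at q = 0 in the
  separate terms.\<close>

lemma N0_2_odd:
  "has_gf (\<lambda>n. N0 2 8 (2 * n + 1))
    (\<lambda>q. - 1/2 * q powi (-1) + 1/2 * q powi (-1) * mock_g (-1) (q ^ 16)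
    + 1/4 * q powi (-1) * (qJ 8 q ^ 6 * qJ 16 q / (qJ 4 q ^ 4 * qJ 32 q ^ 2))
    + 1/4 * (qJ 2 q ^ 8 * qJ 8 q ^ 2 / (qJ 4 q ^ 5 * qJ 1 q ^ 4))
    - 1/4 * (qJ 4 q ^ 3 / qJ 2 q ^ 2))"
proof (rule has_gf_bisect[OF N0_8_has_gf(3), where A = "\<lambda>_. 0" and ce = "\<lambda>n. N0 2 8 (2 * n)"
      and co = "\<lambda>n. N0 2 8 (2 * n + 1)", THEN conjunct2], goal_cases)
  case q: (1 q)
  note nq = q(2,1)
  have q4: "norm (q ^ 4) < 1" "q ^ 4 \<noteq> 0"
    using q by (simp_all add: norm_power_less_one)
  have 4: "odd_rank_gf 1 (q ^ 4) = odd_rank_gf (- 1) (q ^ 4) - 2 + 2 * mock_g (- 1) (q ^ 32)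
      + qJ 16 q ^ 6 * qJ 32 q / (qJ 8 q ^ 4 * (qJ 64 q)\<^sup>2)"
    using odd_rank_gf_diff_1[OF q4] by (simp add: qJ_power_simps algebra_simps flip: power_mult)
  show ?case
    unfolding odd_rank_gf_sum_1[OF nq] odd_rank_gf_ii[OF nq] 4 negative_powi[of q]
    using q(1) by (simp add: qJ_power_simps algebra_simps flip: power_mult)
qed simp_all

lemma N0_3_even:
  "has_gf (\<lambda>n. N0 3 8 (2 * n))
    (\<lambda>q. - 1/4 + 1/4 * mock_g (-1) (q ^ 4) - 1/2 * q ^ 4 * mock_g (q ^ 4) (q ^ 16)
    + 1/4 * (qJ 8 q ^ 7 / (qJ 4 q ^ 3 * qJ 16 q ^ 3))
    - 1/4 * (qJ 2 q ^ 5 * qJ 8 q ^ 2 / (qJ 1 q ^ 2 * qJ 4 q ^ 3 * qJ 16 q))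
    + 1/8 * (qJ 2 q ^ 6 * qJ 4 q / (qJ 1 q ^ 4 * qJ 8 q ^ 2)))"
proof (rule has_gf_bisect[OF N0_8_has_gf(4), where B = "\<lambda>_. 0" and ce = "\<lambda>n. N0 3 8 (2 * n)"
      and co = "\<lambda>n. N0 3 8 (2 * n + 1)", THEN conjunct1], goal_cases)
  case q: (1 q)
  note nq = q(2,1)
  show ?case
    unfolding odd_rank_gf_diff_1[OF nq] odd_rank_gf_diff_zeta8[OF nq]
    by (simp add: qJ_power_simps algebra_simps flip: power_mult power_Suc)
qed simp_all

lemma N0_4_odd:
  "has_gf (\<lambda>n. N0 4 8 (2 * n + 1))
    (\<lambda>q. q powi (-3) - q powi (-3) * mock_g (-1) (q ^ 64)
    - 1/2 * q powi (-3) * (qJ 32 q ^ 6 * qJ 64 q / (qJ 16 q ^ 4 * qJ 128 q ^ 2))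
    + 1/4 * ((qJ 2 q ^ 8 * qJ 8 q ^ 2 / (qJ 1 q ^ 4 * qJ 4 q ^ 5))
    - 2 * (qJ 2 q ^ 5 * qJ 16 q / (qJ 1 q ^ 2 * qJ 4 q ^ 2 * qJ 8 q))
    + (qJ 4 q ^ 3 / qJ 2 q ^ 2))
    + 1/2 * q * ((qJ 16 q ^ 3 / qJ 8 q ^ 2)
    - (qJ 8 q ^ 8 * qJ 32 q ^ 2 / (qJ 4 q ^ 4 * qJ 16 q ^ 5))))"
proof (rule has_gf_bisect[OF N0_8_has_gf(5), where A = "\<lambda>_. 0" and ce = "\<lambda>n. N0 4 8 (2 * n)"
      and co = "\<lambda>n. N0 4 8 (2 * n + 1)", THEN conjunct2], goal_cases)
  case q: (1 q)
  note nq = q(2,1)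
  have q16: "norm (q ^ 16) < 1" "q ^ 16 \<noteq> 0"
    using q by (simp_all add: norm_power_less_one)
  \<comment> \<open>The values at q^16 now have opposite weights, so the difference formula replaces
    the sum formula used for residue 0.\<close>
  define X where "X = qJ 64 q ^ 6 * qJ 128 q / (qJ 32 q ^ 4 * (qJ 256 q)\<^sup>2)"
  have 16: "odd_rank_gf 1 (q ^ 16) = odd_rank_gf (- 1) (q ^ 16) - 2 + 2 * mock_g (- 1) (q ^ 128) + X"
    using odd_rank_gf_diff_1[OF q16] by (simp add: X_def qJ_power_simps algebra_simps flip: power_mult)
  have cube: "q * q\<^sup>2 = q ^ 3" "q * (q\<^sup>2 * x) = q ^ 3 * x" for x
    by (simp_all add: eval_nat_numeral)
  show ?case
    unfolding odd_rank_gf_sum_1_ii[OF nq] odd_rank_gf_sum_zeta8[OF nq] 16 X_def negative_powi[of q]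
    using q(1) by (simp add: qJ_power_simps algebra_simps cube flip: power_mult)
qed simp_all

section \<open>Progressions modulo 4 and 8\<close>

text \<open>The mock theta term has the odd exponent 21 and otherwise depends on q^2 only, so it
  passes to 4n + 3 and leaves theta quotients on 4n + 1.\<close>

lemma N0_0_4n:
  "has_gf (\<lambda>n. N0 0 8 (4 * n + 1))
    (\<lambda>q. 1/4 * ((qJ 2 q ^ 9 / (qJ 1 q ^ 6 * qJ 4 q ^ 2)) + (qJ 2 q ^ 3 / qJ 1 q ^ 2)
    + 2 * (qJ 4 q ^ 4 / (qJ 8 q * qJ 2 q ^ 2)))) \<and>
  has_gf (\<lambda>n. N0 0 8 (4 * n + 3))
    (\<lambda>q. - (q ^ 10) * mock_g (- (q ^ 16)) (q ^ 32)
    + q ^ 2 * (qJ 16 q ^ 8 * qJ 64 q ^ 2 / (qJ 8 q ^ 4 * qJ 32 q ^ 5))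
    + 1/2 * (qJ 8 q ^ 3 / qJ 4 q ^ 2) + (qJ 4 q ^ 6 / (qJ 1 q ^ 2 * qJ 2 q ^ 3))
    - 1/2 * (qJ 4 q ^ 8 * qJ 16 q ^ 2 / (qJ 2 q ^ 4 * qJ 8 q ^ 5)))"
proof (rule has_gf_bisect[OF N0_0_odd], goal_cases)
  case q: (1 q)
  show ?case
    using bisect_J2_8_J8_2_over_J1_4_J4_5[OF q(2,1)] bisect_J2_5_J16_over_J1_2_J4_2_J8[OF q(2,1)]
    by (simp add: qJ_power_simps algebra_simps mult_power_numeral flip: power_mult)
qed (rule arg_cong[where f = "N0 0 8"], simp)+

lemma N0_0_8n_1:
  "has_gf (\<lambda>n. N0 0 8 (8 * n + 1))
    (\<lambda>q. 1/2 * (qJ 2 q ^ 4 / (qJ 1 q ^ 2 * qJ 4 q))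
    + 1/4 * (qJ 4 q ^ 5 / (qJ 1 q ^ 2 * qJ 8 q ^ 2))
    + 1/4 * (qJ 2 q ^ 12 * qJ 4 q / (qJ 1 q ^ 10 * qJ 8 q ^ 2))
    + 2 * q * (qJ 2 q ^ 2 * qJ 4 q ^ 3 * qJ 8 q ^ 2 / qJ 1 q ^ 6)) \<and>
  has_gf (\<lambda>n. N0 0 8 (8 * n + 5))
    (\<lambda>q. 2 * (qJ 4 q ^ 9 / (qJ 1 q ^ 6 * qJ 8 q ^ 2)))"
proof (rule has_gf_bisect[OF N0_0_4n[THEN conjunct1]], goal_cases)
  case q: (1 q)
  show ?case
    using bisect_J2_9_over_J1_6_J4_2'[OF q(2,1)]
    by (simp add: qJ_power_simps algebra_simps mult_power_numeral flip: power_mult)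
qed (rule arg_cong[where f = "N0 0 8"], simp)+

text \<open>The exponent 10 of the mock theta term is even, so it stays on 8n + 3.\<close>

lemma N0_0_8n_3:
  "has_gf (\<lambda>n. N0 0 8 (8 * n + 3))
    (\<lambda>q. - (q ^ 5) * mock_g (- (q ^ 8)) (q ^ 16)
    + q * (qJ 8 q ^ 8 * qJ 32 q ^ 2 / (qJ 4 q ^ 4 * qJ 16 q ^ 5))
    + 1/2 * (qJ 4 q ^ 3 / qJ 2 q ^ 2)
    - 1/2 * (qJ 2 q ^ 8 * qJ 8 q ^ 2 / (qJ 1 q ^ 4 * qJ 4 q ^ 5))
    + (qJ 2 q ^ 6 * qJ 4 q ^ 5 / (qJ 1 q ^ 8 * qJ 8 q ^ 2))) \<and>
  has_gf (\<lambda>n. N0 0 8 (8 * n + 7))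
    (\<lambda>q. 2 * (qJ 2 q ^ 8 * qJ 8 q ^ 2 / (qJ 1 q ^ 8 * qJ 4 q)))"
proof (rule has_gf_bisect[OF N0_0_4n[THEN conjunct2]], goal_cases)
  case q: (1 q)
  show ?case
    using bisect_J4_6_over_J1_2_J2_3[OF q(2,1)]
    by (simp add: qJ_power_simps algebra_simps mult_power_numeral flip: power_mult)
qed (rule arg_cong[where f = "N0 0 8"], simp)+

text \<open>The power q^(-3) is q times (q^2)^(-2), so the mock theta part goes to 4n + 3; the
  resulting q^(-2) is even and remains on 8n + 3 afterwards.\<close>

lemma N0_4_4n:
  "has_gf (\<lambda>n. N0 4 8 (4 * n + 1))
    (\<lambda>q. 1/4 * ((qJ 2 q ^ 9 / (qJ 1 q ^ 6 * qJ 4 q ^ 2))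
    - 2 * (qJ 4 q ^ 4 / (qJ 2 q ^ 2 * qJ 8 q)) + (qJ 2 q ^ 3 / qJ 1 q ^ 2))) \<and>
  has_gf (\<lambda>n. N0 4 8 (4 * n + 3))
    (\<lambda>q. q powi (-2) - q powi (-2) * mock_g (-1) (q ^ 32)
    - 1/2 * q powi (-2) * (qJ 16 q ^ 6 * qJ 32 q / (qJ 8 q ^ 4 * qJ 64 q ^ 2))
    - 1/2 * (qJ 8 q ^ 3 / qJ 4 q ^ 2)
    - 1/2 * (qJ 4 q ^ 8 * qJ 16 q ^ 2 / (qJ 2 q ^ 4 * qJ 8 q ^ 5))
    + (qJ 4 q ^ 6 / (qJ 2 q ^ 3 * qJ 1 q ^ 2)))"
proof (rule has_gf_bisect[OF N0_4_odd], goal_cases)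
  case q: (1 q)
  show ?case
    unfolding negative_powi[of q] using bisect_J2_8_J8_2_over_J1_4_J4_5[OF q(2,1)] bisect_J2_5_J16_over_J1_2_J4_2_J8[OF q(2,1)]  q(1)
    by (simp add: qJ_power_simps algebra_simps mult_power_numeral flip: power_mult)
qed (rule arg_cong[where f = "N0 4 8"], simp)+

lemma N0_4_8n_1:
  "has_gf (\<lambda>n. N0 4 8 (8 * n + 1))
    (\<lambda>q. 1/4 * (qJ 2 q ^ 12 * qJ 4 q / (qJ 1 q ^ 10 * qJ 8 q ^ 2))
    + 2 * q * (qJ 2 q ^ 2 * qJ 4 q ^ 3 * qJ 8 q ^ 2 / qJ 1 q ^ 6)
    - 1/2 * (qJ 2 q ^ 4 / (qJ 1 q ^ 2 * qJ 4 q))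
    + 1/4 * (qJ 4 q ^ 5 / (qJ 1 q ^ 2 * qJ 8 q ^ 2))) \<and>
  has_gf (\<lambda>n. N0 4 8 (8 * n + 5))
    (\<lambda>q. 2 * (qJ 4 q ^ 9 / (qJ 1 q ^ 6 * qJ 8 q ^ 2)))"
proof (rule has_gf_bisect[OF N0_4_4n[THEN conjunct1]], goal_cases)
  case q: (1 q)
  show ?case
    using bisect_J2_9_over_J1_6_J4_2'[OF q(2,1)]
    by (simp add: qJ_power_simps algebra_simps mult_power_numeral flip: power_mult)
qed (rule arg_cong[where f = "N0 4 8"], simp)+

lemma N0_4_8n_3:
  "has_gf (\<lambda>n. N0 4 8 (8 * n + 3))
    (\<lambda>q. q powi (-1) - q powi (-1) * mock_g (-1) (q ^ 16)
    - 1/2 * q powi (-1) * (qJ 8 q ^ 6 * qJ 16 q / (qJ 4 q ^ 4 * qJ 32 q ^ 2))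
    - 1/2 * (qJ 4 q ^ 3 / qJ 2 q ^ 2)
    - 1/2 * (qJ 2 q ^ 8 * qJ 8 q ^ 2 / (qJ 1 q ^ 4 * qJ 4 q ^ 5))
    + (qJ 2 q ^ 6 * qJ 4 q ^ 5 / (qJ 1 q ^ 8 * qJ 8 q ^ 2))) \<and>
  has_gf (\<lambda>n. N0 4 8 (8 * n + 7))
    (\<lambda>q. 2 * (qJ 2 q ^ 8 * qJ 8 q ^ 2 / (qJ 1 q ^ 8 * qJ 4 q)))"
proof (rule has_gf_bisect[OF N0_4_4n[THEN conjunct2]], goal_cases)
  case q: (1 q)
  show ?case
    unfolding negative_powi[of q] using bisect_J4_6_over_J1_2_J2_3[OF q(2,1)]  q(1)
    by (simp add: qJ_power_simps algebra_simps mult_power_numeral flip: power_mult)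
qed (rule arg_cong[where f = "N0 4 8"], simp)+

lemma N0_2_4n:
  "has_gf (\<lambda>n. N0 2 8 (4 * n + 1))
    (\<lambda>q. q * (qJ 2 q ^ 4 * qJ 16 q ^ 2 / (qJ 1 q ^ 4 * qJ 8 q))) \<and>
  has_gf (\<lambda>n. N0 2 8 (4 * n + 3))
    (\<lambda>q. - 1/2 * q powi (-1) + 1/2 * q powi (-1) * mock_g (-1) (q ^ 8)
    + 1/4 * q powi (-1) * (qJ 4 q ^ 6 * qJ 8 q / (qJ 2 q ^ 4 * qJ 16 q ^ 2))
    + (qJ 4 q ^ 6 / (qJ 1 q ^ 2 * qJ 2 q ^ 3)))"
proof (rule has_gf_bisect[OF N0_2_odd], goal_cases)
  case q: (1 q)
  have q2: "norm (q\<^sup>2) < 1" "q\<^sup>2 \<noteq> 0"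
    using q by (simp_all add: norm_power_less_one)
  show ?case
    unfolding negative_powi[of q] using bisect_J2_8_J8_2_over_J1_4_J4_5[OF q(2,1)] J_quotient_diff[OF q2] q(1)
    by (simp add: qJ_power_simps algebra_simps mult_power_numeral flip: power_mult)
qed (rule arg_cong[where f = "N0 2 8"], simp)+

lemma N0_2_8n_1:
  "has_gf (\<lambda>n. N0 2 8 (8 * n + 1))
    (\<lambda>q. 4 * q * (qJ 2 q ^ 2 * qJ 4 q ^ 3 * qJ 8 q ^ 2 / qJ 1 q ^ 6)) \<and>
  has_gf (\<lambda>n. N0 2 8 (8 * n + 5))
    (\<lambda>q. qJ 2 q ^ 14 * qJ 8 q ^ 2 / (qJ 1 q ^ 10 * qJ 4 q ^ 5))"
proof (rule has_gf_bisect[OF N0_2_4n[THEN conjunct1]], goal_cases)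
  case q: (1 q)
  show ?case
    using bisect_J2_4_J16_2_over_J1_4_J8[OF q(2,1)]
    by (simp add: qJ_power_simps algebra_simps mult_power_numeral power2_eq_square[of q, symmetric] flip: power_mult)
qed (rule arg_cong[where f = "N0 2 8"], simp)+

text \<open>The power q^(-1) is q times (q^2)^(-1), hence odd at every level. The mock theta part
  therefore ends on 8n + 7, not on 8n + 3 as for residues 0 and 4.\<close>

lemma N0_2_8n_3:
  "has_gf (\<lambda>n. N0 2 8 (8 * n + 3))
    (\<lambda>q. qJ 2 q ^ 6 * qJ 4 q ^ 5 / (qJ 1 q ^ 8 * qJ 8 q ^ 2)) \<and>
  has_gf (\<lambda>n. N0 2 8 (8 * n + 7))
    (\<lambda>q. - 1/2 * q powi (-1) + 1/2 * q powi (-1) * mock_g (-1) (q ^ 4)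
    + 1/4 * q powi (-1) * (qJ 2 q ^ 6 * qJ 4 q / (qJ 1 q ^ 4 * qJ 8 q ^ 2))
    + 2 * (qJ 2 q ^ 8 * qJ 8 q ^ 2 / (qJ 1 q ^ 8 * qJ 4 q)))"
proof (rule has_gf_bisect[OF N0_2_4n[THEN conjunct2]], goal_cases)
  case q: (1 q)
  show ?case
    unfolding negative_powi[of q] using bisect_J4_6_over_J1_2_J2_3[OF q(2,1)]  q(1)
    by (simp add: qJ_power_simps algebra_simps mult_power_numeral flip: power_mult)
qed (rule arg_cong[where f = "N0 2 8"], simp)+

lemma N0_1_4n:
  "has_gf (\<lambda>n. N0 1 8 (4 * n))
    (\<lambda>q. - 1/4 + 1/4 * mock_g (-1) (q ^ 2) + 1/2 * q ^ 2 * mock_g (q ^ 2) (q ^ 8)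
    + 1/8 * (qJ 2 q ^ 15 / (qJ 1 q ^ 8 * qJ 4 q ^ 6))) \<and>
  has_gf (\<lambda>n. N0 1 8 (4 * n + 2))
    (\<lambda>q. 1/2 * ((qJ 2 q ^ 3 * qJ 4 q ^ 2 / qJ 1 q ^ 4) + (qJ 4 q * qJ 8 q / qJ 2 q)))"
proof (rule has_gf_bisect[OF N0_1_even], goal_cases)
  case q: (1 q)
  show ?case
    using bisect_J2_6_J4_over_J1_4_J8_2[OF q(2,1)] bisect_J2_5_J8_2_over_J1_2_J4_3_J16[OF q(2,1)]
    by (simp add: qJ_power_simps algebra_simps mult_power_numeral flip: power_mult)
qed (rule arg_cong[where f = "N0 1 8"], simp)+

lemma N0_1_8n:
  "has_gf (\<lambda>n. N0 1 8 (8 * n))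
    (\<lambda>q. - 1/4 + 1/4 * mock_g (-1) q + 1/2 * q * mock_g q (q ^ 4)
    + 1/8 * (qJ 2 q ^ 22 / (qJ 1 q ^ 13 * qJ 4 q ^ 8))
    + 2 * q * (qJ 4 q ^ 8 / (qJ 1 q ^ 5 * qJ 2 q ^ 2))) \<and>
  has_gf (\<lambda>n. N0 1 8 (8 * n + 4))
    (\<lambda>q. qJ 2 q ^ 10 / qJ 1 q ^ 9)"
proof (rule has_gf_bisect[OF N0_1_4n[THEN conjunct1]], goal_cases)
  case q: (1 q)
  show ?case
    using bisect_J2_15_over_J1_8_J4_6[OF q(2,1)]
    by (simp add: qJ_power_simps algebra_simps mult_power_numeral flip: power_mult)
qed (rule arg_cong[where f = "N0 1 8"], simp)+

lemma N0_1_8n_2: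
  "has_gf (\<lambda>n. N0 1 8 (8 * n + 2))
    (\<lambda>q. 1/2 * ((qJ 2 q ^ 16 / (qJ 1 q ^ 11 * qJ 4 q ^ 4)) + (qJ 2 q * qJ 4 q / qJ 1 q))) \<and>
  has_gf (\<lambda>n. N0 1 8 (8 * n + 6))
    (\<lambda>q. 2 * (qJ 2 q ^ 4 * qJ 4 q ^ 4 / qJ 1 q ^ 7))"
proof (rule has_gf_bisect[OF N0_1_4n[THEN conjunct2]], goal_cases)
  case q: (1 q)
  show ?case
    using bisect_J2_3_J4_2_over_J1_4[OF q(2,1)]
    by (simp add: qJ_power_simps algebra_simps mult_power_numeral flip: power_mult)
qed (rule arg_cong[where f = "N0 1 8"], simp)+

text \<open>Of the two opposite quotients one is carried over from the even progression, the other
  is the even part of its neighbour. They are displayed as in the stated formula; for residue 1 the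
  same pair has been cancelled.\<close>

lemma N0_3_4n:
  "has_gf (\<lambda>n. N0 3 8 (4 * n))
    (\<lambda>q. - 1/4 + 1/4 * mock_g (-1) (q ^ 2) - 1/2 * q ^ 2 * mock_g (q ^ 2) (q ^ 8)
    + 1/4 * (qJ 4 q ^ 7 / (qJ 2 q ^ 3 * qJ 8 q ^ 3))
    - 1/4 * (qJ 4 q ^ 7 / (qJ 2 q ^ 3 * qJ 8 q ^ 3))
    + 1/8 * (qJ 2 q ^ 15 / (qJ 4 q ^ 6 * qJ 1 q ^ 8))) \<and>
  has_gf (\<lambda>n. N0 3 8 (4 * n + 2))
    (\<lambda>q. 1/2 * ((qJ 2 q ^ 3 * qJ 4 q ^ 2 / qJ 1 q ^ 4) - (qJ 4 q * qJ 8 q / qJ 2 q)))"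
proof (rule has_gf_bisect[OF N0_3_even], goal_cases)
  case q: (1 q)
  show ?case
    using bisect_J2_6_J4_over_J1_4_J8_2[OF q(2,1)] bisect_J2_5_J8_2_over_J1_2_J4_3_J16[OF q(2,1)]
    by (simp add: qJ_power_simps algebra_simps mult_power_numeral flip: power_mult)
qed (rule arg_cong[where f = "N0 3 8"], simp)+

lemma N0_3_8n:
  "has_gf (\<lambda>n. N0 3 8 (8 * n))
    (\<lambda>q. - 1/4 + 1/4 * mock_g (-1) q - 1/2 * q * mock_g q (q ^ 4)
    + 1/8 * (qJ 2 q ^ 22 / (qJ 1 q ^ 13 * qJ 4 q ^ 8))
    + 2 * q * (qJ 4 q ^ 8 / (qJ 1 q ^ 5 * qJ 2 q ^ 2))) \<and>
  has_gf (\<lambda>n. N0 3 8 (8 * n + 4))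
    (\<lambda>q. qJ 2 q ^ 10 / qJ 1 q ^ 9)"
proof (rule has_gf_bisect[OF N0_3_4n[THEN conjunct1]], goal_cases)
  case q: (1 q)
  show ?case
    using bisect_J2_15_over_J1_8_J4_6[OF q(2,1)]
    by (simp add: qJ_power_simps algebra_simps mult_power_numeral flip: power_mult)
qed (rule arg_cong[where f = "N0 3 8"], simp)+

lemma N0_3_8n_2:
  "has_gf (\<lambda>n. N0 3 8 (8 * n + 2))
    (\<lambda>q. 1/2 * ((qJ 2 q ^ 16 / (qJ 1 q ^ 11 * qJ 4 q ^ 4)) - (qJ 2 q * qJ 4 q / qJ 1 q))) \<and>
  has_gf (\<lambda>n. N0 3 8 (8 * n + 6))
    (\<lambda>q. 2 * (qJ 2 q ^ 4 * qJ 4 q ^ 4 / qJ 1 q ^ 7))"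
proof (rule has_gf_bisect[OF N0_3_4n[THEN conjunct2]], goal_cases)
  case q: (1 q)
  show ?case
    using bisect_J2_3_J4_2_over_J1_4[OF q(2,1)]
    by (simp add: qJ_power_simps algebra_simps mult_power_numeral flip: power_mult)
qed (rule arg_cong[where f = "N0 3 8"], simp)+

theorem theorem3p3:
  fixes q :: complex
  assumes "q \<noteq> 0" and "norm q < 1"
  shows "
     ((\<lambda>n. of_nat (N0 0 8 (2 * n + 1)) * q ^ n) sums
        (- (q ^ 21) * mock_g (- (q ^ 32)) (q ^ 64)
         + q ^ 5 * (qJ 32 q ^ 8 * qJ 128 q ^ 2 / (qJ 16 q ^ 4 * qJ 64 q ^ 5))
         + 1/4 * (qJ 2 q ^ 8 * qJ 8 q ^ 2 / (qJ 1 q ^ 4 * qJ 4 q ^ 5))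
         + 1/4 * (qJ 4 q ^ 3 / qJ 2 q ^ 2)
         + 1/2 * (qJ 2 q ^ 5 * qJ 16 q / (qJ 1 q ^ 2 * qJ 4 q ^ 2 * qJ 8 q))
         - 1/2 * q * (qJ 8 q ^ 8 * qJ 32 q ^ 2 / (qJ 4 q ^ 4 * qJ 16 q ^ 5))
         - 1/2 * q * (qJ 16 q ^ 3 / qJ 8 q ^ 2)) \<and>
      (\<lambda>n. of_nat (N0 0 8 (4 * n + 1)) * q ^ n) sums
        (1/4 * ((qJ 2 q ^ 9 / (qJ 1 q ^ 6 * qJ 4 q ^ 2)) + (qJ 2 q ^ 3 / qJ 1 q ^ 2)
                + 2 * (qJ 4 q ^ 4 / (qJ 8 q * qJ 2 q ^ 2)))) \<and>
      (\<lambda>n. of_nat (N0 0 8 (4 * n + 3)) * q ^ n) sums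
        (- (q ^ 10) * mock_g (- (q ^ 16)) (q ^ 32)
         + q ^ 2 * (qJ 16 q ^ 8 * qJ 64 q ^ 2 / (qJ 8 q ^ 4 * qJ 32 q ^ 5))
         + 1/2 * (qJ 8 q ^ 3 / qJ 4 q ^ 2) + (qJ 4 q ^ 6 / (qJ 1 q ^ 2 * qJ 2 q ^ 3))
         - 1/2 * (qJ 4 q ^ 8 * qJ 16 q ^ 2 / (qJ 2 q ^ 4 * qJ 8 q ^ 5))) \<and>
      (\<lambda>n. of_nat (N0 0 8 (8 * n + 1)) * q ^ n) sums
        (1/2 * (qJ 2 q ^ 4 / (qJ 1 q ^ 2 * qJ 4 q))
         + 1/4 * (qJ 4 q ^ 5 / (qJ 1 q ^ 2 * qJ 8 q ^ 2))
         + 1/4 * (qJ 2 q ^ 12 * qJ 4 q / (qJ 1 q ^ 10 * qJ 8 q ^ 2))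
         + 2 * q * (qJ 2 q ^ 2 * qJ 4 q ^ 3 * qJ 8 q ^ 2 / qJ 1 q ^ 6)) \<and>
      (\<lambda>n. of_nat (N0 0 8 (8 * n + 3)) * q ^ n) sums
        (- (q ^ 5) * mock_g (- (q ^ 8)) (q ^ 16)
         + q * (qJ 8 q ^ 8 * qJ 32 q ^ 2 / (qJ 4 q ^ 4 * qJ 16 q ^ 5))
         + 1/2 * (qJ 4 q ^ 3 / qJ 2 q ^ 2)
         - 1/2 * (qJ 2 q ^ 8 * qJ 8 q ^ 2 / (qJ 1 q ^ 4 * qJ 4 q ^ 5))
         + (qJ 2 q ^ 6 * qJ 4 q ^ 5 / (qJ 1 q ^ 8 * qJ 8 q ^ 2))) \<and>
      (\<lambda>n. of_nat (N0 0 8 (8 * n + 5)) * q ^ n) sums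
        (2 * (qJ 4 q ^ 9 / (qJ 1 q ^ 6 * qJ 8 q ^ 2))) \<and>
      (\<lambda>n. of_nat (N0 0 8 (8 * n + 7)) * q ^ n) sums
        (2 * (qJ 2 q ^ 8 * qJ 8 q ^ 2 / (qJ 1 q ^ 8 * qJ 4 q)))) \<and>
     ((\<lambda>n. of_nat (N0 1 8 (2 * n)) * q ^ n) sums
        (- 1/4 + 1/4 * mock_g (-1) (q ^ 4) + 1/2 * q ^ 4 * mock_g (q ^ 4) (q ^ 16)
         + 1/8 * (qJ 2 q ^ 6 * qJ 4 q / (qJ 1 q ^ 4 * qJ 8 q ^ 2))
         - 1/4 * (qJ 8 q ^ 7 / (qJ 4 q ^ 3 * qJ 16 q ^ 3))
         + 1/4 * (qJ 2 q ^ 5 * qJ 8 q ^ 2 / (qJ 1 q ^ 2 * qJ 4 q ^ 3 * qJ 16 q))) \<and>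
      (\<lambda>n. of_nat (N0 1 8 (4 * n)) * q ^ n) sums
        (- 1/4 + 1/4 * mock_g (-1) (q ^ 2) + 1/2 * q ^ 2 * mock_g (q ^ 2) (q ^ 8)
         + 1/8 * (qJ 2 q ^ 15 / (qJ 1 q ^ 8 * qJ 4 q ^ 6))) \<and>
      (\<lambda>n. of_nat (N0 1 8 (4 * n + 2)) * q ^ n) sums
        (1/2 * ((qJ 2 q ^ 3 * qJ 4 q ^ 2 / qJ 1 q ^ 4) + (qJ 4 q * qJ 8 q / qJ 2 q))) \<and>
      (\<lambda>n. of_nat (N0 1 8 (8 * n)) * q ^ n) sums
        (- 1/4 + 1/4 * mock_g (-1) q + 1/2 * q * mock_g q (q ^ 4)
         + 1/8 * (qJ 2 q ^ 22 / (qJ 1 q ^ 13 * qJ 4 q ^ 8))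
         + 2 * q * (qJ 4 q ^ 8 / (qJ 1 q ^ 5 * qJ 2 q ^ 2))) \<and>
      (\<lambda>n. of_nat (N0 1 8 (8 * n + 2)) * q ^ n) sums
        (1/2 * ((qJ 2 q ^ 16 / (qJ 1 q ^ 11 * qJ 4 q ^ 4)) + (qJ 2 q * qJ 4 q / qJ 1 q))) \<and>
      (\<lambda>n. of_nat (N0 1 8 (8 * n + 4)) * q ^ n) sums
        (qJ 2 q ^ 10 / qJ 1 q ^ 9) \<and>
      (\<lambda>n. of_nat (N0 1 8 (8 * n + 6)) * q ^ n) sums
        (2 * (qJ 2 q ^ 4 * qJ 4 q ^ 4 / qJ 1 q ^ 7))) \<and>
     ((\<lambda>n. of_nat (N0 2 8 (2 * n + 1)) * q ^ n) sums
        (- 1/2 * q powi (-1) + 1/2 * q powi (-1) * mock_g (-1) (q ^ 16)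
         + 1/4 * q powi (-1) * (qJ 8 q ^ 6 * qJ 16 q / (qJ 4 q ^ 4 * qJ 32 q ^ 2))
         + 1/4 * (qJ 2 q ^ 8 * qJ 8 q ^ 2 / (qJ 4 q ^ 5 * qJ 1 q ^ 4))
         - 1/4 * (qJ 4 q ^ 3 / qJ 2 q ^ 2)) \<and>
      (\<lambda>n. of_nat (N0 2 8 (4 * n + 1)) * q ^ n) sums
        (q * (qJ 2 q ^ 4 * qJ 16 q ^ 2 / (qJ 1 q ^ 4 * qJ 8 q))) \<and>
      (\<lambda>n. of_nat (N0 2 8 (4 * n + 3)) * q ^ n) sums
        (- 1/2 * q powi (-1) + 1/2 * q powi (-1) * mock_g (-1) (q ^ 8)
         + 1/4 * q powi (-1) * (qJ 4 q ^ 6 * qJ 8 q / (qJ 2 q ^ 4 * qJ 16 q ^ 2))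
         + (qJ 4 q ^ 6 / (qJ 1 q ^ 2 * qJ 2 q ^ 3))) \<and>
      (\<lambda>n. of_nat (N0 2 8 (8 * n + 1)) * q ^ n) sums
        (4 * q * (qJ 2 q ^ 2 * qJ 4 q ^ 3 * qJ 8 q ^ 2 / qJ 1 q ^ 6)) \<and>
      (\<lambda>n. of_nat (N0 2 8 (8 * n + 3)) * q ^ n) sums
        (qJ 2 q ^ 6 * qJ 4 q ^ 5 / (qJ 1 q ^ 8 * qJ 8 q ^ 2)) \<and>
      (\<lambda>n. of_nat (N0 2 8 (8 * n + 5)) * q ^ n) sums
        (qJ 2 q ^ 14 * qJ 8 q ^ 2 / (qJ 1 q ^ 10 * qJ 4 q ^ 5)) \<and>
      (\<lambda>n. of_nat (N0 2 8 (8 * n + 7)) * q ^ n) sums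
        (- 1/2 * q powi (-1) + 1/2 * q powi (-1) * mock_g (-1) (q ^ 4)
         + 1/4 * q powi (-1) * (qJ 2 q ^ 6 * qJ 4 q / (qJ 1 q ^ 4 * qJ 8 q ^ 2))
         + 2 * (qJ 2 q ^ 8 * qJ 8 q ^ 2 / (qJ 1 q ^ 8 * qJ 4 q)))) \<and>
     ((\<lambda>n. of_nat (N0 3 8 (2 * n)) * q ^ n) sums
        (- 1/4 + 1/4 * mock_g (-1) (q ^ 4) - 1/2 * q ^ 4 * mock_g (q ^ 4) (q ^ 16)
         + 1/4 * (qJ 8 q ^ 7 / (qJ 4 q ^ 3 * qJ 16 q ^ 3))
         - 1/4 * (qJ 2 q ^ 5 * qJ 8 q ^ 2 / (qJ 1 q ^ 2 * qJ 4 q ^ 3 * qJ 16 q))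
         + 1/8 * (qJ 2 q ^ 6 * qJ 4 q / (qJ 1 q ^ 4 * qJ 8 q ^ 2))) \<and>
      (\<lambda>n. of_nat (N0 3 8 (4 * n)) * q ^ n) sums
        (- 1/4 + 1/4 * mock_g (-1) (q ^ 2) - 1/2 * q ^ 2 * mock_g (q ^ 2) (q ^ 8)
         + 1/4 * (qJ 4 q ^ 7 / (qJ 2 q ^ 3 * qJ 8 q ^ 3))
         - 1/4 * (qJ 4 q ^ 7 / (qJ 2 q ^ 3 * qJ 8 q ^ 3))
         + 1/8 * (qJ 2 q ^ 15 / (qJ 4 q ^ 6 * qJ 1 q ^ 8))) \<and>
      (\<lambda>n. of_nat (N0 3 8 (4 * n + 2)) * q ^ n) sums
        (1/2 * ((qJ 2 q ^ 3 * qJ 4 q ^ 2 / qJ 1 q ^ 4) - (qJ 4 q * qJ 8 q / qJ 2 q))) \<and>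
      (\<lambda>n. of_nat (N0 3 8 (8 * n)) * q ^ n) sums
        (- 1/4 + 1/4 * mock_g (-1) q - 1/2 * q * mock_g q (q ^ 4)
         + 1/8 * (qJ 2 q ^ 22 / (qJ 1 q ^ 13 * qJ 4 q ^ 8))
         + 2 * q * (qJ 4 q ^ 8 / (qJ 1 q ^ 5 * qJ 2 q ^ 2))) \<and>
      (\<lambda>n. of_nat (N0 3 8 (8 * n + 2)) * q ^ n) sums
        (1/2 * ((qJ 2 q ^ 16 / (qJ 1 q ^ 11 * qJ 4 q ^ 4)) - (qJ 2 q * qJ 4 q / qJ 1 q))) \<and>
      (\<lambda>n. of_nat (N0 3 8 (8 * n + 4)) * q ^ n) sums
        (qJ 2 q ^ 10 / qJ 1 q ^ 9) \<and>
      (\<lambda>n. of_nat (N0 3 8 (8 * n + 6)) * q ^ n) sums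
        (2 * (qJ 2 q ^ 4 * qJ 4 q ^ 4 / qJ 1 q ^ 7))) \<and>
     ((\<lambda>n. of_nat (N0 4 8 (2 * n + 1)) * q ^ n) sums
        (q powi (-3) - q powi (-3) * mock_g (-1) (q ^ 64)
         - 1/2 * q powi (-3) * (qJ 32 q ^ 6 * qJ 64 q / (qJ 16 q ^ 4 * qJ 128 q ^ 2))
         + 1/4 * ((qJ 2 q ^ 8 * qJ 8 q ^ 2 / (qJ 1 q ^ 4 * qJ 4 q ^ 5))
                  - 2 * (qJ 2 q ^ 5 * qJ 16 q / (qJ 1 q ^ 2 * qJ 4 q ^ 2 * qJ 8 q))
                  + (qJ 4 q ^ 3 / qJ 2 q ^ 2))
         + 1/2 * q * ((qJ 16 q ^ 3 / qJ 8 q ^ 2)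
                      - (qJ 8 q ^ 8 * qJ 32 q ^ 2 / (qJ 4 q ^ 4 * qJ 16 q ^ 5)))) \<and>
      (\<lambda>n. of_nat (N0 4 8 (4 * n + 1)) * q ^ n) sums
        (1/4 * ((qJ 2 q ^ 9 / (qJ 1 q ^ 6 * qJ 4 q ^ 2))
                - 2 * (qJ 4 q ^ 4 / (qJ 2 q ^ 2 * qJ 8 q)) + (qJ 2 q ^ 3 / qJ 1 q ^ 2))) \<and>
      (\<lambda>n. of_nat (N0 4 8 (4 * n + 3)) * q ^ n) sums
        (q powi (-2) - q powi (-2) * mock_g (-1) (q ^ 32)
         - 1/2 * q powi (-2) * (qJ 16 q ^ 6 * qJ 32 q / (qJ 8 q ^ 4 * qJ 64 q ^ 2))
         - 1/2 * (qJ 8 q ^ 3 / qJ 4 q ^ 2)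
         - 1/2 * (qJ 4 q ^ 8 * qJ 16 q ^ 2 / (qJ 2 q ^ 4 * qJ 8 q ^ 5))
         + (qJ 4 q ^ 6 / (qJ 2 q ^ 3 * qJ 1 q ^ 2))) \<and>
      (\<lambda>n. of_nat (N0 4 8 (8 * n + 1)) * q ^ n) sums
        (1/4 * (qJ 2 q ^ 12 * qJ 4 q / (qJ 1 q ^ 10 * qJ 8 q ^ 2))
         + 2 * q * (qJ 2 q ^ 2 * qJ 4 q ^ 3 * qJ 8 q ^ 2 / qJ 1 q ^ 6)
         - 1/2 * (qJ 2 q ^ 4 / (qJ 1 q ^ 2 * qJ 4 q))
         + 1/4 * (qJ 4 q ^ 5 / (qJ 1 q ^ 2 * qJ 8 q ^ 2))) \<and>
      (\<lambda>n. of_nat (N0 4 8 (8 * n + 3)) * q ^ n) sums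
        (q powi (-1) - q powi (-1) * mock_g (-1) (q ^ 16)
         - 1/2 * q powi (-1) * (qJ 8 q ^ 6 * qJ 16 q / (qJ 4 q ^ 4 * qJ 32 q ^ 2))
         - 1/2 * (qJ 4 q ^ 3 / qJ 2 q ^ 2)
         - 1/2 * (qJ 2 q ^ 8 * qJ 8 q ^ 2 / (qJ 1 q ^ 4 * qJ 4 q ^ 5))
         + (qJ 2 q ^ 6 * qJ 4 q ^ 5 / (qJ 1 q ^ 8 * qJ 8 q ^ 2))) \<and>
      (\<lambda>n. of_nat (N0 4 8 (8 * n + 5)) * q ^ n) sums
        (2 * (qJ 4 q ^ 9 / (qJ 1 q ^ 6 * qJ 8 q ^ 2))) \<and>
      (\<lambda>n. of_nat (N0 4 8 (8 * n + 7)) * q ^ n) sums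
        (2 * (qJ 2 q ^ 8 * qJ 8 q ^ 2 / (qJ 1 q ^ 8 * qJ 4 q))))"
proof -
  note gfs =
    N0_0_odd N0_0_4n[THEN conjunct1] N0_0_4n[THEN conjunct2]
    N0_0_8n_1[THEN conjunct1] N0_0_8n_1[THEN conjunct2] N0_0_8n_3[THEN conjunct1]
    N0_0_8n_3[THEN conjunct2] N0_1_even N0_1_4n[THEN conjunct1]
    N0_1_4n[THEN conjunct2] N0_1_8n[THEN conjunct1] N0_1_8n[THEN conjunct2]
    N0_1_8n_2[THEN conjunct1] N0_1_8n_2[THEN conjunct2] N0_2_odd
    N0_2_4n[THEN conjunct1] N0_2_4n[THEN conjunct2] N0_2_8n_1[THEN conjunct1]
    N0_2_8n_1[THEN conjunct2] N0_2_8n_3[THEN conjunct1] N0_2_8n_3[THEN conjunct2]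
    N0_3_even N0_3_4n[THEN conjunct1] N0_3_4n[THEN conjunct2]
    N0_3_8n[THEN conjunct1] N0_3_8n[THEN conjunct2] N0_3_8n_2[THEN conjunct1]
    N0_3_8n_2[THEN conjunct2] N0_4_odd N0_4_4n[THEN conjunct1]
    N0_4_4n[THEN conjunct2] N0_4_8n_1[THEN conjunct1] N0_4_8n_1[THEN conjunct2]
    N0_4_8n_3[THEN conjunct1] N0_4_8n_3[THEN conjunct2]
  show ?thesis
    by (intro conjI gfs[THEN has_gfD, OF assms])
qed

end
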